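(* Let $\Omega=\mathbb{R}$ or $\Omega=\mathbb{T}$, let $M>0$, $\nu\ge0$, $\alpha\ge0$ with $\min\{\nu,\alpha\}=0$. Then for every sufficiently small $\delta>0$ there exist $u_0\in H^2(\Omega)$ with $0\le u_0\le1$ and $T^*<\infty$ such that the corresponding solution $u(t)$ of $$\partial_t u+\partial_x\left[\frac{u^2}{u^2+M(1-u)^2}\right]=-\nu\Lambda^\alpha u,\qquad x\in\Omega,\ t>0,\qquad u(x,0)=u_0(x),$$ has a finite time singularity in $C^\delta$, i.e. $$\limsup_{t\to T^*}\|u(t)\|_{C^\delta}=\infty.$$
   Context: $\mathbb{T}$ is the one-dimensional torus of length $2\pi$. $\Lambda^\alpha=(-\Delta)^{\alpha/2}$ is the fractional Laplacian, $\widehat{\Lambda^\alpha u}(\xi)=|\xi|^\alpha\hat u(\xi)$; in particular $\Lambda^0u=u$. Thus the condition $\min\{\nu,\alpha\}=0$ means that the right-hand side is either $0$ or $-\nu u$. $C^\delta$ denotes the Hölder space of exponent $\delta$. *)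

theory Defs
  imports "HOL-Analysis.Analysis"
begin

text \<open>
  The spatial domain is the real line or the torus of length \<open>2\<pi>\<close>. Functions on the torus are
  rendered as \<open>2\<pi>\<close>-periodic functions on the reals and are integrated over one period.
\<close>

datatype spatial_domain = Line | Torus

definition cell :: "spatial_domain \<Rightarrow> real set" where
  "cell \<Omega> = (case \<Omega> of Line \<Rightarrow> UNIV | Torus \<Rightarrow> {-pi..pi})"

definition function_on :: "spatial_domain \<Rightarrow> (real \<Rightarrow> 'a) \<Rightarrow> bool" where
  "function_on \<Omega> u \<longleftrightarrow> (case \<Omega> of Line \<Rightarrow> True | Torus \<Rightarrow> (\<forall>x. u (x + 2 * pi) = u x))"

definition L2 :: "spatial_domain \<Rightarrow> (real \<Rightarrow> real) set" where
  "L2 \<Omega> = {u. function_on \<Omega> u \<and> u \<in> borel_measurable lborel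
               \<and> set_integrable lborel (cell \<Omega>) (\<lambda>x. (u x)\<^sup>2)}"

definition smooth :: "(real \<Rightarrow> 'a::real_normed_vector) \<Rightarrow> bool" where
  "smooth \<phi> \<longleftrightarrow> (\<exists>D :: nat \<Rightarrow> real \<Rightarrow> 'a. D 0 = \<phi> \<and>
     (\<forall>n x. (D n has_vector_derivative D (Suc n) x) (at x)))"

definition test_function :: "spatial_domain \<Rightarrow> (real \<Rightarrow> real) \<Rightarrow> bool" where
  "test_function \<Omega> \<phi> \<longleftrightarrow> smooth \<phi> \<and> function_on \<Omega> \<phi> \<and> (\<Omega> = Line \<longrightarrow> bounded {x. \<phi> x \<noteq> 0})"

definition has_weak_derivative ::
    "spatial_domain \<Rightarrow> (real \<Rightarrow> real) \<Rightarrow> (real \<Rightarrow> real) \<Rightarrow> bool" where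
  "has_weak_derivative \<Omega> u v \<longleftrightarrow> (\<forall>\<phi>. test_function \<Omega> \<phi> \<longrightarrow>
     (LINT x:cell \<Omega>|lborel. u x * deriv \<phi> x) = - (LINT x:cell \<Omega>|lborel. v x * \<phi> x))"

text \<open>The weak derivative in \<open>L\<^sup>2\<close> is unique only up to null sets; it is used below only inside integrals.\<close>

definition weak_derivative :: "spatial_domain \<Rightarrow> (real \<Rightarrow> real) \<Rightarrow> real \<Rightarrow> real" where
  "weak_derivative \<Omega> u = (SOME v. v \<in> L2 \<Omega> \<and> has_weak_derivative \<Omega> u v)"

text \<open>Elements of \<open>H\<^sup>2\<close> are identified with their continuous representatives.\<close>

definition H2 :: "spatial_domain \<Rightarrow> (real \<Rightarrow> real) set" where
  "H2 \<Omega> = {u \<in> L2 \<Omega>. continuous_on UNIV u \<and>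
     (\<exists>v\<in>L2 \<Omega>. \<exists>w\<in>L2 \<Omega>. has_weak_derivative \<Omega> u v \<and> has_weak_derivative \<Omega> v w)}"

definition H2_norm :: "spatial_domain \<Rightarrow> (real \<Rightarrow> real) \<Rightarrow> real" where
  "H2_norm \<Omega> u = sqrt
     ((LINT x:cell \<Omega>|lborel. (u x)\<^sup>2)
      + (LINT x:cell \<Omega>|lborel. (weak_derivative \<Omega> u x)\<^sup>2)
      + (LINT x:cell \<Omega>|lborel. (weak_derivative \<Omega> (weak_derivative \<Omega> u) x)\<^sup>2))"

text \<open>
  For a periodic function, the supremum over all pairs of distinct reals equals the supremum with
  respect to the distance of the torus, so one formula serves both domains.
\<close>

definition holder_norm :: "real \<Rightarrow> (real \<Rightarrow> real) \<Rightarrow> ereal" where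
  "holder_norm \<delta> u = (SUP x. ereal \<bar>u x\<bar>)
     + (SUP (x, y)\<in>{(x, y). x \<noteq> y}. ereal (\<bar>u x - u y\<bar> / \<bar>x - y\<bar> powr \<delta>))"

text \<open>The symbol \<open>|\<xi>|\<^sup>\<alpha>\<close> with \<open>|0|\<^sup>0 = 1\<close>, whereas \<open>0 powr 0 = 0\<close>.\<close>

definition frac_symbol :: "real \<Rightarrow> real \<Rightarrow> real" where
  "frac_symbol \<alpha> \<xi> = (if \<alpha> = 0 then 1 else \<bar>\<xi>\<bar> powr \<alpha>)"

definition schwartz :: "(real \<Rightarrow> complex) \<Rightarrow> bool" where
  "schwartz \<phi> \<longleftrightarrow> (\<exists>D :: nat \<Rightarrow> real \<Rightarrow> complex. D 0 = \<phi> \<and>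
     (\<forall>n x. (D n has_vector_derivative D (Suc n) x) (at x)) \<and>
     (\<forall>n m. bounded (range (\<lambda>x. (x ^ m) *\<^sub>R D n x))))"

definition fourier_integral :: "(real \<Rightarrow> complex) \<Rightarrow> real \<Rightarrow> complex" where
  "fourier_integral \<phi> \<xi> = (LINT x|lborel. \<phi> x * cis (- (x * \<xi>)))"

definition fourier_coeff :: "(real \<Rightarrow> real) \<Rightarrow> int \<Rightarrow> complex" where
  "fourier_coeff u k =
     (LINT x:{-pi..pi}|lborel. complex_of_real (u x) * cis (- (x * of_int k))) / (2 * pi)"

text \<open>
  \<open>g = \<Lambda>\<^sup>\<alpha> u\<close>, i.e. \<open>g^(\<xi>) = |\<xi>|\<^sup>\<alpha> u^(\<xi>)\<close> where \<open>^\<close> is the Fourier transform. On the line the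
  transform of a function in \<open>L\<^sup>2\<close> is that of a tempered distribution, \<open>\<langle>g^, \<phi>\<rangle> = \<langle>g, \<phi>^\<rangle>\<close> for
  Schwartz functions \<open>\<phi>\<close>; hence the identity reads \<open>\<langle>g, \<phi>^\<rangle> = \<langle>u, (|\<cdot>|\<^sup>\<alpha> \<phi>)^\<rangle>\<close>.
\<close>

definition is_frac_laplacian ::
    "spatial_domain \<Rightarrow> real \<Rightarrow> (real \<Rightarrow> real) \<Rightarrow> (real \<Rightarrow> real) \<Rightarrow> bool" where
  "is_frac_laplacian \<Omega> \<alpha> u g \<longleftrightarrow> (case \<Omega> of
     Line \<Rightarrow> (\<forall>\<phi>. schwartz \<phi> \<longrightarrow>
       (LINT x|lborel. complex_of_real (g x) * fourier_integral \<phi> x)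
       = (LINT x|lborel. complex_of_real (u x)
            * fourier_integral (\<lambda>\<xi>. complex_of_real (frac_symbol \<alpha> \<xi>) * \<phi> \<xi>) x))
   | Torus \<Rightarrow> (\<forall>k. fourier_coeff g k
       = complex_of_real (frac_symbol \<alpha> (of_int k)) * fourier_coeff u k))"

text \<open>
  The continuous representative of \<open>\<Lambda>\<^sup>\<alpha> u\<close> in \<open>L\<^sup>2\<close>. If there is none (possible for large \<open>\<alpha>\<close>), the value
  is unspecified; below it is then multiplied by \<open>\<nu> = 0\<close>, because \<open>min \<nu> \<alpha> = 0\<close>.
\<close>

definition frac_laplacian :: "spatial_domain \<Rightarrow> real \<Rightarrow> (real \<Rightarrow> real) \<Rightarrow> real \<Rightarrow> real" where
  "frac_laplacian \<Omega> \<alpha> u =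
     (THE g. g \<in> L2 \<Omega> \<and> continuous_on UNIV g \<and> is_frac_laplacian \<Omega> \<alpha> u g)"

definition flux :: "real \<Rightarrow> real \<Rightarrow> real" where
  "flux M u = u\<^sup>2 / (u\<^sup>2 + M * (1 - u)\<^sup>2)"

text \<open>
  Solutions in \<open>C([0,T); H\<^sup>2)\<close>, the first argument of \<open>u\<close> being time. In this class
  \<open>\<partial>\<^sub>x (flux M u)\<close> is continuous, so the equation is understood in the classical sense.
\<close>

definition H2_solution ::
    "spatial_domain \<Rightarrow> real \<Rightarrow> real \<Rightarrow> real \<Rightarrow> (real \<Rightarrow> real) \<Rightarrow> real \<Rightarrow> (real \<Rightarrow> real \<Rightarrow> real) \<Rightarrow> bool" where
  "H2_solution \<Omega> M \<nu> \<alpha> u\<^sub>0 T u \<longleftrightarrow>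
     (\<forall>t\<in>{0..<T}. u t \<in> H2 \<Omega>) \<and>
     (\<forall>t\<in>{0..<T}. ((\<lambda>s. H2_norm \<Omega> (\<lambda>x. u s x - u t x)) \<longlongrightarrow> 0) (at t within {0..<T})) \<and>
     u 0 = u\<^sub>0 \<and>
     (\<forall>t\<in>{0<..<T}. \<forall>x. \<exists>u\<^sub>t F\<^sub>x.
        ((\<lambda>s. u s x) has_real_derivative u\<^sub>t) (at t) \<and>
        ((\<lambda>y. flux M (u t y)) has_real_derivative F\<^sub>x) (at x) \<and>
        u\<^sub>t + F\<^sub>x = - \<nu> * frac_laplacian \<Omega> \<alpha> (u t) x)"

text \<open>\<open>u\<close> is the solution on \<open>[0,T)\<close>; its values at other times are irrelevant.\<close>

definition the_H2_solution ::
    "spatial_domain \<Rightarrow> real \<Rightarrow> real \<Rightarrow> real \<Rightarrow> (real \<Rightarrow> real) \<Rightarrow> real \<Rightarrow> (real \<Rightarrow> real \<Rightarrow> real) \<Rightarrow> bool" where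
  "the_H2_solution \<Omega> M \<nu> \<alpha> u\<^sub>0 T u \<longleftrightarrow>
     H2_solution \<Omega> M \<nu> \<alpha> u\<^sub>0 T u \<and>
     (\<forall>v. H2_solution \<Omega> M \<nu> \<alpha> u\<^sub>0 T v \<longrightarrow> (\<forall>t\<in>{0..<T}. v t = u t))"

end

theory Submission
  imports Defs "HOL-Probability.Characteristic_Functions"
begin

text \<open>
  The proof uses the method of characteristics. Since \<open>min \<nu> \<alpha> = 0\<close>, the right-hand side is \<open>- \<nu> u\<close>
  in both cases, so a characteristic carries a value \<open>v\<close> that decays like \<open>exp (- \<nu> t) v\<close> and it moves
  with the speed \<open>f' (exp (- \<nu> t) v)\<close>, where \<open>f\<close> is the flux. A solution is thus an assignment of values
  and positions to labels \<open>\<theta>\<close>, and the singularity can be prescribed instead of detected: the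
  label \<open>\<theta>\<close> carries \<open>U \<theta>\<close>, its position at the singular time \<open>1\<close> is a chosen \<open>P \<theta>\<close>, and so its position
  at time \<open>t\<close> is \<open>X t \<theta> = P \<theta> - \<Gamma> t (U \<theta>)\<close>, where \<open>\<Gamma> t v\<close> is the displacement between the times \<open>t\<close>
  and \<open>1\<close>. The function \<open>P\<close> is nondecreasing, and it is constant on an interval on which \<open>U\<close> decreases. The
  characteristics with these labels all meet at time \<open>1\<close>: the limit has a jump, so the norm of \<open>C\<^sup>\<delta>\<close> diverges
  for every \<open>\<delta> > 0\<close>, with one initial datum for all \<open>\<delta>\<close> (\<open>u_blowup\<close>).

  Before time \<open>1\<close> the map \<open>X t\<close> is a diffeomorphism. Indeed the flux is strictly convex near \<open>0\<close>, so that
  \<open>\<Gamma> t\<close> is increasing on small values for \<open>t < 1\<close>; where \<open>U\<close> decreases this pushes the derivative of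
  \<open>X t\<close> above \<open>P'\<close>, and where \<open>U\<close> increases \<open>P'\<close> is bounded below and \<open>U\<close> is chosen small (\<open>shock_exists\<close>).
  Hence \<open>u t x = exp (- \<nu> t) U (Y t x)\<close>, with \<open>Y t\<close> inverse to \<open>X t\<close>, is twice continuously differentiable
  in \<open>x\<close>, with derivatives continuous in \<open>(t, x)\<close>, and solves the equation (\<open>u_solution\<close>).

  Uniqueness is proved pointwise. If \<open>v\<close> is another solution in \<open>C([0,1); H\<^sup>2)\<close>, then
  \<open>m t = v t (X t \<theta>) - u t (X t \<theta>)\<close>, taken along a characteristic of the known solution \<open>u\<close>, satisfies
  \<open>m' = v\<^sub>x (f' (u) - f' (v)) - \<nu> m\<close>, and Gronwall's lemma gives \<open>m = 0\<close> because \<open>v\<^sub>x\<close> is locally bounded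
  (\<open>solution_unique\<close>).

  What links this with the definition of \<open>H\<^sup>2\<close> by weak derivatives are three facts: a function in \<open>H\<^sup>2\<close>
  is continuously differentiable, and it is bounded with its derivative by the norm
  (\<open>Sobolev_embedding\<close>); weak derivatives are unique almost everywhere, so that the norm of a
  classical function is given by its classical derivatives (\<open>C2_in_H2\<close>); and the operator of order
  zero is the identity (\<open>frac_laplacian_zero\<close>).
\<close>

section \<open>Smooth functions and mollifiers\<close>

text \<open>
  Smoothness is the existence of all derivatives at once, as one sequence. A set of functions that is
  closed under taking a derivative provides such a sequence.
\<close>

lemma smooth_coinduct:
  assumes "\<phi> \<in> S" and "\<And>g. g \<in> S \<Longrightarrow> \<exists>g'\<in>S. \<forall>x. (g has_vector_derivative g' x) (at x)"
  shows "smooth \<phi>"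
proof -
  obtain d where d: "\<And>g. g \<in> S \<Longrightarrow> d g \<in> S \<and> (\<forall>x. (g has_vector_derivative d g x) (at x))"
    using assms(2) by metis
  have "(d ^^ n) \<phi> \<in> S" for n
    by (induction n) (use assms(1) d in auto)
  then show ?thesis
    unfolding smooth_def by (intro exI[of _ "\<lambda>n. (d ^^ n) \<phi>"]) (use d in auto)
qed

lemma smooth_antideriv:
  assumes "smooth \<phi>" and "\<And>x. (\<Phi> has_vector_derivative \<phi> x) (at x)"
  shows "smooth \<Phi>"
proof -
  obtain D where D: "D 0 = \<phi>" "\<And>n x. (D n has_vector_derivative D (Suc n) x) (at x)"
    using assms(1) unfolding smooth_def by auto
  have "((case n of 0 \<Rightarrow> \<Phi> | Suc k \<Rightarrow> D k) has_vector_derivative D n x) (at x)" for n x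
    using D assms(2) by (cases n) auto
  then show ?thesis
    unfolding smooth_def by (intro exI[of _ "\<lambda>n. case n of 0 \<Rightarrow> \<Phi> | Suc k \<Rightarrow> D k"]) auto
qed

lemma smooth_diff:
  assumes "smooth f" "smooth g" shows "smooth (\<lambda>x. f x - g x)"
proof -
  obtain D where D: "D 0 = f" "\<And>n x. (D n has_vector_derivative D (Suc n) x) (at x)"
    using assms(1) unfolding smooth_def by auto
  obtain E where E: "E 0 = g" "\<And>n x. (E n has_vector_derivative E (Suc n) x) (at x)"
    using assms(2) unfolding smooth_def by auto
  show ?thesis
    unfolding smooth_def by (rule exI[of _ "\<lambda>n x. D n x - E n x"])
      (use D E in \<open>auto intro!: has_vector_derivative_diff\<close>)
qed

lemma smooth_rescale:
  fixes f :: "real \<Rightarrow> real"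
  assumes "smooth f" shows "smooth (\<lambda>x. c * f (b * x + a))"
proof -
  obtain D where D: "D 0 = f" "\<And>n x. (D n has_vector_derivative D (Suc n) x) (at x)"
    using assms(1) unfolding smooth_def by auto
  show ?thesis
    unfolding smooth_def
  proof (rule exI[of _ "\<lambda>n x. c * b ^ n * D n (b * x + a)"], intro conjI allI)
    show "(\<lambda>x. c * b ^ 0 * D 0 (b * x + a)) = (\<lambda>x. c * f (b * x + a))" using D by simp
    fix n x
    have "(D n has_real_derivative D (Suc n) (b * x + a)) (at (b * x + a))"
      using D(2) by (simp add: has_real_derivative_iff_has_vector_derivative)
    then have "((\<lambda>x. D n (b * x + a)) has_real_derivative D (Suc n) (b * x + a) * b) (at x)"
      by (rule DERIV_chain2) (auto intro!: derivative_eq_intros)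
    from DERIV_cmult[OF this, of "c * b ^ n"]
    show "((\<lambda>x. c * b ^ n * D n (b * x + a)) has_vector_derivative c * b ^ Suc n * D (Suc n) (b * x + a)) (at x)"
      by (simp add: has_real_derivative_iff_has_vector_derivative mult_ac)
  qed
qed

lemma smooth_deriv:
  fixes f :: "real \<Rightarrow> real"
  assumes "smooth f"
  shows "smooth (deriv f)" "\<And>x. (f has_real_derivative deriv f x) (at x)"
proof -
  obtain D where D: "D 0 = f" "\<And>n x. (D n has_vector_derivative D (Suc n) x) (at x)"
    using assms(1) unfolding smooth_def by auto
  have E: "(f has_real_derivative D 1 x) (at x)" for x
    using D(2)[of 0 x] by (simp add: has_real_derivative_iff_has_vector_derivative D(1))
  then have "deriv f x = D 1 x" for x
    by (rule DERIV_imp_deriv)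
  then have *: "deriv f = D 1" by auto
  then show "\<And>x. (f has_real_derivative deriv f x) (at x)" using E by auto
  show "smooth (deriv f)" unfolding * smooth_def
    by (rule exI[of _ "\<lambda>n. D (Suc n)"]) (use D in auto)
qed

lemma smooth_continuous: "smooth (f :: real \<Rightarrow> real) \<Longrightarrow> continuous_on S f"
  using smooth_deriv(2) by (meson DERIV_continuous_on has_field_derivative_at_within)

text \<open>
  For \<open>p = 1\<close> and \<open>k = 0\<close> this is the usual bump function. The polynomial factor and the power of the
  denominator make the family closed under differentiation.
\<close>

definition bump_family :: "real poly \<Rightarrow> nat \<Rightarrow> real \<Rightarrow> real" where
  "bump_family p k x = (if \<bar>x\<bar> < 1 then poly p x / (1 - x\<^sup>2) ^ k * exp (- 1 / (1 - x\<^sup>2)) else 0)"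

lemma exp_inverse_div_power_le:
  fixes q :: real assumes "q > 0"
  shows "exp (- 1 / q) / q ^ k \<le> real k ^ k"
proof (cases "k = 0")
  case True
  then show ?thesis using assms by simp
next
  case False
  have "(1 / (q * k)) ^ k \<le> (1 + (1 / q) / k) ^ k"
    using assms by (intro power_mono) auto
  also have "\<dots> \<le> exp (1 / q)"
    using False assms by (intro exp_ge_one_plus_x_over_n_power_n) (auto intro: order_trans[of _ 0])
  finally have "1 \<le> exp (1 / q) * (q ^ k * real k ^ k)"
    using assms False by (simp add: field_simps power_mult_distrib)
  then show ?thesis
    using assms False by (simp add: field_simps exp_minus)
qed

definition bump_family_deriv :: "real poly \<Rightarrow> nat \<Rightarrow> real poly" where
  "bump_family_deriv p k = pderiv p * [:1, 0, -1:] ^ 2 + smult (2 * k) ([:0, 1:] * p * [:1, 0, -1:]) - smult 2 ([:0, 1:] * p)"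

text \<open>
  Only the points \<open>1\<close> and \<open>- 1\<close> are delicate. There the exponential beats every power of \<open>1 - x\<^sup>2\<close>, so
  each member of the family is bounded by a multiple of the squared distance to the point.
\<close>

lemma bump_family_has_derivative:
  "(bump_family p k has_real_derivative bump_family (bump_family_deriv p k) (k + 2) x) (at x)"
proof -
  consider "\<bar>x\<bar> < 1" | "\<bar>x\<bar> > 1" | "\<bar>x\<bar> = 1" by linarith
  then show ?thesis
  proof cases
    case 1
    then have q: "1 - x\<^sup>2 > 0" by (simp add: abs_square_less_1)
    have "((\<lambda>x. poly p x / (1 - x\<^sup>2) ^ k * exp (- 1 / (1 - x\<^sup>2))) has_real_derivative
        bump_family (bump_family_deriv p k) (k + 2) x) (at x)"
      apply (rule derivative_eq_intros refl | use q in force)+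
      subgoal
        using q 1
        apply (simp add: bump_family_def bump_family_deriv_def)
        apply (cases k)
        apply (simp_all add: divide_simps)
        apply (simp_all add: power2_eq_square algebra_simps)
        done
      done
    moreover have "open {x::real. \<bar>x\<bar> < 1}" by (intro open_Collect_less continuous_intros)
    ultimately show ?thesis
      using 1 by (rule_tac has_field_derivative_transform_within_open[where S="{x. \<bar>x\<bar> < 1}"])
        (auto simp: bump_family_def)
  next
    case 2
    have "((\<lambda>x. 0) has_real_derivative 0) (at x)" by simp
    moreover have "open {x::real. \<bar>x\<bar> > 1}" by (intro open_Collect_less continuous_intros)
    ultimately show ?thesis
      using 2 by (rule_tac has_field_derivative_transform_within_open[where S="{x. \<bar>x\<bar> > 1}" and f="\<lambda>_. 0"])
        (auto simp: bump_family_def)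
  next
    case 3
    obtain B where B: "\<And>y. y \<in> {-1..1} \<Longrightarrow> \<bar>poly p y\<bar> \<le> B"
      using compact_imp_bounded[OF compact_continuous_image[of "{-1..1}" "poly p"]]
      by (force simp: bounded_iff intro: continuous_intros)
    then have B0: "B \<ge> 0" by (metis abs_ge_zero atLeastAtMost_iff neg_le_0_iff_le order_trans zero_le_one)
    define C where "C = B * real (k + 2) ^ (k + 2) * 4"
    have bd: "\<bar>bump_family p k y\<bar> \<le> C * \<bar>y - x\<bar>\<^sup>2" for y
    proof (cases "\<bar>y\<bar> < 1")
      case True
      then have q: "1 - y\<^sup>2 > 0" by (simp add: abs_square_less_1)
      define q where "q = 1 - y\<^sup>2"
      have q1: "q > 0" using q by (simp add: q_def)
      have q2: "q \<le> 2 * \<bar>y - x\<bar>"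
      proof -
        have "x = 1 \<or> x = -1" using 3 by auto
        then have "q = \<bar>y - x\<bar> * \<bar>y + x\<bar>"
          using q1 unfolding abs_mult[symmetric] q_def by (auto simp: algebra_simps power2_eq_square)
        also have "\<dots> \<le> \<bar>y - x\<bar> * 2" using True 3 by (intro mult_left_mono) auto
        finally show ?thesis by simp
      qed
      have "\<bar>bump_family p k y\<bar> = \<bar>poly p y\<bar> * (exp (- 1 / q) / q ^ (k + 2)) * q\<^sup>2"
        using True q1 unfolding bump_family_def q_def[symmetric] by (simp add: abs_mult power_add power2_eq_square[of q])
      also have "\<dots> \<le> B * (real (k + 2) ^ (k + 2)) * (2 * \<bar>y - x\<bar>)\<^sup>2"
        using True q1 q2 B0 by (intro mult_mono B exp_inverse_div_power_le power_mono mult_nonneg_nonneg) auto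
      also have "\<dots> = C * \<bar>y - x\<bar>\<^sup>2" by (simp add: C_def power_mult_distrib)
      finally show ?thesis .
    qed (use B0 in \<open>auto simp: bump_family_def C_def\<close>)
    have z: "bump_family q l x = 0" for q l using 3 by (simp add: bump_family_def)
    have "((\<lambda>y. (bump_family p k y - bump_family p k x) / (y - x)) \<longlongrightarrow> 0) (at x)"
    proof (rule Lim_null_comparison)
      show "\<forall>\<^sub>F y in at x. norm ((bump_family p k y - bump_family p k x) / (y - x)) \<le> C * \<bar>y - x\<bar>"
        using bd by (intro always_eventually)
          (auto simp: z divide_simps power2_eq_square mult_ac abs_mult)
      show "((\<lambda>y. C * \<bar>y - x\<bar>) \<longlongrightarrow> 0) (at x)"
        by (auto intro!: tendsto_eq_intros)
    qed
    then show ?thesis by (simp add: z has_field_derivative_iff)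
  qed
qed

lemma smooth_bump_family: "smooth (bump_family p k)"
proof (rule smooth_coinduct[where S="range (\<lambda>(p, k). bump_family p k)"])
  show "bump_family p k \<in> range (\<lambda>(p, k). bump_family p k)" by auto
  fix g assume "g \<in> range (\<lambda>(p, k). bump_family p k)"
  then obtain p k where g: "g = bump_family p k" by auto
  show "\<exists>g'\<in>range (\<lambda>(p, k). bump_family p k). \<forall>x. (g has_vector_derivative g' x) (at x)"
    by (rule bexI[of _ "bump_family (bump_family_deriv p k) (k + 2)"])
      (use bump_family_has_derivative in \<open>auto simp: g has_real_derivative_iff_has_vector_derivative[symmetric]\<close>)
qed

lemma continuous_antiderivative:
  fixes f :: "real \<Rightarrow> real"
  assumes "continuous_on UNIV f"
  shows "\<exists>F. (\<forall>x. (F has_real_derivative f x) (at x)) \<and> F a = c"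
proof -
  obtain F where F: "\<And>x. (F has_vector_derivative f x) (at x)"
    using einterval_antiderivative[of "-\<infinity>" "\<infinity>" f] assms
    by (auto simp: continuous_on_eq_continuous_at)
  show ?thesis
    by (rule exI[of _ "\<lambda>x. F x - F a + c"])
      (use F in \<open>auto intro!: derivative_eq_intros simp: has_real_derivative_iff_has_vector_derivative[symmetric]\<close>)
qed

lemma zero_derivative_imp_eq:
  fixes f :: "real \<Rightarrow> real"
  assumes "a \<le> b" "\<And>x. a \<le> x \<Longrightarrow> x \<le> b \<Longrightarrow> (f has_real_derivative 0) (at x)"
  shows "f a = f b"
proof (cases "a = b")
  case False
  have "continuous_on {a..b} f"
    using assms(2) by (auto intro!: continuous_at_imp_continuous_on DERIV_isCont)
  then show ?thesis
    using DERIV_isconst2[of a b f b] assms False by auto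
qed simp

text \<open>
  The kernel \<open>r\<close> and its first two primitives are smoothings of the Dirac mass, of the Heaviside function
  and of the positive part. The identity \<open>R x = x\<close> on the right says that \<open>r\<close> has mean zero; it makes
  combinations of translates of \<open>R\<close> compactly supported as soon as those of the positive part are.
\<close>

locale mollifier =
  fixes r R\<^sub>1 R :: "real \<Rightarrow> real" and B :: real
  assumes smooth_R: "smooth R" and smooth_R1: "smooth R\<^sub>1" and smooth_r: "smooth r"
    and R_deriv: "\<And>x. (R has_real_derivative R\<^sub>1 x) (at x)"
    and R1_deriv: "\<And>x. (R\<^sub>1 has_real_derivative r x) (at x)"
    and r_nonneg: "\<And>x. 0 \<le> r x" and r_le: "\<And>x. r x \<le> B" and r_support: "\<And>x. \<bar>x\<bar> \<ge> 1 \<Longrightarrow> r x = 0"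
    and R1_nonneg: "\<And>x. 0 \<le> R\<^sub>1 x" and R1_le_1: "\<And>x. R\<^sub>1 x \<le> 1"
    and R1_left: "\<And>x. x \<le> -1 \<Longrightarrow> R\<^sub>1 x = 0" and R1_right: "\<And>x. x \<ge> 1 \<Longrightarrow> R\<^sub>1 x = 1"
    and R_left: "\<And>x. x \<le> -1 \<Longrightarrow> R x = 0" and R_right: "\<And>x. x \<ge> 1 \<Longrightarrow> R x = x"

lemma mollifier_exists: "\<exists>r R\<^sub>1 R B. mollifier r R\<^sub>1 R B"
proof -
  define r0 where "r0 = bump_family 1 0"
  have s0: "smooth r0" by (simp add: r0_def smooth_bump_family)
  have r0: "r0 x \<ge> 0" "r0 (-x) = r0 x" "\<bar>x\<bar> \<ge> 1 \<Longrightarrow> r0 x = 0" "r0 0 > 0" for x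
    by (auto simp: r0_def bump_family_def)
  obtain Q where Q: "\<And>x. (Q has_real_derivative r0 x) (at x)" "Q (-1) = 0"
    using continuous_antiderivative[OF smooth_continuous[OF s0]] by metis
  have Qmono: "Q x \<le> Q y" if "x \<le> y" for x y
    using that Q(1) r0(1) by (rule_tac DERIV_nonneg_imp_nondecreasing[of x y Q]) auto
  have Qpos: "Q 1 > 0"
  proof (rule ccontr)
    assume "\<not> Q 1 > 0"
    then have z: "Q x = 0" if "x \<in> {-1<..<1}" for x
      using Qmono[of "-1" x] Qmono[of x 1] Q(2) that by auto
    have "(Q has_real_derivative 0) (at 0)"
      by (rule has_field_derivative_transform_within_open[of "\<lambda>_. 0" _ _ "{-1<..<1}"]) (auto simp: z)
    with Q(1)[of 0] r0(4) show False using DERIV_unique by fastforce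
  qed
  define r where "r x = r0 x / Q 1" for x
  define R1 where "R1 x = Q x / Q 1" for x
  have dR1: "(R1 has_real_derivative r x) (at x)" for x
    unfolding R1_def r_def using Q(1) by (rule DERIV_cdivide)
  have sr: "smooth r" using smooth_rescale[OF s0, of "1 / Q 1" 1 0] by (simp add: r_def[abs_def])
  have sR1: "smooth R1"
    by (rule smooth_antideriv[OF sr]) (use dR1 in \<open>simp add: has_real_derivative_iff_has_vector_derivative\<close>)
  have Ql: "Q x = 0" if "x \<le> -1" for x
  proof -
    have "(Q has_real_derivative 0) (at y)" if "y \<le> -1" for y
      using Q(1)[of y] r0(3)[of y] that by simp
    from zero_derivative_imp_eq[OF that this] Q(2) show ?thesis by simp
  qed
  have Qr: "Q x = Q 1" if "x \<ge> 1" for x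
  proof -
    have "(Q has_real_derivative 0) (at y)" if "1 \<le> y" for y
      using Q(1)[of y] r0(3)[of y] that by simp
    from zero_derivative_imp_eq[OF that this] show ?thesis by simp
  qed
  have R1: "0 \<le> R1 x" "R1 x \<le> 1" "x \<le> -1 \<Longrightarrow> R1 x = 0" "x \<ge> 1 \<Longrightarrow> R1 x = 1" for x
  proof -
    show "x \<le> -1 \<Longrightarrow> R1 x = 0" "x \<ge> 1 \<Longrightarrow> R1 x = 1" using Ql[of x] Qr[of x] Qpos by (simp_all add: R1_def)
    show "0 \<le> R1 x" using Qpos Qmono[of "-1" x] Ql[of x] Q(2) by (cases "x \<le> -1") (auto simp: R1_def)
    show "R1 x \<le> 1" using Qpos Qmono[of x 1] Qr[of x] by (cases "x \<ge> 1") (auto simp: R1_def)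
  qed
  obtain R where R: "\<And>x. (R has_real_derivative R1 x) (at x)" "R (-1) = 0"
    using continuous_antiderivative[OF smooth_continuous[OF sR1]] by metis
  have sR: "smooth R"
    by (rule smooth_antideriv[OF sR1]) (use R in \<open>simp add: has_real_derivative_iff_has_vector_derivative\<close>)
  have Rl: "R x = 0" if "x \<le> -1" for x
  proof -
    have "(R has_real_derivative 0) (at y)" if "y \<le> -1" for y
      using R(1)[of y] R1(3)[of y] that by simp
    from zero_derivative_imp_eq[OF that this] R(2) show ?thesis by simp
  qed
  \<comment> \<open>This is where the evenness of the kernel enters: it yields \<open>R 1 = 1\<close>.\<close>
  have sym: "R1 x + R1 (-x) = 1" if "x \<le> 1" for x
  proof -
    have "((\<lambda>x. R1 x + R1 (-x)) has_real_derivative 0) (at y)" for y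
    proof -
      have "((\<lambda>x. R1 (-x)) has_real_derivative r (-y) * (-1)) (at y)"
        by (rule DERIV_chain2[OF dR1]) (auto intro!: derivative_eq_intros)
      from DERIV_add[OF dR1 this] show ?thesis using r0(2) by (simp add: r_def)
    qed
    from zero_derivative_imp_eq[of x 1 "\<lambda>x. R1 x + R1 (-x)", OF that this] R1(3)[of "-1"] R1(4)[of 1]
    show ?thesis by simp
  qed
  have Rone: "R 1 = 1"
  proof -
    have "((\<lambda>x. R x - R (-x) - x) has_real_derivative 0) (at y)" if "0 \<le> y" "y \<le> 1" for y
    proof -
      have "((\<lambda>x. R (-x)) has_real_derivative R1 (-y) * (-1)) (at y)"
        by (rule DERIV_chain2[OF R(1)]) (auto intro!: derivative_eq_intros)
      from DERIV_diff[OF DERIV_diff[OF R(1) this] DERIV_ident] sym[OF that(2)] show ?thesis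
        by (simp add: algebra_simps)
    qed
    from zero_derivative_imp_eq[of 0 1 "\<lambda>x. R x - R (-x) - x", OF _ this] R(2) show ?thesis by simp
  qed
  have Rdiff: "R x - x = R 1 - 1" if "x \<ge> 1" for x
  proof -
    have "((\<lambda>x. R x - x) has_real_derivative 0) (at y)" if "1 \<le> y" for y
      using DERIV_diff[OF R(1) DERIV_ident, of y] R1(4)[OF that] by simp
    from zero_derivative_imp_eq[of 1 x "\<lambda>x. R x - x", OF that this] show ?thesis by simp
  qed
  have Rr: "R x = x" if "x \<ge> 1" for x using Rdiff[OF that] Rone by simp
  have r: "0 \<le> r x" "\<bar>x\<bar> \<ge> 1 \<Longrightarrow> r x = 0" for x using r0 Qpos by (auto simp: r_def)
  obtain B where B: "\<And>y. y \<in> {-1..1} \<Longrightarrow> \<bar>r y\<bar> \<le> B"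
    using compact_imp_bounded[OF compact_continuous_image[OF smooth_continuous[OF sr], of "{-1..1}"]]
    by (force simp: bounded_iff)
  have rB: "r x \<le> B" for x
  proof (cases "\<bar>x\<bar> \<ge> 1")
    case True
    then show ?thesis using B[of 0] r(2)[of x] abs_ge_zero[of "r 0"] by simp
  next
    case False
    then have "-1 \<le> x" "x \<le> 1" by linarith+
    then have "\<bar>r x\<bar> \<le> B" by (intro B) auto
    then show ?thesis by linarith
  qed
  have "mollifier r R1 R B"
    by (rule mollifier.intro) (rule sR sR1 sr R(1) dR1 r rB R1 Rl Rr; assumption)+
  then show ?thesis by blast
qed

section \<open>Local square integrability\<close>

lemma periodic_int:
  fixes F :: "real \<Rightarrow> 'a"
  assumes "\<And>x. F (x + 2 * pi) = F x" shows "F (x + of_int n * (2 * pi)) = F x"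
proof (induction n rule: int_induct[of _ 0])
  case (step1 i)
  then show ?case using assms[of "x + of_int i * (2 * pi)"] by (simp add: algebra_simps)
next
  case (step2 i)
  then show ?case using assms[of "x + of_int (i - 1) * (2 * pi)"] by (simp add: algebra_simps)
qed simp

lemma periodic_reduce:
  fixes F :: "real \<Rightarrow> 'a"
  assumes "\<And>x. F (x + 2 * pi) = F x" shows "\<exists>y\<in>{-pi..pi}. F x = F y"
proof
  define n where "n = round (x / (2 * pi))"
  have "\<bar>of_int n - x / (2 * pi)\<bar> \<le> 1 / 2" unfolding n_def by (rule of_int_round_abs_le)
  then have "2 * pi * \<bar>of_int n - x / (2 * pi)\<bar> \<le> 2 * pi * (1 / 2)" by (intro mult_left_mono) auto
  also have "2 * pi * \<bar>of_int n - x / (2 * pi)\<bar> = \<bar>2 * pi * (of_int n - x / (2 * pi))\<bar>" by (simp add: abs_mult)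
  also have "2 * pi * (of_int n - x / (2 * pi)) = of_int n * (2 * pi) - x" by (simp add: field_simps)
  finally show "x - of_int n * (2 * pi) \<in> {-pi..pi}" by (auto simp: abs_le_iff)
  show "F x = F (x - of_int n * (2 * pi))"
    using periodic_int[of F "x - of_int n * (2 * pi)" n, OF assms] by simp
qed

lemma derivative_periodic:
  assumes "\<And>x. (f has_real_derivative f' x) (at x)" "\<And>x. f (x + 2 * pi) = f x + c"
  shows "f' (x + 2 * pi) = f' x"
proof -
  have "((\<lambda>x. f (x + 2 * pi)) has_real_derivative f' (x + 2 * pi) * 1) (at x)"
    by (rule DERIV_chain2[OF assms(1)]) (auto intro!: derivative_eq_intros)
  moreover have "((\<lambda>x. f (x + 2 * pi)) has_real_derivative f' x) (at x)"
    unfolding assms(2) using DERIV_add[OF assms(1) DERIV_const] by simp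
  ultimately show ?thesis using DERIV_unique by fastforce
qed

lemma set_integrable_translate:
  fixes F :: "real \<Rightarrow> 'a::euclidean_space"
  assumes "\<And>x. F (x + p) = F x" and "set_integrable lborel {a..b} F"
  shows "set_integrable lborel {a + p..b + p} F"
    and "(LINT x:{a + p..b + p}|lborel. F x) = (LINT x:{a..b}|lborel. F x)"
proof -
  have eq: "indicat_real {a + p..b + p} (p + 1 * x) *\<^sub>R F (p + 1 * x) = indicat_real {a..b} x *\<^sub>R F x" for x
    using assms(1)[of x] by (auto simp: indicator_def add.commute)
  show "set_integrable lborel {a + p..b + p} F"
    using assms(2) lborel_integrable_real_affine_iff[of 1 "\<lambda>x. indicat_real {a + p..b + p} x *\<^sub>R F x" p]
    unfolding set_integrable_def eq by simp
  show "(LINT x:{a + p..b + p}|lborel. F x) = (LINT x:{a..b}|lborel. F x)"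
    using lborel_integral_real_affine[of 1 "\<lambda>x. indicat_real {a + p..b + p} x *\<^sub>R F x" p]
    unfolding set_lebesgue_integral_def eq by simp
qed

lemma set_integrable_glue:
  fixes F :: "real \<Rightarrow> 'a::euclidean_space"
  assumes "a \<le> b" "b \<le> c" and "set_integrable lborel {a..b} F" "set_integrable lborel {b..c} F"
  shows "set_integrable lborel {a..c} F"
    and "(LINT x:{a..c}|lborel. F x) = (LINT x:{a..b}|lborel. F x) + (LINT x:{b..c}|lborel. F x)"
proof -
  have U: "{a..c} = {a..b} \<union> {b..c}" using assms by auto
  show "set_integrable lborel {a..c} F"
    unfolding U by (rule set_integrable_Un) (use assms in auto)
  have "AE x in lborel. \<not> (x \<in> {a..b} \<and> x \<in> {b..c})"
    using AE_lborel_singleton[of b] by eventually_elim auto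
  then show "(LINT x:{a..c}|lborel. F x) = (LINT x:{a..b}|lborel. F x) + (LINT x:{b..c}|lborel. F x)"
    unfolding U by (rule set_integral_Un_AE) (use assms in auto)
qed

lemma periodic_set_integrable:
  fixes F :: "real \<Rightarrow> 'a::euclidean_space"
  assumes per: "\<And>x. F (x + 2 * pi) = F x" and int: "set_integrable lborel {-pi..pi} F"
  shows "set_integrable lborel {a..b} F"
proof -
  have per': "F (x + - (2 * pi)) = F x" for x using per[of "x - 2 * pi"] by simp
  have *: "set_integrable lborel {- pi..pi + n * (2 * pi)} F" for n :: nat
  proof (induction n)
    case (Suc n)
    have "set_integrable lborel {- pi + 2 * pi..pi + n * (2 * pi) + 2 * pi} F"
      by (rule set_integrable_translate(1)[OF per Suc])
    then have *: "set_integrable lborel {pi..pi + Suc n * (2 * pi)} F"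
      by (simp add: algebra_simps)
    have "pi \<le> pi + Suc n * (2 * pi)" by (simp del: of_nat_Suc)
    from set_integrable_glue(1)[OF _ this int *] show ?case by simp
  qed (use int in simp)
  have **: "set_integrable lborel {- pi - m * (2 * pi)..pi + n * (2 * pi)} F" for n m :: nat
  proof (induction m)
    case (Suc m)
    have "set_integrable lborel {- pi - m * (2 * pi) + - (2 * pi)..pi + n * (2 * pi) + - (2 * pi)} F"
      by (rule set_integrable_translate(1)[OF per' Suc])
    moreover have eq: "- pi - m * (2 * pi) + - (2 * pi) = - pi - Suc m * (2 * pi)"
      by (simp add: algebra_simps)
    ultimately have *: "set_integrable lborel {- pi - Suc m * (2 * pi)..pi + n * (2 * pi) + - (2 * pi)} F"
      by (simp only: eq)
    have pos: "0 \<le> m * (2 * pi)" "0 \<le> n * (2 * pi)" by simp_all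
    then have le: "- pi - m * (2 * pi) \<le> pi + n * (2 * pi) + - (2 * pi)" "- pi - m * (2 * pi) \<le> pi + n * (2 * pi)"
      using pi_gt_zero by linarith+
    have **: "set_integrable lborel {- pi - Suc m * (2 * pi)..- pi - m * (2 * pi)} F"
      using le(1) by (rule_tac set_integrable_subset[OF *]) (simp_all only: sets_lborel atLeastAtMost_borel atLeastatMost_subset_iff order_refl, simp)
    have "- pi - Suc m * (2 * pi) \<le> - pi - m * (2 * pi)" using eq pi_gt_zero by linarith
    from set_integrable_glue(1)[OF this le(2) ** Suc] show ?case .
  qed (use * in simp)
  obtain N :: nat where N: "\<bar>a\<bar> + \<bar>b\<bar> \<le> N" using real_arch_simple by blast
  have "real N * 1 \<le> real N * (2 * pi)" using pi_ge_two by (intro mult_left_mono) auto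
  then show ?thesis
    using **[of N N] N pi_ge_two by (rule_tac set_integrable_subset) auto
qed

text \<open>
  After a shift by full periods the window starts in \<open>{- pi..pi}\<close>; the part that sticks out on the right
  is then the translate of the part that is missing on the left.
\<close>

lemma periodic_integral_shift:
  fixes F :: "real \<Rightarrow> 'a::euclidean_space"
  assumes per: "\<And>x. F (x + 2 * pi) = F x" and int: "set_integrable lborel {-pi..pi} F"
  shows "(LINT x:{c - pi..c + pi}|lborel. F x) = (LINT x:{-pi..pi}|lborel. F x)"
proof -
  note I = periodic_set_integrable[OF per int]
  define n where "n = \<lfloor>c / (2 * pi)\<rfloor>"
  define d where "d = c - n * (2 * pi)"
  have d: "0 \<le> d" "d < 2 * pi"
    using floor_divide_lower[of "2 * pi" c] floor_divide_upper[of "2 * pi" c]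
    by (auto simp: d_def n_def algebra_simps)
  have pern: "F (x + of_int n * (2 * pi)) = F x" for x by (rule periodic_int[of F, OF per])
  have "(LINT x:{c - pi..c + pi}|lborel. F x) = (LINT x:{d - pi..d + pi}|lborel. F x)"
    using set_integrable_translate(2)[OF pern I, of "d - pi" "d + pi"] by (simp add: d_def algebra_simps)
  also have "\<dots> = (LINT x:{d - pi..pi}|lborel. F x) + (LINT x:{pi..d + pi}|lborel. F x)"
    using d by (rule_tac set_integrable_glue(2)) (auto intro: I)
  also have "(LINT x:{pi..d + pi}|lborel. F x) = (LINT x:{-pi..d - pi}|lborel. F x)"
    using set_integrable_translate(2)[OF per I, of "-pi" "d - pi"] by (simp add: algebra_simps)
  also have "(LINT x:{d - pi..pi}|lborel. F x) + (LINT x:{-pi..d - pi}|lborel. F x) = (LINT x:{-pi..pi}|lborel. F x)"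
    using d set_integrable_glue(2)[of "-pi" "d - pi" pi F] I by auto
  finally show ?thesis .
qed

lemma L2_D:
  assumes "z \<in> L2 \<Omega>"
  shows "z \<in> borel_measurable borel" "set_integrable lborel (cell \<Omega>) (\<lambda>x. (z x)\<^sup>2)" "function_on \<Omega> z"
  using assms by (auto simp: L2_def)

lemma L2_square_locally_integrable:
  assumes "z \<in> L2 \<Omega>"
  shows "set_integrable lborel {a..b} (\<lambda>x. (z x)\<^sup>2)"
proof (cases \<Omega>)
  case Line
  then show ?thesis
    using L2_D(2)[OF assms] by (rule_tac set_integrable_subset[of lborel UNIV]) (auto simp: cell_def)
next
  case Torus
  then show ?thesis
    using L2_D(2,3)[OF assms] by (rule_tac periodic_set_integrable) (auto simp: cell_def function_on_def)
qed

lemma L2_local_norm_le: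
  assumes "z \<in> L2 \<Omega>" "b \<le> a + 2 * pi"
  shows "(LINT x:{a..b}|lborel. (z x)\<^sup>2) \<le> (LINT x:cell \<Omega>|lborel. (z x)\<^sup>2)"
proof (cases \<Omega>)
  case Line
  then show ?thesis
    using L2_D(2)[OF assms(1)] L2_square_locally_integrable[OF assms(1), of a b]
    unfolding set_lebesgue_integral_def set_integrable_def
    by (intro integral_mono) (auto simp: cell_def indicator_def)
next
  case Torus
  note I = L2_square_locally_integrable[OF assms(1)]
  have "(LINT x:{a..b}|lborel. (z x)\<^sup>2) \<le> (LINT x:{a..a + 2 * pi}|lborel. (z x)\<^sup>2)"
    using I[of a b] I[of a "a + 2 * pi"] assms(2) unfolding set_lebesgue_integral_def set_integrable_def
    by (intro integral_mono) (auto simp: indicator_def)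
  also have "\<dots> = (LINT x:{-pi..pi}|lborel. (z x)\<^sup>2)"
    using periodic_integral_shift[of "\<lambda>x. (z x)\<^sup>2" "a + pi"] L2_D(2,3)[OF assms(1)] Torus
    by (auto simp: cell_def function_on_def algebra_simps)
  finally show ?thesis using Torus by (simp add: cell_def)
qed

lemma L2_integral_nonneg: "0 \<le> (LINT x:A|lborel. (f x :: real)\<^sup>2)"
  by (auto simp: set_lebesgue_integral_def intro!: Bochner_Integration.integral_nonneg)

lemma continuous_set_integrable: 
  fixes f :: "real \<Rightarrow> real" shows "continuous_on UNIV f \<Longrightarrow> set_integrable lborel {a..b} f"
  by (intro borel_integrable_atLeastAtMost') (rule continuous_on_subset, auto)

lemma set_integrable_const_Icc: "set_integrable lborel {a..b::real} (\<lambda>x. c :: real)"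
  by (simp add: set_integrable_def integrable_indicator_iff emeasure_lborel_Icc_eq)

lemma L2_mult_continuous_integrable:
  assumes "z \<in> L2 \<Omega>" "continuous_on {a..b} \<phi>" "\<phi> \<in> borel_measurable borel"
  shows "set_integrable lborel {a..b} (\<lambda>x. z x * \<phi> x)"
proof -
  obtain B where B: "\<And>y. y \<in> {a..b} \<Longrightarrow> \<bar>\<phi> y\<bar> \<le> B"
    using compact_imp_bounded[OF compact_continuous_image[OF assms(2)]]
    by (force simp: bounded_iff)
  have "set_integrable lborel {a..b} (\<lambda>x. B * (1 + (z x)\<^sup>2))"
    using L2_square_locally_integrable[OF assms(1)] set_integrable_const_Icc
    by (intro set_integrable_mult_right set_integral_add) auto
  then show ?thesis
  proof (rule set_integrable_bound)
    show "set_borel_measurable lborel {a..b} (\<lambda>x. z x * \<phi> x)"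
      using L2_D(1)[OF assms(1)] assms(3) by (simp add: set_borel_measurable_def)
    show "AE x in lborel. x \<in> {a..b} \<longrightarrow> norm (z x * \<phi> x) \<le> norm (B * (1 + (z x)\<^sup>2))"
    proof (rule AE_I2, intro impI)
      fix x assume x: "x \<in> {a..b}"
      have "0 \<le> (\<bar>z x\<bar> - 1)\<^sup>2" by simp
      then have "\<bar>z x\<bar> \<le> 1 + (z x)\<^sup>2" by (auto simp: power2_eq_square algebra_simps) 
      then have "\<bar>z x\<bar> * \<bar>\<phi> x\<bar> \<le> (1 + (z x)\<^sup>2) * B"
        using B[OF x] by (intro mult_mono) auto
      also have "\<dots> \<le> norm (B * (1 + (z x)\<^sup>2))" by (simp add: mult.commute)
      finally show "norm (z x * \<phi> x) \<le> norm (B * (1 + (z x)\<^sup>2))"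
        by (simp add: abs_mult)
    qed
  qed
qed

lemma L2_abs_integrable:
  assumes "z \<in> L2 \<Omega>" shows "set_integrable lborel {a..b} (\<lambda>x. \<bar>z x\<bar>)"
  using L2_mult_continuous_integrable[OF assms, of a b "\<lambda>_. 1"] by (rule_tac set_integrable_abs) simp

text \<open>
  The Cauchy--Schwarz inequality on an interval, from the nonnegativity of the variance of \<open>\<bar>z\<bar>\<close>.
\<close>

lemma L1_le_L2:
  assumes "z \<in> L2 \<Omega>" "a < b" "b \<le> a + 2 * pi"
  shows "(LINT x:{a..b}|lborel. \<bar>z x\<bar>) \<le> sqrt (b - a) * sqrt (LINT x:cell \<Omega>|lborel. (z x)\<^sup>2)"
proof -
  note I = L2_abs_integrable[OF assms(1), of a b] L2_square_locally_integrable[OF assms(1), of a b]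
  define J m where "J = (LINT x:{a..b}|lborel. \<bar>z x\<bar>)" and "m = J / (b - a)"
  have "0 \<le> (LINT x:{a..b}|lborel. (\<bar>z x\<bar> - m)\<^sup>2)"
    by (rule L2_integral_nonneg)
  also have "\<dots> = (LINT x:{a..b}|lborel. (z x)\<^sup>2 - 2 * m * \<bar>z x\<bar> + m\<^sup>2)"
    by (simp add: power2_diff algebra_simps)
  also have "\<dots> = (LINT x:{a..b}|lborel. (z x)\<^sup>2) - 2 * m * J + m\<^sup>2 * (b - a)"
  proof -
    have 1: "set_integrable lborel {a..b} (\<lambda>x. 2 * m * \<bar>z x\<bar>)" using I(1) by simp
    have "(LINT x:{a..b}|lborel. m\<^sup>2) = m\<^sup>2 * (b - a)"
      using assms(2) by (simp add: set_lebesgue_integral_def)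
    then show ?thesis
      using set_integral_add(2)[OF set_integral_diff(1)[OF I(2) 1] set_integrable_const_Icc[of a b "m\<^sup>2"]]
        set_integral_diff(2)[OF I(2) 1] by (simp add: J_def)
  qed
  also have "\<dots> = (LINT x:{a..b}|lborel. (z x)\<^sup>2) - J\<^sup>2 / (b - a)"
  proof -
    have "m\<^sup>2 * (b - a) = m * J" using assms(2) by (simp add: m_def power2_eq_square)
    then show ?thesis by (simp add: m_def power2_eq_square)
  qed
  finally have "J\<^sup>2 \<le> (b - a) * (LINT x:{a..b}|lborel. (z x)\<^sup>2)"
    using assms(2) by (simp add: field_simps)
  also have "\<dots> \<le> (b - a) * (LINT x:cell \<Omega>|lborel. (z x)\<^sup>2)"
    using assms by (intro mult_left_mono L2_local_norm_le) auto
  finally have "sqrt (J\<^sup>2) \<le> sqrt ((b - a) * (LINT x:cell \<Omega>|lborel. (z x)\<^sup>2))"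
    by (rule real_sqrt_le_mono)
  then show ?thesis by (auto simp: J_def real_sqrt_mult)
qed

lemma set_integral_abs_bound:
  fixes w \<phi> :: "real \<Rightarrow> real"
  assumes "w \<in> L2 \<Omega>" "continuous_on UNIV \<phi>" "\<And>x. x \<in> A \<Longrightarrow> \<bar>\<phi> x\<bar> \<le> C" "A = {a..b}"
  shows "\<bar>LINT x:A|lborel. w x * \<phi> x\<bar> \<le> C * (LINT x:A|lborel. \<bar>w x\<bar>)"
proof -
  have I: "set_integrable lborel A (\<lambda>x. w x * \<phi> x)" "set_integrable lborel A (\<lambda>x. \<bar>w x\<bar>)"
    unfolding assms(4)
    by (rule L2_mult_continuous_integrable[OF assms(1)], rule continuous_on_subset[OF assms(2)])
      (auto intro: borel_measurable_continuous_onI assms L2_abs_integrable)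
  have "\<bar>LINT x:A|lborel. w x * \<phi> x\<bar> \<le> (LINT x:A|lborel. C * \<bar>w x\<bar>)"
    unfolding set_lebesgue_integral_def
  proof (rule integral_abs_bound[THEN order_trans], rule integral_mono)
    show "integrable lborel (\<lambda>x. \<bar>indicat_real A x *\<^sub>R (w x * \<phi> x)\<bar>)"
      "integrable lborel (\<lambda>x. indicat_real A x *\<^sub>R (C * \<bar>w x\<bar>))"
      using I set_integrable_mult_right[of C lborel A "\<lambda>x. \<bar>w x\<bar>"] by (auto simp: set_integrable_def)
    show "\<bar>indicat_real A x *\<^sub>R (w x * \<phi> x)\<bar> \<le> indicat_real A x *\<^sub>R (C * \<bar>w x\<bar>)" for x
      using mult_right_mono[OF assms(3)[of x], of "\<bar>w x\<bar>"] by (auto simp: indicator_def abs_mult mult.commute)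
  qed
  then show ?thesis by simp
qed

lemma L2_diff:
  assumes "f \<in> L2 \<Omega>" "g \<in> L2 \<Omega>" shows "(\<lambda>x. f x - g x) \<in> L2 \<Omega>"
proof -
  have "set_integrable lborel (cell \<Omega>) (\<lambda>x. 2 * (f x)\<^sup>2 + 2 * (g x)\<^sup>2)"
    using L2_D(2)[OF assms(1)] L2_D(2)[OF assms(2)] by (rule_tac set_integral_add(1)) auto
  then have "set_integrable lborel (cell \<Omega>) (\<lambda>x. (f x - g x)\<^sup>2)"
  proof (rule set_integrable_bound)
    show "set_borel_measurable lborel (cell \<Omega>) (\<lambda>x. (f x - g x)\<^sup>2)"
      using L2_D(1)[OF assms(1)] L2_D(1)[OF assms(2)]
      by (cases \<Omega>) (auto simp: set_borel_measurable_def cell_def)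
    show "AE x in lborel. x \<in> cell \<Omega> \<longrightarrow> norm ((f x - g x)\<^sup>2) \<le> norm (2 * (f x)\<^sup>2 + 2 * (g x)\<^sup>2)"
    proof (rule AE_I2, rule impI)
      fix x
      have "0 \<le> (f x + g x)\<^sup>2" by simp
      then have "(f x - g x)\<^sup>2 \<le> 2 * (f x)\<^sup>2 + 2 * (g x)\<^sup>2"
        by (simp add: power2_eq_square algebra_simps)
      then show "norm ((f x - g x)\<^sup>2) \<le> norm (2 * (f x)\<^sup>2 + 2 * (g x)\<^sup>2)" by simp
    qed
  qed
  then show ?thesis
    using L2_D[OF assms(1)] L2_D[OF assms(2)]
    by (cases \<Omega>) (auto simp: L2_def function_on_def)
qed

section \<open>Localised test functions\<close>

text \<open>
  A test function supported in a window of length \<open>2\<close> is also one on the torus after periodisation. This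
  reduces both domains to the same local statement about integrals over the window. At each \<open>x\<close> only the
  translate of \<open>\<phi>\<close> centred nearest to \<open>x\<close> can contribute, so rounding replaces the sum over all translates.
\<close>

definition periodize :: "real \<Rightarrow> (real \<Rightarrow> real) \<Rightarrow> real \<Rightarrow> real" where
  "periodize c \<phi> x = \<phi> (x - 2 * pi * of_int (round ((x - c) / (2 * pi))))"

lemma dist_nonrounded:
  assumes "n \<noteq> round ((x - c) / (2 * pi))"
  shows "\<bar>x - 2 * pi * of_int n - c\<bar> \<ge> pi"
proof -
  define y where "y = (x - c) / (2 * pi)"
  have "\<bar>of_int (round y) - y\<bar> \<le> 1 / 2" by (rule of_int_round_abs_le)
  moreover have "\<bar>of_int n - of_int (round y) :: real\<bar> \<ge> 1"
    using assms unfolding y_def by linarith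
  ultimately have "\<bar>y - of_int n\<bar> \<ge> 1 / 2" by linarith
  then have "2 * pi * \<bar>y - of_int n\<bar> \<ge> 2 * pi * (1 / 2)" by (intro mult_left_mono) auto
  moreover have "2 * pi * \<bar>y - of_int n\<bar> = \<bar>2 * pi * (y - of_int n)\<bar>" by (simp add: abs_mult)
  moreover have "2 * pi * (y - of_int n) = x - 2 * pi * of_int n - c" by (simp add: y_def field_simps)
  ultimately show ?thesis by simp
qed

text \<open>
  The rounding jumps only at distance \<open>pi\<close> from the centres, where all translates of \<open>\<phi>\<close> vanish; hence it can
  be frozen near any point, and periodisation commutes with differentiation.
\<close>

lemma periodize_locally_translate:
  assumes "\<And>x. \<bar>x - c\<bar> > 1 \<Longrightarrow> \<phi> x = 0" and "\<bar>x - x\<^sub>0\<bar> < 1 / 2"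
  shows "periodize c \<phi> x = \<phi> (x - 2 * pi * of_int (round ((x\<^sub>0 - c) / (2 * pi))))"
proof (cases "round ((x - c) / (2 * pi)) = round ((x\<^sub>0 - c) / (2 * pi))")
  case False
  from dist_nonrounded[OF False[symmetric]] dist_nonrounded[OF False]
  have "\<bar>x - 2 * pi * of_int (round ((x - c) / (2 * pi))) - c\<bar> > 1"
    "\<bar>x - 2 * pi * of_int (round ((x\<^sub>0 - c) / (2 * pi))) - c\<bar> > 1"
    using assms(2) pi_ge_two by linarith+
  then show ?thesis using assms(1) unfolding periodize_def by simp
qed (simp add: periodize_def)

lemma periodize_periodic: "periodize c \<phi> (x + 2 * pi) = periodize c \<phi> x"
proof -
  have "(x + 2 * pi - c) / (2 * pi) = (x - c) / (2 * pi) + of_int 1" by (simp add: field_simps)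
  then have "round ((x + 2 * pi - c) / (2 * pi)) = round ((x - c) / (2 * pi)) + 1"
    unfolding round_def by (simp add: add.assoc add.commute[of 1] floor_add_int[symmetric] del: floor_add_int) linarith
  then show ?thesis by (simp add: periodize_def algebra_simps)
qed

lemma periodize_has_derivative:
  assumes "\<And>x. \<bar>x - c\<bar> > 1 \<Longrightarrow> \<phi> x = 0" "\<And>x. \<bar>x - c\<bar> > 1 \<Longrightarrow> \<phi>' x = 0"
    and "\<And>x. (\<phi> has_real_derivative \<phi>' x) (at x)"
  shows "(periodize c \<phi> has_real_derivative periodize c \<phi>' x) (at x)"
proof -
  define p where "p = 2 * pi * of_int (round ((x - c) / (2 * pi)))"
  have "((\<lambda>y. \<phi> (y - p)) has_real_derivative \<phi>' (x - p) * 1) (at x)"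
    by (rule DERIV_chain2[OF assms(3)]) (auto intro!: derivative_eq_intros)
  then have "((\<lambda>y. \<phi> (y - p)) has_real_derivative periodize c \<phi>' x) (at x)"
    by (simp add: periodize_def p_def)
  then show ?thesis
    by (rule has_field_derivative_transform_within_open[where S="ball x (1/2)"])
      (use periodize_locally_translate[OF assms(1)] in \<open>auto simp: p_def dist_real_def abs_minus_commute\<close>)
qed

lemma derivative_zero_outside:
  fixes \<phi> :: "real \<Rightarrow> real"
  assumes "\<And>x. \<bar>x - c\<bar> > r \<Longrightarrow> \<phi> x = 0" "(\<phi> has_real_derivative d) (at x)" "\<bar>x - c\<bar> > r"
  shows "d = 0"
proof -
  have "open {x. \<bar>x - c\<bar> > r}" by (intro open_Collect_less continuous_intros)
  then have "((\<lambda>_. 0) has_real_derivative d) (at x)"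
    using assms by (rule_tac has_field_derivative_transform_within_open[where S="{x. \<bar>x - c\<bar> > r}" and f=\<phi>]) auto
  then show ?thesis using DERIV_unique[OF DERIV_const] by auto
qed

lemma periodize_test_function:
  assumes "smooth \<phi>" "\<And>x. \<bar>x - c\<bar> > 1 \<Longrightarrow> \<phi> x = 0"
  shows "test_function Torus (periodize c \<phi>)"
    and "deriv (periodize c \<phi>) = periodize c (deriv \<phi>)"
proof -
  obtain D where D: "D 0 = \<phi>" "\<And>n x. (D n has_vector_derivative D (Suc n) x) (at x)"
    using assms(1) unfolding smooth_def by auto
  note D' = D(2)[folded has_real_derivative_iff_has_vector_derivative]
  have z: "D n x = 0" if "\<bar>x - c\<bar> > 1" for n x
    using that
  proof (induction n arbitrary: x)
    case (Suc n)
    from derivative_zero_outside[OF Suc.IH D' Suc.prems] show ?case .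
  qed (use D(1) assms(2) in simp)
  have "smooth (periodize c \<phi>)"
    unfolding smooth_def has_real_derivative_iff_has_vector_derivative[symmetric]
    by (rule exI[of _ "\<lambda>n. periodize c (D n)"]) (use D(1) periodize_has_derivative[OF z z D'] in auto)
  then show "test_function Torus (periodize c \<phi>)"
    by (simp add: test_function_def function_on_def periodize_periodic)
  have "deriv \<phi> x = D 1 x" for x using D(1) D'[of 0 x] by (auto intro: DERIV_imp_deriv)
  then have "deriv \<phi> = D 1" by auto
  moreover have "deriv (periodize c \<phi>) x = periodize c (D 1) x" for x
  proof (rule DERIV_imp_deriv)
    have "(periodize c (D 0) has_real_derivative periodize c (D (Suc 0)) x) (at x)"
      by (rule periodize_has_derivative[OF z z D'])
    then show "(periodize c \<phi> has_real_derivative periodize c (D 1) x) (at x)" by (simp add: D(1))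
  qed
  ultimately show "deriv (periodize c \<phi>) = periodize c (deriv \<phi>)" by auto
qed

lemma set_integral_support:
  fixes F :: "real \<Rightarrow> real"
  assumes "A \<subseteq> B" "\<And>x. x \<in> B \<Longrightarrow> x \<notin> A \<Longrightarrow> F x = 0"
  shows "(LINT x:B|lborel. F x) = (LINT x:A|lborel. F x)"
  unfolding set_lebesgue_integral_def using assms
  by (intro Bochner_Integration.integral_cong) (auto simp: indicator_def)

lemma periodize_integral:
  assumes "z \<in> L2 Torus" "smooth \<phi>" "\<And>x. \<bar>x - c\<bar> > 1 \<Longrightarrow> \<phi> x = 0"
  shows "(LINT x:cell Torus|lborel. z x * periodize c \<phi> x) = (LINT x:{c - 1..c + 1}|lborel. z x * \<phi> x)"
proof -
  have cont: "continuous_on S (periodize c \<phi>)" for S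
    using periodize_test_function(1)[OF assms(2,3)] by (intro smooth_continuous) (simp add: test_function_def)
  have *: "periodize c \<phi> x = \<phi> x" if "\<bar>x - c\<bar> \<le> pi" for x
  proof (cases "round ((x - c) / (2 * pi)) = 0")
    case False
    from dist_nonrounded[OF False[symmetric]] have "\<bar>x - c\<bar> \<ge> pi" by simp
    moreover have "\<bar>x - 2 * pi * of_int (round ((x - c) / (2 * pi))) - c\<bar> \<ge> pi"
    proof -
      have "1 \<le> \<bar>real_of_int (round ((x - c) / (2 * pi)))\<bar>" using False by linarith
      then have "2 * pi * 1 \<le> 2 * pi * \<bar>real_of_int (round ((x - c) / (2 * pi)))\<bar>" by (intro mult_left_mono) auto
      then have "2 * pi \<le> \<bar>2 * pi * real_of_int (round ((x - c) / (2 * pi)))\<bar>" by (simp add: abs_mult)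
      then show ?thesis using that by linarith
    qed
    ultimately show ?thesis
      using pi_ge_two unfolding periodize_def by (subst (1 2) assms(3)) auto
  qed (simp add: periodize_def)
  have "(LINT x:cell Torus|lborel. z x * periodize c \<phi> x) = (LINT x:{c - pi..c + pi}|lborel. z x * periodize c \<phi> x)"
    unfolding cell_def spatial_domain.case
    by (rule periodic_integral_shift[symmetric])
      (use L2_D(3)[OF assms(1)] in \<open>auto simp: function_on_def periodize_periodic intro!: L2_mult_continuous_integrable[OF assms(1)] cont borel_measurable_continuous_onI\<close>)
  also have "\<dots> = (LINT x:{c - pi..c + pi}|lborel. z x * \<phi> x)"
    by (rule set_lebesgue_integral_cong) (auto simp: *)
  also have "\<dots> = (LINT x:{c - 1..c + 1}|lborel. z x * \<phi> x)"
    using pi_ge_two assms(3) by (intro set_integral_support) auto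
  finally show ?thesis .
qed

lemma weak_derivative_local:
  assumes "has_weak_derivative \<Omega> u v" "u \<in> L2 \<Omega>" "v \<in> L2 \<Omega>"
    and "smooth \<phi>" "\<And>x. \<bar>x - c\<bar> > 1 \<Longrightarrow> \<phi> x = 0"
  shows "(LINT x:{c - 1..c + 1}|lborel. u x * deriv \<phi> x) = - (LINT x:{c - 1..c + 1}|lborel. v x * \<phi> x)"
proof -
  have d0: "deriv \<phi> x = 0" if "\<bar>x - c\<bar> > 1" for x
    using derivative_zero_outside[OF assms(5) smooth_deriv(2)[OF assms(4)] that] .
  show ?thesis
  proof (cases \<Omega>)
    case Line
    have "{x. \<phi> x \<noteq> 0} \<subseteq> {c - 1..c + 1}" using assms(5) by (force simp: not_less)
    then have "test_function Line \<phi>"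
      using assms(4) bounded_subset[OF bounded_closed_interval[of "c - 1" "c + 1"]]
      by (auto simp: test_function_def function_on_def)
    then have "(LINT x:cell \<Omega>|lborel. u x * deriv \<phi> x) = - (LINT x:cell \<Omega>|lborel. v x * \<phi> x)"
      using assms(1) Line by (simp add: has_weak_derivative_def)
    moreover have "(LINT x:cell \<Omega>|lborel. u x * deriv \<phi> x) = (LINT x:{c - 1..c + 1}|lborel. u x * deriv \<phi> x)"
      "(LINT x:cell \<Omega>|lborel. v x * \<phi> x) = (LINT x:{c - 1..c + 1}|lborel. v x * \<phi> x)"
      using Line d0 assms(5) by (auto intro!: set_integral_support simp: cell_def)
    ultimately show ?thesis by simp
  next
    case Torus
    have "(LINT x:cell \<Omega>|lborel. u x * deriv (periodize c \<phi>) x) = - (LINT x:cell \<Omega>|lborel. v x * periodize c \<phi> x)"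
      using assms(1) Torus periodize_test_function(1)[OF assms(4,5)] by (simp add: has_weak_derivative_def)
    then show ?thesis
      using periodize_integral[of u "deriv \<phi>" c] periodize_integral[of v \<phi> c] assms Torus d0 smooth_deriv(1)
      by (simp add: periodize_test_function(2)[OF assms(4,5)])
  qed
qed

lemma weak_derivative2_local:
  assumes "has_weak_derivative \<Omega> u v" "has_weak_derivative \<Omega> v w" "u \<in> L2 \<Omega>" "v \<in> L2 \<Omega>" "w \<in> L2 \<Omega>"
    and "smooth \<phi>" "\<And>x. \<bar>x - c\<bar> > 1 \<Longrightarrow> \<phi> x = 0"
  shows "(LINT x:{c - 1..c + 1}|lborel. u x * deriv (deriv \<phi>) x) = (LINT x:{c - 1..c + 1}|lborel. w x * \<phi> x)"
proof -
  have d0: "deriv \<phi> x = 0" if "\<bar>x - c\<bar> > 1" for x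
    using derivative_zero_outside[OF assms(7) smooth_deriv(2)[OF assms(6)] that] .
  show ?thesis
    using weak_derivative_local[OF assms(1,3,4) smooth_deriv(1)[OF assms(6)] d0]
      weak_derivative_local[OF assms(2,4,5,6,7)] by simp
qed

section \<open>Sobolev embedding\<close>

text \<open>The kernels at scale \<open>\<epsilon>\<close> centred at \<open>a\<close>: smoothings of \<open>max 0 (x - a)\<close> and of its derivatives.\<close>

context mollifier
begin

definition P :: "real \<Rightarrow> real \<Rightarrow> real \<Rightarrow> real" where "P \<epsilon> a x = \<epsilon> * R ((x - a) / \<epsilon>)"
definition H :: "real \<Rightarrow> real \<Rightarrow> real \<Rightarrow> real" where "H \<epsilon> a x = R\<^sub>1 ((x - a) / \<epsilon>)"
definition K :: "real \<Rightarrow> real \<Rightarrow> real \<Rightarrow> real" where "K \<epsilon> a x = r ((x - a) / \<epsilon>) / \<epsilon>"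

lemma smooth_PHK: "smooth (P \<epsilon> a)" "smooth (H \<epsilon> a)" "smooth (K \<epsilon> a)"
proof -
  have e: "(x - a) / \<epsilon> = (1 / \<epsilon>) * x + (- a / \<epsilon>)" for x by (simp add: diff_divide_distrib)
  show "smooth (P \<epsilon> a)" using smooth_rescale[OF smooth_R, of \<epsilon> "1 / \<epsilon>" "- a / \<epsilon>"] unfolding P_def[abs_def] e .
  show "smooth (H \<epsilon> a)" using smooth_rescale[OF smooth_R1, of 1 "1 / \<epsilon>" "- a / \<epsilon>"] unfolding H_def[abs_def] e by simp
  show "smooth (K \<epsilon> a)" using smooth_rescale[OF smooth_r, of "1 / \<epsilon>" "1 / \<epsilon>" "- a / \<epsilon>"] unfolding K_def[abs_def] e by simp
qed

lemma P_deriv: "\<epsilon> > 0 \<Longrightarrow> (P \<epsilon> a has_real_derivative H \<epsilon> a x) (at x)"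
  unfolding P_def[abs_def] H_def
  by (auto intro!: derivative_eq_intros DERIV_chain2[where f = R, OF R_deriv])

lemma H_deriv: "\<epsilon> > 0 \<Longrightarrow> (H \<epsilon> a has_real_derivative K \<epsilon> a x) (at x)"
  unfolding H_def[abs_def] K_def
  by (rule DERIV_cong[OF DERIV_chain2[OF R1_deriv]]) (auto intro!: derivative_eq_intros)

lemma PHK_values:
  assumes "\<epsilon> > 0"
  shows "x \<le> a - \<epsilon> \<Longrightarrow> P \<epsilon> a x = 0" "x \<ge> a + \<epsilon> \<Longrightarrow> P \<epsilon> a x = x - a"
    "x \<le> a - \<epsilon> \<Longrightarrow> H \<epsilon> a x = 0" "x \<ge> a + \<epsilon> \<Longrightarrow> H \<epsilon> a x = 1"
    "0 \<le> H \<epsilon> a x" "H \<epsilon> a x \<le> 1" "0 \<le> K \<epsilon> a x" "K \<epsilon> a x \<le> B / \<epsilon>" "\<bar>x - a\<bar> \<ge> \<epsilon> \<Longrightarrow> K \<epsilon> a x = 0"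
proof -
  show "x \<le> a - \<epsilon> \<Longrightarrow> P \<epsilon> a x = 0" "x \<le> a - \<epsilon> \<Longrightarrow> H \<epsilon> a x = 0"
    using assms R_left[of "(x - a) / \<epsilon>"] R1_left[of "(x - a) / \<epsilon>"] by (auto simp: P_def H_def field_simps)
  show "x \<ge> a + \<epsilon> \<Longrightarrow> P \<epsilon> a x = x - a" "x \<ge> a + \<epsilon> \<Longrightarrow> H \<epsilon> a x = 1"
    using assms R_right[of "(x - a) / \<epsilon>"] R1_right[of "(x - a) / \<epsilon>"] by (auto simp: P_def H_def field_simps)
  show "0 \<le> H \<epsilon> a x" "H \<epsilon> a x \<le> 1" "0 \<le> K \<epsilon> a x" "K \<epsilon> a x \<le> B / \<epsilon>"
    using assms R1_nonneg R1_le_1 r_nonneg r_le by (auto simp: H_def K_def divide_right_mono)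
  show "\<bar>x - a\<bar> \<ge> \<epsilon> \<Longrightarrow> K \<epsilon> a x = 0"
    using assms r_support[of "(x - a) / \<epsilon>"] by (auto simp: K_def abs_divide)
qed

lemma P_mono:
  assumes "\<epsilon> > 0" "x \<le> y" shows "P \<epsilon> a x \<le> P \<epsilon> a y"
  by (rule DERIV_nonneg_imp_nondecreasing[OF assms(2)]) (use P_deriv[OF assms(1)] PHK_values(5)[OF assms(1)] in blast)

lemma K_integral:
  assumes "\<epsilon> > 0" "{a - \<epsilon>..a + \<epsilon>} \<subseteq> {c - 1..c + 1}"
  shows "(LINT y:{c - 1..c + 1}|lborel. K \<epsilon> a y) = 1"
proof -
  have "(LINT y:{c - 1..c + 1}|lborel. K \<epsilon> a y) = H \<epsilon> a (c + 1) - H \<epsilon> a (c - 1)"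
    unfolding set_lebesgue_integral_def
    by (rule integral_FTC_atLeastAtMost)
      (use H_deriv[OF assms(1)] smooth_continuous[OF smooth_PHK(3)] in
        \<open>auto simp: has_real_derivative_iff_has_vector_derivative intro: has_vector_derivative_at_within\<close>)
  then show ?thesis using PHK_values(3,4)[OF assms(1)] assms by auto
qed

text \<open>
  The kernels \<open>K \<epsilon> a\<close> are probability densities concentrated at distance at most \<open>\<epsilon>\<close> from \<open>a\<close>.
\<close>

lemma K_average:
  assumes "\<epsilon> > 0" "{a - \<epsilon>..a + \<epsilon>} \<subseteq> {c - 1..c + 1}" "continuous_on UNIV z"
    and "\<And>y. \<bar>y - a\<bar> < \<epsilon> \<Longrightarrow> \<bar>z y - z a\<bar> \<le> \<eta>"
  shows "\<bar>(LINT y:{c - 1..c + 1}|lborel. z y * K \<epsilon> a y) - z a\<bar> \<le> \<eta>"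
proof -
  have cK: "continuous_on UNIV (K \<epsilon> a)" by (rule smooth_continuous[OF smooth_PHK(3)])
  have I: "set_integrable lborel {c - 1..c + 1} (\<lambda>y. z y * K \<epsilon> a y)"
    "set_integrable lborel {c - 1..c + 1} (\<lambda>y. z a * K \<epsilon> a y)"
    "set_integrable lborel {c - 1..c + 1} (\<lambda>y. (z y - z a) * K \<epsilon> a y)"
    "set_integrable lborel {c - 1..c + 1} (\<lambda>y. \<eta> * K \<epsilon> a y)"
    by (intro continuous_set_integrable continuous_intros cK assms(3))+
  have "(LINT y:{c - 1..c + 1}|lborel. z y * K \<epsilon> a y) - z a = (LINT y:{c - 1..c + 1}|lborel. (z y - z a) * K \<epsilon> a y)"
    using I(1,2) K_integral[OF assms(1,2)] by (simp add: left_diff_distrib)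
  also have "\<bar>\<dots>\<bar> \<le> (LINT y:{c - 1..c + 1}|lborel. \<eta> * K \<epsilon> a y)"
    unfolding set_lebesgue_integral_def
  proof (rule integral_abs_bound[THEN order_trans], rule integral_mono)
    show "integrable lborel (\<lambda>x. \<bar>indicat_real {c - 1..c + 1} x *\<^sub>R ((z x - z a) * K \<epsilon> a x)\<bar>)"
      "integrable lborel (\<lambda>x. indicat_real {c - 1..c + 1} x *\<^sub>R (\<eta> * K \<epsilon> a x))"
      using I(3,4) by (auto simp: set_integrable_def)
    show "\<bar>indicat_real {c - 1..c + 1} x *\<^sub>R ((z x - z a) * K \<epsilon> a x)\<bar> \<le> indicat_real {c - 1..c + 1} x *\<^sub>R (\<eta> * K \<epsilon> a x)" for x
      using assms(4)[of x] PHK_values(7)[OF assms(1), of a x] PHK_values(9)[OF assms(1), of x a]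
      by (cases "\<bar>x - a\<bar> < \<epsilon>") (auto simp: indicator_def abs_mult mult_right_mono)
  qed
  finally show ?thesis using K_integral[OF assms(1,2)] by simp
qed

lemma K_limit:
  assumes "\<bar>a - c\<bar> < 1" "continuous_on UNIV z"
  shows "((\<lambda>\<epsilon>. LINT y:{c - 1..c + 1}|lborel. z y * K \<epsilon> a y) \<longlongrightarrow> z a) (at_right 0)"
  unfolding tendsto_iff
proof (intro allI impI)
  fix e :: real assume "e > 0"
  then obtain d where d: "d > 0" "\<And>y. \<bar>y - a\<bar> < d \<Longrightarrow> \<bar>z y - z a\<bar> < e / 2"
    using assms(2)[unfolded continuous_on_iff, rule_format, of a "e / 2"] by (auto simp: dist_real_def)
  have "\<forall>\<^sub>F \<epsilon> in at_right 0. \<epsilon> \<in> {0<..<min d (1 - \<bar>a - c\<bar>)}"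
    using d(1) assms(1) by (intro eventually_at_right_real) auto
  then show "\<forall>\<^sub>F \<epsilon> in at_right 0. dist (LINT y:{c - 1..c + 1}|lborel. z y * K \<epsilon> a y) (z a) < e"
  proof eventually_elim
    case (elim \<epsilon>)
    then have "\<bar>(LINT y:{c - 1..c + 1}|lborel. z y * K \<epsilon> a y) - z a\<bar> \<le> e / 2"
    proof (intro K_average assms(2))
      show "\<bar>z y - z a\<bar> \<le> e / 2" if "\<bar>y - a\<bar> < \<epsilon>" for y
        using d(2)[of y] that elim by simp
    qed (use elim assms(1) in auto)
    then show ?case using \<open>e > 0\<close> by (simp add: dist_real_def)
  qed
qed

end

locale weakly_twice_differentiable = mollifier +
  fixes \<Omega> :: spatial_domain and z v w :: "real \<Rightarrow> real"
  assumes z_L2: "z \<in> L2 \<Omega>" and v_L2: "v \<in> L2 \<Omega>" and w_L2: "w \<in> L2 \<Omega>" and z_cont: "continuous_on UNIV z"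
    and weak1: "has_weak_derivative \<Omega> z v" and weak2: "has_weak_derivative \<Omega> v w"
begin

definition Z :: real where "Z = sqrt (LINT x:cell \<Omega>|lborel. (z x)\<^sup>2)"
definition W :: real where "W = sqrt (LINT x:cell \<Omega>|lborel. (w x)\<^sup>2)"

lemma Z_W_nonneg: "0 \<le> Z" "0 \<le> W"
  using L2_integral_nonneg by (auto simp: Z_def W_def)

lemma weak_second_derivative:
  assumes "smooth \<phi>" "\<And>x. \<bar>x - c\<bar> > 1 \<Longrightarrow> \<phi> x = 0"
    and "\<And>x. (\<phi> has_real_derivative \<phi>' x) (at x)" "\<And>x. (\<phi>' has_real_derivative \<phi>'' x) (at x)"
  shows "(LINT x:{c - 1..c + 1}|lborel. z x * \<phi>'' x) = (LINT x:{c - 1..c + 1}|lborel. w x * \<phi> x)"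
proof -
  have "deriv \<phi> = \<phi>'" using assms(3) by (auto intro!: ext DERIV_imp_deriv)
  moreover have "deriv \<phi>' = \<phi>''" using assms(4) by (auto intro!: ext DERIV_imp_deriv)
  ultimately show ?thesis
    using weak_derivative2_local[OF weak1 weak2 z_L2 v_L2 w_L2 assms(1,2)] by simp
qed

text \<open>
  The difference of the smoothed positive parts at the scales \<open>\<epsilon>\<close> and \<open>1/2\<close> is a bounded test function, and
  its second derivative is the difference of the two kernels. Hence the local averages of \<open>z\<close> at the two
  scales differ by at most the norm of \<open>w\<close>. The average at scale \<open>1/2\<close> is controlled by the norm of \<open>z\<close>, the
  one at scale \<open>\<epsilon>\<close> tends to \<open>z a\<close>.
\<close>

lemma sup_bound: "\<bar>z a\<bar> \<le> 2 * B * (sqrt 2 * Z) + 1 / 2 * (sqrt 2 * W)"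
proof -
  let ?I = "{a - 1..a + 1}"
  let ?A = "\<lambda>\<epsilon>. LINT y:?I|lborel. z y * K \<epsilon> a y"
  have cont: "continuous_on UNIV (P \<epsilon> a)" "continuous_on UNIV (K \<epsilon> a)" for \<epsilon>
    by (intro smooth_continuous smooth_PHK)+
  have L1: "(LINT y:?I|lborel. \<bar>z y\<bar>) \<le> sqrt 2 * Z" "(LINT y:?I|lborel. \<bar>w y\<bar>) \<le> sqrt 2 * W"
    using L1_le_L2[OF z_L2, of "a - 1" "a + 1"] L1_le_L2[OF w_L2, of "a - 1" "a + 1"] pi_ge_two
    by (auto simp: Z_def W_def)
  have B: "B \<ge> 0" using r_nonneg r_le order_trans by blast
  have half: "\<bar>?A (1/2)\<bar> \<le> 2 * B * (sqrt 2 * Z)"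
  proof -
    have "\<bar>?A (1/2)\<bar> \<le> (B / (1/2)) * (LINT y:?I|lborel. \<bar>z y\<bar>)"
      by (rule set_integral_abs_bound[OF z_L2 cont(2) _ refl])
        (use PHK_values(7,8)[of "1/2" a] in auto)
    also have "\<dots> \<le> (B / (1/2)) * (sqrt 2 * Z)" using B L1(1) by (intro mult_left_mono) auto
    finally show ?thesis by simp
  qed
  have "\<bar>?A \<epsilon>\<bar> \<le> 2 * B * (sqrt 2 * Z) + 1 / 2 * (sqrt 2 * W)" if "\<epsilon> \<in> {0<..<1/2}" for \<epsilon>
  proof -
    have \<epsilon>: "\<epsilon> > 0" "\<epsilon> < 1/2" using that by auto
    let ?\<phi> = "\<lambda>y. P \<epsilon> a y - P (1/2) a y"
    have rng: "0 \<le> P e a y \<and> P e a y \<le> 1 / 2" if "\<bar>y - a\<bar> \<le> 1/2" "0 < e" "e \<le> 1/2" for e y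
    proof -
      have "a - 1/2 \<le> y" "y \<le> a + 1/2" using that(1) by linarith+
      then show ?thesis
        using P_mono[OF that(2), of "a - 1/2" y a] P_mono[OF that(2), of y "a + 1/2" a]
          PHK_values(1)[OF that(2), of "a - 1/2" a] PHK_values(2)[OF that(2), of a "a + 1/2"] that
        by auto
    qed
    have 0: "?\<phi> y = 0" if "\<bar>y - a\<bar> \<ge> 1/2" for y
    proof (cases "y \<le> a")
      case True
      then have "y \<le> a - \<epsilon>" "y \<le> a - 1/2" using that \<epsilon> by linarith+
      then show ?thesis using \<epsilon> PHK_values(1)[of \<epsilon> y a] PHK_values(1)[of "1/2" y a] by auto
    next
      case False
      then have "y \<ge> a + \<epsilon>" "y \<ge> a + 1/2" using that \<epsilon> by linarith+
      then show ?thesis using \<epsilon> PHK_values(2)[of \<epsilon> a y] PHK_values(2)[of "1/2" a y] by auto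
    qed
    have bd: "\<bar>?\<phi> y\<bar> \<le> 1/2" for y
    proof (cases "\<bar>y - a\<bar> \<le> 1/2")
      case True
      have "0 \<le> P \<epsilon> a y \<and> P \<epsilon> a y \<le> 1 / 2" "0 \<le> P (1/2) a y \<and> P (1/2) a y \<le> 1 / 2"
        by (rule rng[OF True]; use \<epsilon> in simp)+
      then show ?thesis by linarith
    next
      case False
      then show ?thesis using 0[of y] by simp
    qed
    have "(LINT y:?I|lborel. z y * (K \<epsilon> a y - K (1/2) a y)) = (LINT y:?I|lborel. w y * ?\<phi> y)"
    proof (rule weak_second_derivative[where \<phi>' = "\<lambda>y. H \<epsilon> a y - H (1/2) a y"])
      show "?\<phi> y = 0" if "\<bar>y - a\<bar> > 1" for y using that by (intro 0) linarith
    qed (use \<epsilon> in \<open>auto intro!: smooth_diff smooth_PHK DERIV_diff P_deriv H_deriv\<close>)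
    moreover have "(LINT y:?I|lborel. z y * (K \<epsilon> a y - K (1/2) a y)) = ?A \<epsilon> - ?A (1/2)"
      unfolding right_diff_distrib
      by (rule set_integral_diff) (intro continuous_set_integrable continuous_intros cont z_cont)+
    moreover have "\<bar>LINT y:?I|lborel. w y * ?\<phi> y\<bar> \<le> 1/2 * (LINT y:?I|lborel. \<bar>w y\<bar>)"
      by (rule set_integral_abs_bound[OF w_L2 _ bd refl]) (intro continuous_intros cont)
    ultimately show ?thesis using half L1(2) by linarith
  qed
  then have "\<forall>\<^sub>F \<epsilon> in at_right 0. \<bar>?A \<epsilon>\<bar> \<le> 2 * B * (sqrt 2 * Z) + 1 / 2 * (sqrt 2 * W)"
    by (rule eventually_mono[OF eventually_at_right_real[of 0 "1/2"], rotated]) auto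
  moreover have "((\<lambda>\<epsilon>. \<bar>?A \<epsilon>\<bar>) \<longlongrightarrow> \<bar>z a\<bar>) (at_right 0)"
    by (intro tendsto_rabs K_limit z_cont) auto
  ultimately show ?thesis by (intro tendsto_upperbound) auto
qed

text \<open>
  Difference quotients. Two of them differ by the integral of \<open>w\<close> against a function with values in
  \<open>{- 1..1}\<close> supported in the hull of the four points: the difference of two quotients of the
  positive part, each of which has values in \<open>{- 1..0}\<close>. This replaces the continuous
  representative of the first derivative, which is not known to exist beforehand.
\<close>

definition Q :: "real \<Rightarrow> real \<Rightarrow> real" where "Q a b = (z b - z a) / (b - a)"

lemma Q_diff_bound:
  assumes "a \<noteq> b" "a' \<noteq> b'" and "\<rho> \<le> 1/2"
    and pts: "\<bar>a - c\<bar> \<le> \<rho>" "\<bar>b - c\<bar> \<le> \<rho>" "\<bar>a' - c\<bar> \<le> \<rho>" "\<bar>b' - c\<bar> \<le> \<rho>"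
  shows "\<bar>Q a b - Q a' b'\<bar> \<le> sqrt (2 * \<rho>) * W"
proof -
  let ?I = "{c - 1..c + 1}"
  let ?A = "\<lambda>\<epsilon> a. LINT y:?I|lborel. z y * K \<epsilon> a y"
  have \<rho>: "\<rho> \<ge> 0" using pts by linarith
  have cont: "continuous_on UNIV (P \<epsilon> a)" "continuous_on UNIV (K \<epsilon> a)" for \<epsilon> a
    by (intro smooth_continuous smooth_PHK)+
  have KI: "set_integrable lborel ?I (\<lambda>y. z y * K \<epsilon> a y)" for \<epsilon> a
    by (intro continuous_set_integrable continuous_intros cont z_cont)
  have step: "\<bar>(?A \<epsilon> b - ?A \<epsilon> a) / (b - a) - (?A \<epsilon> b' - ?A \<epsilon> a') / (b' - a')\<bar> \<le> sqrt (2 * (\<rho> + \<epsilon>)) * W"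
    if "\<epsilon> \<in> {0<..<1/2}" for \<epsilon>
  proof -
    have \<epsilon>: "\<epsilon> > 0" "\<epsilon> < 1/2" using that by auto
    let ?q = "\<lambda>a b y. (P \<epsilon> b y - P \<epsilon> a y) / (b - a)"
    let ?\<phi> = "\<lambda>y. ?q a b y - ?q a' b' y"
    \<comment> \<open>In the variable \<open>a\<close> the derivative of \<open>P \<epsilon> a y\<close> is \<open>- H \<epsilon> a y\<close>.\<close>
    have qr: "-1 \<le> ?q a b y \<and> ?q a b y \<le> 0" if "a \<noteq> b" for a b y
    proof -
      have *: "-1 \<le> ?q a b y \<and> ?q a b y \<le> 0" if "a < b" for a b
      proof -
        have "((\<lambda>a. P \<epsilon> a y) has_real_derivative - H \<epsilon> a y) (at a)" for a
          unfolding P_def[abs_def] H_def using \<epsilon>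
          by (auto intro!: derivative_eq_intros DERIV_chain2[OF R_deriv])
        from MVT2[OF that this] obtain x where "P \<epsilon> b y - P \<epsilon> a y = (b - a) * - H \<epsilon> x y" by blast
        then have "?q a b y = - H \<epsilon> x y" using that by simp
        then show ?thesis using PHK_values(5,6)[OF \<epsilon>(1)] by simp
      qed
      have "?q a b y = ?q b a y" by (metis minus_diff_eq minus_divide_divide)
      then show ?thesis using *[of a b] *[of b a] that by (cases "a < b") auto
    qed
    have 0: "?\<phi> y = 0" if "\<bar>y - c\<bar> \<ge> \<rho> + \<epsilon>" for y
    proof (cases "y \<le> c")
      case True
      then have "P \<epsilon> s y = 0" if "\<bar>s - c\<bar> \<le> \<rho>" for s
        using that \<open>\<bar>y - c\<bar> \<ge> \<rho> + \<epsilon>\<close> by (intro PHK_values(1) \<epsilon>) linarith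
      then show ?thesis using pts by simp
    next
      case False
      then have "P \<epsilon> s y = y - s" if "\<bar>s - c\<bar> \<le> \<rho>" for s
        using that \<open>\<bar>y - c\<bar> \<ge> \<rho> + \<epsilon>\<close> by (intro PHK_values(2) \<epsilon>) linarith
      then have "?q a b y = -1" "?q a' b' y = -1" using pts assms(1,2) by (auto simp: field_simps)
      then show ?thesis by simp
    qed
    have bd: "\<bar>?\<phi> y\<bar> \<le> 1" for y
      using qr[OF assms(1), of y] qr[OF assms(2), of y] by linarith
    have sm: "smooth ?\<phi>"
    proof -
      have "smooth (\<lambda>y. 1 / (b - a) * (\<lambda>y. P \<epsilon> b y - P \<epsilon> a y) (1 * y + 0))" for a b
        by (intro smooth_rescale smooth_diff smooth_PHK)
      then show ?thesis by (intro smooth_diff) simp_all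
    qed
    have cphi: "continuous_on UNIV ?\<phi>" by (rule smooth_continuous[OF sm])
    have "(LINT y:?I|lborel. z y * ((K \<epsilon> b y - K \<epsilon> a y) / (b - a) - (K \<epsilon> b' y - K \<epsilon> a' y) / (b' - a')))
        = (LINT y:?I|lborel. w y * ?\<phi> y)"
    proof (rule weak_second_derivative[OF sm, where \<phi>' = "\<lambda>y. (H \<epsilon> b y - H \<epsilon> a y) / (b - a) - (H \<epsilon> b' y - H \<epsilon> a' y) / (b' - a')"])
      show "?\<phi> y = 0" if "\<bar>y - c\<bar> > 1" for y using that \<epsilon> assms(3) by (intro 0) linarith
    qed (use \<epsilon> in \<open>auto intro!: DERIV_diff DERIV_cdivide P_deriv H_deriv\<close>)
    moreover have "(LINT y:?I|lborel. z y * ((K \<epsilon> b y - K \<epsilon> a y) / (b - a) - (K \<epsilon> b' y - K \<epsilon> a' y) / (b' - a')))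
        = (?A \<epsilon> b - ?A \<epsilon> a) / (b - a) - (?A \<epsilon> b' - ?A \<epsilon> a') / (b' - a')"
    proof -
      have eq: "z y * ((K \<epsilon> b y - K \<epsilon> a y) / (b - a) - (K \<epsilon> b' y - K \<epsilon> a' y) / (b' - a'))
          = (z y * K \<epsilon> b y - z y * K \<epsilon> a y) / (b - a) - (z y * K \<epsilon> b' y - z y * K \<epsilon> a' y) / (b' - a')" for y
        by (simp add: right_diff_distrib)
      have D: "set_integrable lborel ?I (\<lambda>y. (z y * K \<epsilon> b y - z y * K \<epsilon> a y) / (b - a))" for a b
        by (rule set_integrable_divide, rule set_integral_diff(1)) (rule KI)+
      show ?thesis unfolding eq by (simp only: set_integral_diff(2)[OF D D] set_integral_divide_zero set_integral_diff(2)[OF KI KI])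
    qed
    moreover have "(LINT y:?I|lborel. w y * ?\<phi> y) = (LINT y:{c - (\<rho> + \<epsilon>)..c + (\<rho> + \<epsilon>)}|lborel. w y * ?\<phi> y)"
    proof (rule set_integral_support)
      show "{c - (\<rho> + \<epsilon>)..c + (\<rho> + \<epsilon>)} \<subseteq> ?I" using \<epsilon> assms(3) by auto
      fix y assume "y \<notin> {c - (\<rho> + \<epsilon>)..c + (\<rho> + \<epsilon>)}"
      then have "\<not> (c - (\<rho> + \<epsilon>) \<le> y \<and> y \<le> c + (\<rho> + \<epsilon>))" by simp
      then have "\<bar>y - c\<bar> \<ge> \<rho> + \<epsilon>" by linarith
      from 0[OF this] show "w y * ?\<phi> y = 0" by simp
    qed
    moreover have "\<bar>LINT y:{c - (\<rho> + \<epsilon>)..c + (\<rho> + \<epsilon>)}|lborel. w y * ?\<phi> y\<bar>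
        \<le> 1 * (LINT y:{c - (\<rho> + \<epsilon>)..c + (\<rho> + \<epsilon>)}|lborel. \<bar>w y\<bar>)"
      by (rule set_integral_abs_bound[OF w_L2 cphi bd refl])
    moreover have "(LINT y:{c - (\<rho> + \<epsilon>)..c + (\<rho> + \<epsilon>)}|lborel. \<bar>w y\<bar>) \<le> sqrt (2 * (\<rho> + \<epsilon>)) * W"
      using L1_le_L2[OF w_L2, of "c - (\<rho> + \<epsilon>)" "c + (\<rho> + \<epsilon>)"] \<epsilon> \<rho> assms(3) pi_ge_two
      by (simp add: W_def algebra_simps)
    ultimately show ?thesis by simp
  qed
  have "\<forall>\<^sub>F \<epsilon> in at_right 0. \<bar>(?A \<epsilon> b - ?A \<epsilon> a) / (b - a) - (?A \<epsilon> b' - ?A \<epsilon> a') / (b' - a')\<bar> \<le> sqrt (2 * (\<rho> + \<epsilon>)) * W"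
    by (rule eventually_mono[OF eventually_at_right_real[of 0 "1/2"]]) (use step in auto)
  moreover have "((\<lambda>\<epsilon>. \<bar>(?A \<epsilon> b - ?A \<epsilon> a) / (b - a) - (?A \<epsilon> b' - ?A \<epsilon> a') / (b' - a')\<bar>) \<longlongrightarrow> \<bar>Q a b - Q a' b'\<bar>) (at_right 0)"
    unfolding Q_def using pts assms(1-3)
    by (intro tendsto_rabs tendsto_diff tendsto_divide K_limit z_cont tendsto_const) auto
  moreover have "((\<lambda>\<epsilon>. sqrt (2 * (\<rho> + \<epsilon>)) * W) \<longlongrightarrow> sqrt (2 * (\<rho> + 0)) * W) (at_right 0)"
    by (intro tendsto_intros)
  ultimately show ?thesis
    by (intro tendsto_le[of "at_right 0" _ "sqrt (2 * \<rho>) * W"]) auto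
qed

text \<open>
  By the previous bound the difference quotients at \<open>x\<close> satisfy a Cauchy criterion.
\<close>

lemma z_differentiable: "\<exists>d. (z has_real_derivative d) (at x)"
proof -
  define q where "q n = Q x (x + 1 / Suc n)" for n
  have hs: "1 / real (Suc m) \<le> 1 / real (Suc n)" if "n \<le> m" for n m using that by (simp add: frac_le)
  have inv0: "(\<lambda>n. 1 / real (Suc n)) \<longlonglongrightarrow> 0" by (rule LIMSEQ_Suc[OF lim_1_over_n])
  have root0: "(\<lambda>n. sqrt (2 * (1 / real (Suc n))) * W) \<longlonglongrightarrow> sqrt (2 * 0) * W" by (intro tendsto_intros inv0)
  have "Cauchy q"
  proof (rule metric_CauchyI)
    fix e :: real assume "e > 0"
    with root0 have "\<forall>\<^sub>F n in sequentially. sqrt (2 * (1 / real (Suc n))) * W < e"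
      by (intro order_tendstoD(2)) auto
    then obtain N where N: "sqrt (2 * (1 / real (Suc n))) * W < e" if "n \<ge> N" for n
      by (auto simp: eventually_sequentially)
    show "\<exists>M. \<forall>m\<ge>M. \<forall>n\<ge>M. dist (q m) (q n) < e"
    proof (intro exI allI impI)
      fix m n assume mn: "m \<ge> N + 1" "n \<ge> N + 1"
      have "\<bar>q m - q n\<bar> \<le> sqrt (2 * (1 / Suc (N + 1))) * W"
        unfolding q_def using hs[OF mn(1)] hs[OF mn(2)]
        by (intro Q_diff_bound[where c = x]) (auto simp del: of_nat_Suc simp: of_nat_Suc[of "N + 1"] field_simps)
      also have "\<dots> < e" by (rule N) simp
      finally show "dist (q m) (q n) < e" by (simp add: dist_real_def)
    qed
  qed
  then obtain d where d: "q \<longlonglongrightarrow> d" using Cauchy_convergent_iff convergent_def by blast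
  have "\<bar>Q x y - d\<bar> \<le> sqrt (2 * \<bar>y - x\<bar>) * W" if "y \<noteq> x" "\<bar>y - x\<bar> < 1/2" for y
  proof -
    have "\<forall>\<^sub>F n in sequentially. 1 / real (Suc n) < \<bar>y - x\<bar>"
      using that by (intro order_tendstoD(2)[OF inv0]) auto
    then have "\<forall>\<^sub>F n in sequentially. \<bar>Q x y - q n\<bar> \<le> sqrt (2 * \<bar>y - x\<bar>) * W"
      unfolding q_def by eventually_elim (use that in \<open>intro Q_diff_bound[where c = x]; auto\<close>)
    moreover have "(\<lambda>n. \<bar>Q x y - q n\<bar>) \<longlonglongrightarrow> \<bar>Q x y - d\<bar>" by (intro tendsto_intros d)
    ultimately show ?thesis by (intro tendsto_upperbound) auto
  qed
  then have "\<forall>\<^sub>F y in at x. norm (Q x y - d) \<le> sqrt (2 * \<bar>y - x\<bar>) * W"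
    unfolding eventually_at by (intro exI[of _ "1/2"]) (auto simp: dist_real_def)
  moreover have "((\<lambda>y. sqrt (2 * \<bar>y - x\<bar>) * W) \<longlongrightarrow> sqrt (2 * \<bar>x - x\<bar>) * W) (at x)"
    by (intro tendsto_intros)
  ultimately have "((\<lambda>y. Q x y - d) \<longlongrightarrow> 0) (at x)"
    by (rule_tac Lim_null_comparison[of _ "\<lambda>y. sqrt (2 * \<bar>y - x\<bar>) * W"]) auto
  then have "((\<lambda>y. Q x y) \<longlongrightarrow> d) (at x)" by (simp add: LIM_zero_iff)
  then show ?thesis unfolding Q_def has_field_derivative_iff by blast
qed

lemma Q_deriv_bound:
  assumes "(z has_real_derivative d) (at x)" "a' \<noteq> b'" and "\<rho> \<le> 1/2"
    and pts: "\<bar>x - c\<bar> < \<rho>" "\<bar>a' - c\<bar> \<le> \<rho>" "\<bar>b' - c\<bar> \<le> \<rho>"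
  shows "\<bar>d - Q a' b'\<bar> \<le> sqrt (2 * \<rho>) * W"
proof -
  have "(Q x \<longlongrightarrow> d) (at x)" using assms(1) by (simp add: has_field_derivative_iff Q_def[abs_def])
  then have "((\<lambda>y. \<bar>Q x y - Q a' b'\<bar>) \<longlongrightarrow> \<bar>d - Q a' b'\<bar>) (at x)" by (intro tendsto_intros)
  moreover have "\<forall>\<^sub>F y in at x. \<bar>Q x y - Q a' b'\<bar> \<le> sqrt (2 * \<rho>) * W"
    unfolding eventually_at
    by (intro exI[of _ "\<rho> - \<bar>x - c\<bar>"]) (use assms in \<open>auto simp: dist_real_def intro!: Q_diff_bound[where c = c]\<close>)
  ultimately show ?thesis by (intro tendsto_upperbound) auto
qed

lemma deriv_modulus:
  assumes "(z has_real_derivative d) (at x)" "(z has_real_derivative d') (at y)" "\<bar>x - y\<bar> \<le> 1/4"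
  shows "\<bar>d - d'\<bar> \<le> 2 * sqrt \<bar>x - y\<bar> * W"
proof (cases "x = y")
  case True
  then show ?thesis using assms DERIV_unique by fastforce
next
  case False
  have "(Q y \<longlongrightarrow> d') (at y)" using assms(2) by (simp add: has_field_derivative_iff Q_def[abs_def])
  then have "((\<lambda>t. \<bar>d - Q y t\<bar>) \<longlongrightarrow> \<bar>d - d'\<bar>) (at y)" by (intro tendsto_intros)
  moreover have "\<forall>\<^sub>F t in at y. \<bar>d - Q y t\<bar> \<le> sqrt (2 * (2 * \<bar>x - y\<bar>)) * W"
    unfolding eventually_at
  proof (intro exI[of _ "\<bar>x - y\<bar>"] conjI ballI impI)
    fix t assume t: "t \<noteq> y \<and> dist t y < \<bar>x - y\<bar>"
    show "\<bar>d - Q y t\<bar> \<le> sqrt (2 * (2 * \<bar>x - y\<bar>)) * W"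
    proof (rule Q_deriv_bound[OF assms(1), where c = x])
      have "\<bar>t - y\<bar> < \<bar>x - y\<bar>" using t by (simp add: dist_real_def)
      then show "\<bar>t - x\<bar> \<le> 2 * \<bar>x - y\<bar>"
        using abs_triangle_ineq[of "t - y" "y - x"] abs_minus_commute[of x y] by simp
    qed (use t False assms(3) in \<open>auto simp: abs_minus_commute[of y x]\<close>)
  qed (use False in auto)
  ultimately have "\<bar>d - d'\<bar> \<le> sqrt (2 * (2 * \<bar>x - y\<bar>)) * W" by (intro tendsto_upperbound) auto
  also have "sqrt (2 * (2 * \<bar>x - y\<bar>)) = 2 * sqrt \<bar>x - y\<bar>" by (simp add: real_sqrt_mult)
  finally show ?thesis .
qed

lemma deriv_bound:
  assumes "(z has_real_derivative d) (at x)" and "\<And>a. \<bar>z a\<bar> \<le> S"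
  shows "\<bar>d\<bar> \<le> 4 * S + W"
proof -
  have "\<bar>d - Q x (x + 1/2)\<bar> \<le> sqrt (2 * (1/2)) * W"
    by (rule Q_deriv_bound[OF assms(1), where c = x]) auto
  moreover have "Q x (x + 1/2) = 2 * (z (x + 1/2) - z x)" by (simp add: Q_def)
  then have "\<bar>Q x (x + 1/2)\<bar> = 2 * \<bar>z (x + 1/2) - z x\<bar>" by (simp only: abs_mult abs_numeral)
  moreover have "\<bar>z (x + 1/2) - z x\<bar> \<le> 2 * S" using assms(2)[of "x + 1/2"] assms(2)[of x] by linarith
  moreover note abs_triangle_ineq2[of d "Q x (x + 1/2)"]
  ultimately show ?thesis by simp
qed

end

lemma test_function_deriv:
  assumes "test_function \<Omega> \<phi>" shows "test_function \<Omega> (deriv \<phi>)"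
proof -
  have sm: "smooth \<phi>" using assms by (simp add: test_function_def)
  have "deriv \<phi> (x + 2 * pi) = deriv \<phi> x" if "\<Omega> = Torus" for x
    by (rule derivative_periodic[OF smooth_deriv(2)[OF sm], of 0])
      (use assms that in \<open>auto simp: test_function_def function_on_def\<close>)
  then have "function_on \<Omega> (deriv \<phi>)" by (cases \<Omega>) (auto simp: function_on_def)
  moreover have "bounded {x. deriv \<phi> x \<noteq> 0}" if Line: "\<Omega> = Line"
  proof -
    obtain b where b: "\<And>x. \<phi> x \<noteq> 0 \<Longrightarrow> \<bar>x\<bar> \<le> b"
      using assms Line by (auto simp: test_function_def bounded_iff)
    have "deriv \<phi> x = 0" if "\<bar>x - 0\<bar> > b" for x
      by (rule derivative_zero_outside[OF _ smooth_deriv(2)[OF sm] that]) (use b in force)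
    then show ?thesis unfolding bounded_iff by (intro exI[of _ b]) force
  qed
  ultimately show ?thesis using smooth_deriv(1)[OF sm] by (simp add: test_function_def)
qed

text \<open>
  The derivative of a test function is a test function, so against derivatives any two weak
  derivatives of \<open>u\<close> agree by definition. Thus the second derivative of a function in \<open>H\<^sup>2\<close> does not depend on
  the choice of the first one.
\<close>

lemma weak_derivative_transfer:
  assumes "has_weak_derivative \<Omega> u v" "has_weak_derivative \<Omega> u v'" "has_weak_derivative \<Omega> v w"
  shows "has_weak_derivative \<Omega> v' w"
  unfolding has_weak_derivative_def
proof (intro allI impI)
  fix \<phi> assume \<phi>: "test_function \<Omega> \<phi>"
  note d = test_function_deriv[OF \<phi>]
  have "(LINT x:cell \<Omega>|lborel. v' x * deriv \<phi> x) = (LINT x:cell \<Omega>|lborel. v x * deriv \<phi> x)"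
    using assms(1,2) d by (auto simp: has_weak_derivative_def)
  then show "(LINT x:cell \<Omega>|lborel. v' x * deriv \<phi> x) = - (LINT x:cell \<Omega>|lborel. w x * \<phi> x)"
    using assms(3) \<phi> by (auto simp: has_weak_derivative_def)
qed

lemma H2_weak_derivatives:
  assumes "z \<in> H2 \<Omega>"
  defines "v \<equiv> weak_derivative \<Omega> z" defines "w \<equiv> weak_derivative \<Omega> v"
  shows "v \<in> L2 \<Omega>" "has_weak_derivative \<Omega> z v" "w \<in> L2 \<Omega>" "has_weak_derivative \<Omega> v w"
proof -
  obtain v0 w0 where vw: "v0 \<in> L2 \<Omega>" "w0 \<in> L2 \<Omega>" "has_weak_derivative \<Omega> z v0" "has_weak_derivative \<Omega> v0 w0"
    using assms(1) by (auto simp: H2_def)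
  show v: "v \<in> L2 \<Omega>" "has_weak_derivative \<Omega> z v"
    using someI[of "\<lambda>v. v \<in> L2 \<Omega> \<and> has_weak_derivative \<Omega> z v", OF conjI[OF vw(1,3)]]
    by (auto simp: v_def weak_derivative_def)
  have "has_weak_derivative \<Omega> v w0" by (rule weak_derivative_transfer[OF vw(3) v(2) vw(4)])
  then show "w \<in> L2 \<Omega>" "has_weak_derivative \<Omega> v w"
    using someI[of "\<lambda>w. w \<in> L2 \<Omega> \<and> has_weak_derivative \<Omega> v w", OF conjI[OF vw(2)]]
    by (auto simp: w_def weak_derivative_def)
qed

text \<open>
  The constants in \<open>sup_bound\<close> and \<open>deriv_bound\<close> depend on the mollifier only, so one mollifier, fixed in advance,
  gives a constant that is uniform in \<open>\<Omega>\<close> and \<open>z\<close>.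
\<close>

lemma Sobolev_embedding:
  "\<exists>C>0. \<forall>\<Omega>. \<forall>z\<in>H2 \<Omega>. (\<forall>x. \<bar>z x\<bar> \<le> C * H2_norm \<Omega> z) \<and>
     (\<forall>x. (z has_real_derivative deriv z x) (at x) \<and> \<bar>deriv z x\<bar> \<le> C * H2_norm \<Omega> z) \<and> continuous_on UNIV (deriv z)"
proof -
  obtain r R1 R B where "mollifier r R1 R B" using mollifier_exists by blast
  then interpret mollifier r R1 R B .
  have B: "B \<ge> 0" using r_nonneg r_le order_trans by blast
  define C where "C = 2 * B * sqrt 2 + 1 / 2 * sqrt 2"
  have C: "C > 0" using B by (simp add: C_def add_nonneg_pos)
  show ?thesis
  proof (intro exI[of _ "4 * C + 1"] conjI ballI allI)
    show "0 < 4 * C + 1" using C by simp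
    fix \<Omega> z assume z: "z \<in> H2 \<Omega>"
    define v where "v = weak_derivative \<Omega> z"
    define w where "w = weak_derivative \<Omega> v"
    interpret weakly_twice_differentiable r R1 R B \<Omega> z v w
      by unfold_locales (use z H2_weak_derivatives[OF z] in \<open>auto simp: v_def w_def H2_def\<close>)
    have ZN: "Z \<le> H2_norm \<Omega> z" "W \<le> H2_norm \<Omega> z"
      unfolding Z_def W_def H2_norm_def v_def[symmetric] w_def[symmetric]
      using L2_integral_nonneg by (auto intro!: add_increasing add_nonneg_nonneg)
    have N: "0 \<le> H2_norm \<Omega> z" using ZN(1) Z_W_nonneg(1) by linarith
    have sup: "\<bar>z x\<bar> \<le> C * H2_norm \<Omega> z" for x
    proof -
      have "\<bar>z x\<bar> \<le> 2 * B * (sqrt 2 * Z) + 1 / 2 * (sqrt 2 * W)" by (rule sup_bound)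
      also have "\<dots> \<le> 2 * B * (sqrt 2 * H2_norm \<Omega> z) + 1 / 2 * (sqrt 2 * H2_norm \<Omega> z)"
        using ZN B by (intro add_mono mult_left_mono) auto
      finally show ?thesis by (simp add: C_def algebra_simps)
    qed
    show "\<bar>z x\<bar> \<le> (4 * C + 1) * H2_norm \<Omega> z" for x
    proof (rule order_trans[OF sup])
      show "C * H2_norm \<Omega> z \<le> (4 * C + 1) * H2_norm \<Omega> z" using N C by (intro mult_right_mono) auto
    qed
    show d: "(z has_real_derivative deriv z x) (at x)" for x
      using z_differentiable[of x] DERIV_imp_deriv by metis
    show "\<bar>deriv z x\<bar> \<le> (4 * C + 1) * H2_norm \<Omega> z" for x
      using deriv_bound[OF d sup, of x] ZN(2) by (simp add: algebra_simps)
    show "continuous_on UNIV (deriv z)"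
      unfolding continuous_on_eq_continuous_at[OF open_UNIV] isCont_def
    proof (intro ballI)
      fix x :: real
      have "\<forall>\<^sub>F y in at x. norm (deriv z y - deriv z x) \<le> 2 * sqrt \<bar>y - x\<bar> * W"
        unfolding eventually_at
        by (intro exI[of _ "1/4"]) (use deriv_modulus[OF d d] in \<open>auto simp: dist_real_def\<close>)
      moreover have "((\<lambda>y. 2 * sqrt \<bar>y - x\<bar> * W) \<longlongrightarrow> 2 * sqrt \<bar>x - x\<bar> * W) (at x)"
        by (intro tendsto_intros)
      ultimately have "((\<lambda>y. deriv z y - deriv z x) \<longlongrightarrow> 0) (at x)"
        by (rule_tac Lim_null_comparison[of _ "\<lambda>y. 2 * sqrt \<bar>y - x\<bar> * W"]) auto
      then show "(deriv z \<longlongrightarrow> deriv z x) (at x)" by (simp add: LIM_zero_iff)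
    qed
  qed
qed

section \<open>Weak and classical derivatives\<close>

text \<open>
  On a window of length one, the measurable sets over which the integral vanishes include the closed
  intervals and are closed under complements and countable disjoint unions.
\<close>

lemma set_integral_intervals_zero_imp_AE_zero:
  fixes g :: "real \<Rightarrow> real"
  assumes int: "\<And>a b. set_integrable lborel {a..b} g"
    and zero: "\<And>a b. b - a \<le> 1 \<Longrightarrow> (LINT x:{a..b}|lborel. g x) = 0"
  shows "AE x in lborel. g x = 0"
proof -
  have "AE x in lborel. indicat_real {of_int m..of_int m + 1} x * g x = 0" for m :: int
  proof -
    define f where "f x = indicat_real {of_int m..of_int m + 1} x * g x" for x
    have fi: "integrable lborel f" using int[of "of_int m" "of_int m + 1"] by (simp add: f_def[abs_def] set_integrable_def)
    have fsi: "set_integrable lborel A f" if "A \<in> sets borel" for A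
      using that integrable_mult_indicator[OF _ fi, of A] by (simp add: set_integrable_def)
    have Icc: "(LINT x:{a..b}|lborel. f x) = 0" for a b
    proof -
      have "(LINT x:{a..b}|lborel. f x) = (LINT x:{max a (of_int m)..min b (of_int m + 1)}|lborel. g x)"
        unfolding set_lebesgue_integral_def f_def
        by (intro Bochner_Integration.integral_cong) (auto simp: indicator_def)
      also have "\<dots> = 0" by (rule zero) (simp add: min_def max_def)
      finally show ?thesis .
    qed
    have UN: "(LINT x:UNIV|lborel. f x) = 0"
      using zero[of "of_int m + 1" "of_int m"] by (simp add: f_def[abs_def] set_lebesgue_integral_def)
    have "(LINT x:A|lborel. f x) = 0" if "A \<in> sets borel" for A
      using that
    proof (induction A rule: borel_set_induct)
      case empty
      then show ?case by (simp add: set_lebesgue_integral_def)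
    next
      case (interval a b)
      show ?case by (rule Icc)
    next
      case (compl A)
      have "(LINT x:A \<union> - A|lborel. f x) = (LINT x:A|lborel. f x) + (LINT x:- A|lborel. f x)"
        by (rule set_integral_Un) (use fsi compl in auto)
      then show ?case using compl UN by simp
    next
      case (union A)
      have "(LINT x:\<Union>(range A)|lborel. f x) = (\<Sum>i. (LINT x:A i|lborel. f x))"
        by (rule lebesgue_integral_countable_add)
          (use union fsi in \<open>auto simp: disjoint_family_on_def\<close>)
      then show ?case using union by simp
    qed
    then have "AE x in lborel. f x = 0"
      by (rule_tac sigma_finite_measure.density_zero[OF sigma_finite_lborel fi]) auto
    then show ?thesis by (simp add: f_def)
  qed
  then have "AE x in lborel. \<forall>m::int. indicat_real {of_int m..of_int m + 1} x * g x = 0"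
    by (subst AE_all_countable) blast
  then show ?thesis
  proof eventually_elim
    case (elim x)
    have "x \<in> {of_int \<lfloor>x\<rfloor>..of_int \<lfloor>x\<rfloor> + 1}" by auto
    then show ?case using elim[rule_format, of "\<lfloor>x\<rfloor>"] by simp
  qed
qed

text \<open>
  The differences of two smoothed Heaviside functions are bounded test functions that converge to the
  indicator function of an interval.
\<close>

lemma weakly_zero_imp_AE_zero:
  assumes g: "g \<in> L2 \<Omega>"
    and zero: "\<And>c \<phi>. smooth \<phi> \<Longrightarrow> (\<And>x. \<bar>x - c\<bar> > 1 \<Longrightarrow> \<phi> x = 0) \<Longrightarrow> (LINT x:{c - 1..c + 1}|lborel. g x * \<phi> x) = 0"
  shows "AE x in lborel. g x = 0"
proof -
  obtain r R1 R B where "mollifier r R1 R B" using mollifier_exists by blast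
  then interpret mollifier r R1 R B .
  have int: "set_integrable lborel {a..b} g" for a b
    using L2_mult_continuous_integrable[OF g, of a b "\<lambda>_. 1"] by simp
  have small: "(LINT x:{a..b}|lborel. g x) = 0" if ab: "a < b" "b - a \<le> 1" for a b
  proof -
    define c where "c = (a + b) / 2"
    define e :: "nat \<Rightarrow> real" where "e n = 1 / (real n + 4)" for n
    have e: "e n > 0" "e n \<le> 1/4" for n by (auto simp: e_def field_simps)
    have e0: "e \<longlonglongrightarrow> 0" 
      using LIMSEQ_ignore_initial_segment[OF lim_1_over_n, of 4] by (simp add: e_def[abs_def])
    define \<phi> where "\<phi> n y = H (e n) a y - H (e n) b y" for n y
    have s\<phi>: "smooth (\<phi> n)" for n unfolding \<phi>_def[abs_def] by (intro smooth_diff smooth_PHK)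
    have z: "(LINT x:{c - 1..c + 1}|lborel. g x * \<phi> n x) = 0" for n
    proof (rule zero[OF s\<phi>])
      fix x assume x: "\<bar>x - c\<bar> > 1"
      show "\<phi> n x = 0"
      proof (cases "x \<le> c")
        case True
        then have "x \<le> a - e n" "x \<le> b - e n" using x ab e[of n] by (auto simp: c_def abs_if field_simps split: if_splits)
        then show ?thesis using PHK_values(3)[OF e(1)[of n]] by (simp add: \<phi>_def)
      next
        case False
        then have "x \<ge> a + e n" "x \<ge> b + e n" using x ab e[of n] by (auto simp: c_def abs_if field_simps split: if_splits)
        then show ?thesis using PHK_values(4)[OF e(1)[of n]] by (simp add: \<phi>_def)
      qed
    qed
    have b1: "\<bar>\<phi> n x\<bar> \<le> 1" for n x
      using PHK_values(5,6)[OF e(1)[of n], of a x] PHK_values(5,6)[OF e(1)[of n], of b x]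
      unfolding \<phi>_def by linarith
    have m: "g \<in> borel_measurable borel" "\<And>n. \<phi> n \<in> borel_measurable borel"
      using L2_D(1)[OF g] s\<phi> by (auto intro!: borel_measurable_continuous_onI smooth_continuous)
    have "(\<lambda>n. LINT x|lborel. indicat_real {c - 1..c + 1} x *\<^sub>R (g x * \<phi> n x))
      \<longlonglongrightarrow> (LINT x|lborel. indicat_real {a..b} x *\<^sub>R g x)"
    proof (rule integral_dominated_convergence[where w = "\<lambda>x. indicat_real {c - 1..c + 1} x *\<^sub>R \<bar>g x\<bar>"])
      show "integrable lborel (\<lambda>x. indicat_real {c - 1..c + 1} x *\<^sub>R \<bar>g x\<bar>)"
        using set_integrable_abs[OF int] by (simp add: set_integrable_def)
      show "AE x in lborel. norm (indicat_real {c - 1..c + 1} x *\<^sub>R (g x * \<phi> n x))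
          \<le> indicat_real {c - 1..c + 1} x *\<^sub>R \<bar>g x\<bar>" for n
        using mult_left_mono[OF b1, of "\<bar>g _\<bar>"] by (intro AE_I2) (auto simp: indicator_def abs_mult)
      show "AE x in lborel. (\<lambda>n. indicat_real {c - 1..c + 1} x *\<^sub>R (g x * \<phi> n x)) \<longlonglongrightarrow> indicat_real {a..b} x *\<^sub>R g x"
        using AE_lborel_singleton[of a] AE_lborel_singleton[of b]
      proof eventually_elim
        case (elim x)
        define d where "d = min \<bar>x - a\<bar> \<bar>x - b\<bar>"
        have "d > 0" using elim by (simp add: d_def)
        then have "\<forall>\<^sub>F n in sequentially. e n < d" using e0 by (intro order_tendstoD(2))
        then have "\<forall>\<^sub>F n in sequentially. \<phi> n x = indicat_real {a..b} x"
        proof eventually_elim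
          case (elim n)
          then have d: "e n < \<bar>x - a\<bar>" "e n < \<bar>x - b\<bar>" by (auto simp: d_def)
          consider "x < a" | "a \<le> x" "x \<le> b" | "x > b" by linarith
          then show ?case
          proof cases
            case 1
            then have "x \<le> a - e n" "x \<le> b - e n" using d ab by linarith+
            then show ?thesis using PHK_values(3)[OF e(1)[of n]] 1 by (simp add: \<phi>_def)
          next
            case 2
            then have "x \<ge> a + e n" "x \<le> b - e n" using d by linarith+
            then show ?thesis using PHK_values(3,4)[OF e(1)[of n]] 2 by (simp add: \<phi>_def)
          next
            case 3
            then have "x \<ge> a + e n" "x \<ge> b + e n" using d ab by linarith+
            then show ?thesis using PHK_values(4)[OF e(1)[of n]] 3 by (simp add: \<phi>_def)
          qed
        qed
        moreover have "indicat_real {c - 1..c + 1} x *\<^sub>R (g x * indicat_real {a..b} x) = indicat_real {a..b} x *\<^sub>R g x"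
          using ab by (auto simp: indicator_def c_def field_simps)
        ultimately show ?case
          by (intro tendsto_eventually) (auto elim!: eventually_mono)
      qed
    qed (use m in auto)
    then have "(\<lambda>n. 0) \<longlonglongrightarrow> (LINT x:{a..b}|lborel. g x)"
      using z by (simp add: set_lebesgue_integral_def)
    then show ?thesis using LIMSEQ_unique[OF tendsto_const] by metis
  qed
  have "(LINT x:{a..b}|lborel. g x) = 0" if "b - a \<le> 1" for a b
  proof (cases "a < b")
    case False
    have "AE x in lborel. indicat_real {a..b} x *\<^sub>R g x = 0"
      using AE_lborel_singleton[of a] by eventually_elim (use False in \<open>auto simp: indicator_def\<close>)
    then show ?thesis unfolding set_lebesgue_integral_def by (rule integral_eq_zero_AE)
  qed (rule small[OF _ that])
  then show ?thesis by (rule set_integral_intervals_zero_imp_AE_zero[OF int])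
qed

lemma weak_derivative_unique:
  assumes "has_weak_derivative \<Omega> u v" "has_weak_derivative \<Omega> u v'" "u \<in> L2 \<Omega>" "v \<in> L2 \<Omega>" "v' \<in> L2 \<Omega>"
  shows "AE x in lborel. v x = v' x"
proof -
  have "AE x in lborel. v x - v' x = 0"
  proof (rule weakly_zero_imp_AE_zero[OF L2_diff[OF assms(4,5)]])
    fix c \<phi> assume \<phi>: "smooth \<phi>" "\<And>x. \<bar>x - c\<bar> > 1 \<Longrightarrow> \<phi> x = (0::real)"
    have I: "set_integrable lborel {c - 1..c + 1} (\<lambda>x. v x * \<phi> x)" "set_integrable lborel {c - 1..c + 1} (\<lambda>x. v' x * \<phi> x)"
      using smooth_continuous[OF \<phi>(1)]
      by (auto intro!: L2_mult_continuous_integrable[OF assms(4)] L2_mult_continuous_integrable[OF assms(5)] borel_measurable_continuous_onI)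
    show "(LINT x:{c - 1..c + 1}|lborel. (v x - v' x) * \<phi> x) = 0"
      using weak_derivative_local[OF assms(1,3,4) \<phi>] weak_derivative_local[OF assms(2,3,5) \<phi>]
      by (simp add: left_diff_distrib I)
  qed
  then show ?thesis by simp
qed

text \<open>
  A class of functions, stable under differences, that lies in \<open>L\<^sup>2\<close> on both domains and for which
  integration by parts has no boundary terms.
\<close>

definition admissible :: "spatial_domain \<Rightarrow> (real \<Rightarrow> real) \<Rightarrow> bool" where
  "admissible \<Omega> f \<longleftrightarrow> continuous_on UNIV f \<and> function_on \<Omega> f \<and> (\<Omega> = Line \<longrightarrow> (\<exists>\<rho>. \<forall>x. \<bar>x\<bar> > \<rho> \<longrightarrow> f x = 0))"

lemma admissible_L2:
  assumes "admissible \<Omega> f" shows "f \<in> L2 \<Omega>"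
proof -
  have c: "continuous_on UNIV f" using assms by (simp add: admissible_def)
  have I: "set_integrable lborel {a..b} (\<lambda>x. (f x)\<^sup>2)" for a b
    by (intro borel_integrable_atLeastAtMost' continuous_intros continuous_on_subset[OF c]) auto
  have "set_integrable lborel (cell \<Omega>) (\<lambda>x. (f x)\<^sup>2)"
  proof (cases \<Omega>)
    case Line
    then obtain \<rho> where "\<And>x. \<bar>x\<bar> > \<rho> \<Longrightarrow> f x = 0" using assms by (auto simp: admissible_def)
    then have "indicat_real {-\<rho>..\<rho>} x *\<^sub>R (f x)\<^sup>2 = (f x)\<^sup>2" for x by (force simp: indicator_def)
    then have "(\<lambda>x. indicat_real {-\<rho>..\<rho>} x *\<^sub>R (f x)\<^sup>2) = (\<lambda>x. (f x)\<^sup>2)" by blast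
    then show ?thesis using I[of "-\<rho>" \<rho>] Line by (simp only: set_integrable_def) (simp add: cell_def)
  qed (use I in \<open>simp add: cell_def\<close>)
  then show ?thesis using assms c by (auto simp: L2_def admissible_def borel_measurable_continuous_onI)
qed

lemma admissible_diff:
  assumes "admissible \<Omega> f" "admissible \<Omega> g" shows "admissible \<Omega> (\<lambda>x. f x - g x)"
proof -
  have "\<exists>\<rho>. \<forall>x. \<bar>x\<bar> > \<rho> \<longrightarrow> f x - g x = 0" if Line: "\<Omega> = Line"
  proof -
    obtain a b where "\<And>x. \<bar>x\<bar> > a \<Longrightarrow> f x = 0" "\<And>x. \<bar>x\<bar> > b \<Longrightarrow> g x = 0"
      using assms Line by (auto simp: admissible_def)
    then show ?thesis by (intro exI[of _ "max a b"]) auto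
  qed
  then show ?thesis
    using assms by (cases \<Omega>) (auto simp: admissible_def function_on_def intro!: continuous_intros)
qed

lemma classical_derivative_is_weak:
  assumes "admissible \<Omega> z" "admissible \<Omega> z'" "\<And>x. (z has_real_derivative z' x) (at x)"
  shows "has_weak_derivative \<Omega> z z'"
  unfolding has_weak_derivative_def
proof (intro allI impI)
  fix \<phi> assume \<phi>: "test_function \<Omega> \<phi>"
  have sm: "smooth \<phi>" using \<phi> by (simp add: test_function_def)
  have c: "continuous_on UNIV z" "continuous_on UNIV z'" "continuous_on UNIV \<phi>" "continuous_on UNIV (deriv \<phi>)"
    using assms smooth_continuous[OF sm] smooth_continuous[OF smooth_deriv(1)[OF sm]] by (auto simp: admissible_def)
  have FTC: "(LINT x:{a..b}|lborel. z x * deriv \<phi> x) + (LINT x:{a..b}|lborel. z' x * \<phi> x) = z b * \<phi> b - z a * \<phi> a"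
    if "a \<le> b" for a b
  proof -
    have "(LINT x:{a..b}|lborel. z x * deriv \<phi> x + z' x * \<phi> x) = z b * \<phi> b - z a * \<phi> a"
      unfolding set_lebesgue_integral_def
    proof (rule integral_FTC_atLeastAtMost[OF that])
      fix x
      have "((\<lambda>x. z x * \<phi> x) has_real_derivative z x * deriv \<phi> x + z' x * \<phi> x) (at x)"
        using DERIV_mult[OF assms(3) smooth_deriv(2)[OF sm], of x] by (simp add: mult_ac add.commute)
      then show "((\<lambda>x. z x * \<phi> x) has_vector_derivative z x * deriv \<phi> x + z' x * \<phi> x) (at x within {a..b})"
        by (simp add: has_real_derivative_iff_has_vector_derivative has_vector_derivative_at_within)
    qed (intro continuous_intros continuous_on_subset[OF c(1)] continuous_on_subset[OF c(2)] continuous_on_subset[OF c(3)] continuous_on_subset[OF c(4)]; simp)+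
    moreover have "set_integrable lborel {a..b} (\<lambda>x. z x * deriv \<phi> x)" "set_integrable lborel {a..b} (\<lambda>x. z' x * \<phi> x)"
      by (intro borel_integrable_atLeastAtMost' continuous_intros continuous_on_subset[OF c(1)] continuous_on_subset[OF c(2)] continuous_on_subset[OF c(3)] continuous_on_subset[OF c(4)]; simp)+
    ultimately show ?thesis by simp
  qed
  show "(LINT x:cell \<Omega>|lborel. z x * deriv \<phi> x) = - (LINT x:cell \<Omega>|lborel. z' x * \<phi> x)"
  proof (cases \<Omega>)
    case Line
    then obtain \<rho> where \<rho>: "\<And>x. \<bar>x\<bar> > \<rho> \<Longrightarrow> z x = 0" using assms(1) by (auto simp: admissible_def)
    define b where "b = \<bar>\<rho>\<bar> + 1"
    have z0: "z x = 0" if "\<bar>x\<bar> \<ge> b" for x using that by (intro \<rho>) (simp add: b_def)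
    have z0': "z' x = 0" if "\<bar>x - 0\<bar> > b" for x
      by (rule derivative_zero_outside[OF z0 assms(3) that]) simp
    have "(LINT x:cell \<Omega>|lborel. z x * deriv \<phi> x) = (LINT x:{-b..b}|lborel. z x * deriv \<phi> x)"
      by (rule set_integral_support) (use Line z0 in \<open>auto simp: cell_def\<close>)
    moreover have "(LINT x:cell \<Omega>|lborel. z' x * \<phi> x) = (LINT x:{-b..b}|lborel. z' x * \<phi> x)"
      by (rule set_integral_support) (use Line z0' in \<open>auto simp: cell_def\<close>)
    ultimately show ?thesis using FTC[of "-b" b] z0[of b] z0[of "-b"] by (simp add: b_def)
  next
    case Torus
    have "z (x + 2 * pi) = z x" "\<phi> (x + 2 * pi) = \<phi> x" for x
      using assms(1) \<phi> Torus by (auto simp: admissible_def test_function_def function_on_def)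
    from this[of "-pi"] show ?thesis using FTC[of "-pi" pi] Torus by (simp add: cell_def)
  qed
qed

lemma C2_in_H2:
  assumes "admissible \<Omega> z" "admissible \<Omega> z'" "admissible \<Omega> z''"
    and "\<And>x. (z has_real_derivative z' x) (at x)" "\<And>x. (z' has_real_derivative z'' x) (at x)"
  shows "z \<in> H2 \<Omega>"
    and "H2_norm \<Omega> z = sqrt ((LINT x:cell \<Omega>|lborel. (z x)\<^sup>2) + (LINT x:cell \<Omega>|lborel. (z' x)\<^sup>2) + (LINT x:cell \<Omega>|lborel. (z'' x)\<^sup>2))"
proof -
  note L = admissible_L2[OF assms(1)] admissible_L2[OF assms(2)] admissible_L2[OF assms(3)]
  note w = classical_derivative_is_weak[OF assms(1,2,4)] classical_derivative_is_weak[OF assms(2,3,5)]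
  show H: "z \<in> H2 \<Omega>" using L w assms(1) by (auto simp: H2_def admissible_def)
  let ?v = "weak_derivative \<Omega> z"
  let ?w = "weak_derivative \<Omega> ?v"
  note D = H2_weak_derivatives[OF H]
  have 1: "AE x in lborel. ?v x = z' x" by (rule weak_derivative_unique[OF D(2) w(1) L(1) D(1) L(2)])
  have "has_weak_derivative \<Omega> z' ?w" by (rule weak_derivative_transfer[OF D(2) w(1) D(4)])
  then have 2: "AE x in lborel. ?w x = z'' x" by (rule weak_derivative_unique[OF _ w(2) L(2) D(3) L(3)])
  have cong: "(LINT x:cell \<Omega>|lborel. (f x)\<^sup>2) = (LINT x:cell \<Omega>|lborel. (g x)\<^sup>2)"
    if "AE x in lborel. f x = g x" "f \<in> L2 \<Omega>" "g \<in> L2 \<Omega>" for f g :: "real \<Rightarrow> real"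
  proof (rule set_lebesgue_integral_cong_AE)
    show "cell \<Omega> \<in> sets lborel" by (cases \<Omega>) (auto simp: cell_def)
    show "AE x\<in>cell \<Omega> in lborel. (f x)\<^sup>2 = (g x)\<^sup>2" using that(1) by eventually_elim auto
  qed (use L2_D(1)[OF that(2)] L2_D(1)[OF that(3)] in auto)
  show "H2_norm \<Omega> z = sqrt ((LINT x:cell \<Omega>|lborel. (z x)\<^sup>2) + (LINT x:cell \<Omega>|lborel. (z' x)\<^sup>2) + (LINT x:cell \<Omega>|lborel. (z'' x)\<^sup>2))"
    unfolding H2_norm_def using cong[OF 1 D(1) L(2)] cong[OF 2 D(3) L(3)] by simp
qed

lemma L2_test_integrable:
  assumes "z \<in> L2 \<Omega>" "test_function \<Omega> \<phi>"
  shows "set_integrable lborel (cell \<Omega>) (\<lambda>x. z x * \<phi> x)"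
proof -
  have sm: "smooth \<phi>" using assms(2) by (simp add: test_function_def)
  have I: "set_integrable lborel {a..b} (\<lambda>x. z x * \<phi> x)" for a b
    using smooth_continuous[OF sm]
    by (intro L2_mult_continuous_integrable[OF assms(1)]) (auto intro: borel_measurable_continuous_onI)
  show ?thesis
  proof (cases \<Omega>)
    case Line
    then obtain b where b: "\<And>x. \<phi> x \<noteq> 0 \<Longrightarrow> \<bar>x\<bar> \<le> b"
      using assms(2) by (auto simp: test_function_def bounded_iff)
    have "indicat_real {-b..b} x *\<^sub>R (z x * \<phi> x) = z x * \<phi> x" for x
      using b[of x] by (cases "\<phi> x = 0") (auto simp: indicator_def abs_le_iff)
    then have "(\<lambda>x. indicat_real {-b..b} x *\<^sub>R (z x * \<phi> x)) = (\<lambda>x. z x * \<phi> x)" by blast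
    then show ?thesis using I[of "-b" b] Line by (simp only: set_integrable_def) (simp add: cell_def)
  qed (use I in \<open>simp add: cell_def\<close>)
qed

lemma weak_derivative_diff:
  assumes "has_weak_derivative \<Omega> f f'" "has_weak_derivative \<Omega> g g'" "f \<in> L2 \<Omega>" "f' \<in> L2 \<Omega>" "g \<in> L2 \<Omega>" "g' \<in> L2 \<Omega>"
  shows "has_weak_derivative \<Omega> (\<lambda>x. f x - g x) (\<lambda>x. f' x - g' x)"
  unfolding has_weak_derivative_def
proof (intro allI impI)
  fix \<phi> assume \<phi>: "test_function \<Omega> \<phi>"
  note d = test_function_deriv[OF \<phi>]
  have "(LINT x:cell \<Omega>|lborel. f x * deriv \<phi> x) = - (LINT x:cell \<Omega>|lborel. f' x * \<phi> x)"
    "(LINT x:cell \<Omega>|lborel. g x * deriv \<phi> x) = - (LINT x:cell \<Omega>|lborel. g' x * \<phi> x)"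
    using assms(1,2) \<phi> by (auto simp: has_weak_derivative_def)
  then show "(LINT x:cell \<Omega>|lborel. (f x - g x) * deriv \<phi> x) = - (LINT x:cell \<Omega>|lborel. (f' x - g' x) * \<phi> x)"
    using L2_test_integrable[OF assms(3) d] L2_test_integrable[OF assms(5) d]
      L2_test_integrable[OF assms(4) \<phi>] L2_test_integrable[OF assms(6) \<phi>]
    by (simp add: left_diff_distrib)
qed

lemma H2_diff:
  assumes "f \<in> H2 \<Omega>" "g \<in> H2 \<Omega>" shows "(\<lambda>x. f x - g x) \<in> H2 \<Omega>"
proof -
  obtain f' f'' where f: "f \<in> L2 \<Omega>" "continuous_on UNIV f" "f' \<in> L2 \<Omega>" "f'' \<in> L2 \<Omega>"
    "has_weak_derivative \<Omega> f f'" "has_weak_derivative \<Omega> f' f''" using assms(1) by (auto simp: H2_def)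
  obtain g' g'' where g: "g \<in> L2 \<Omega>" "continuous_on UNIV g" "g' \<in> L2 \<Omega>" "g'' \<in> L2 \<Omega>"
    "has_weak_derivative \<Omega> g g'" "has_weak_derivative \<Omega> g' g''" using assms(2) by (auto simp: H2_def)
  show ?thesis
    unfolding H2_def
    using L2_diff[OF f(1) g(1)] L2_diff[OF f(3) g(3)] L2_diff[OF f(4) g(4)]
      weak_derivative_diff[OF f(5) g(5)] weak_derivative_diff[OF f(6) g(6)] f g
    by (auto intro!: continuous_intros)
qed

section \<open>The operator of order zero\<close>

text \<open>
  The powers of a kernel \<open>T\<close> with a strict peak at \<open>a\<close> concentrate there: the contribution of a neighbourhood
  of \<open>a\<close> is at least a multiple of \<open>r ^ n\<close>, the rest at most a multiple of \<open>q ^ n\<close> with \<open>q < r\<close>. So if \<open>k\<close>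
  is orthogonal to all these powers, it vanishes at \<open>a\<close>.
\<close>

lemma concentration:
  fixes k T :: "real \<Rightarrow> real"
  assumes kT: "set_integrable lborel S (\<lambda>x. k x * T x)" and m: "k \<in> borel_measurable borel" "T \<in> borel_measurable borel" "S \<in> sets borel"
    and S: "d\<^sub>0 > 0" "{a - d\<^sub>0..a + d\<^sub>0} \<subseteq> S"
    and cont: "isCont k a"
    and T: "\<And>x. x \<in> S \<Longrightarrow> 0 \<le> T x" "\<And>x. x \<in> S \<Longrightarrow> T x \<le> 1"
    and conc: "\<And>d. 0 < d \<Longrightarrow> d \<le> d\<^sub>0 \<Longrightarrow> \<exists>d'>0. \<exists>q r. d' < d \<and> 0 \<le> q \<and> q < r \<and>
        (\<forall>x\<in>S. \<bar>x - a\<bar> \<ge> d \<longrightarrow> T x \<le> q) \<and> (\<forall>x. \<bar>x - a\<bar> \<le> d' \<longrightarrow> r \<le> T x)"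
    and zero: "\<And>n. (LINT x:S|lborel. k x * T x ^ Suc n) = 0"
  shows "k a = 0"
proof (rule ccontr)
  assume "k a \<noteq> 0"
  define k' where "k' x = sgn (k a) * k x" for x
  have ka: "k' a > 0" using \<open>k a \<noteq> 0\<close> by (simp add: k'_def sgn_if)
  have cont': "isCont k' a" unfolding k'_def[abs_def] by (intro continuous_intros cont)
  have k'_meas: "k' \<in> borel_measurable borel" unfolding k'_def[abs_def] using m(1) by simp
  have k'T: "set_integrable lborel S (\<lambda>x. k' x * T x)"
    using kT by (simp add: k'_def mult.assoc)
  have zero': "(LINT x:S|lborel. k' x * T x ^ Suc n) = 0" for n
    using zero[of n] by (simp add: k'_def mult.assoc)
  define c where "c = k' a / 2"
  have c: "c > 0" "c < k' a" using ka by (auto simp: c_def)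
  have "\<forall>\<^sub>F x in at a. c < k' x"
    using cont' c unfolding isCont_def by (intro order_tendstoD(1))
  then obtain d1 where d1: "d1 > 0" "\<And>x. x \<noteq> a \<Longrightarrow> \<bar>x - a\<bar> < d1 \<Longrightarrow> c < k' x"
    by (auto simp: eventually_at dist_real_def)
  define d where "d = min d1 d\<^sub>0"
  have d: "0 < d" "d \<le> d\<^sub>0" "d \<le> d1" using d1 S by (auto simp: d_def)
  have kc: "c < k' x" if "\<bar>x - a\<bar> < d" for x
    using d1(2)[of x] that d c by (cases "x = a") auto
  obtain d' q r where *: "0 < d'" "d' < d" "0 \<le> q" "q < r"
    "\<And>x. x \<in> S \<Longrightarrow> \<bar>x - a\<bar> \<ge> d \<Longrightarrow> T x \<le> q" "\<And>x. \<bar>x - a\<bar> \<le> d' \<Longrightarrow> r \<le> T x"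
    using conc[OF d(1,2)] by auto
  define J where "J = (LINT x:S|lborel. \<bar>k' x * T x\<bar>)"
  have Jint: "set_integrable lborel S (\<lambda>x. \<bar>k' x * T x\<bar>)" by (rule set_integrable_abs[OF k'T])
  have sub: "{a - d'..a + d'} \<subseteq> S" using S *(2) d(2) by force
  have ineq: "2 * d' * c * r ^ Suc n \<le> q ^ n * J" for n
  proof -
    have I1: "set_integrable lborel S (\<lambda>x. c * r ^ Suc n * indicat_real {a - d'..a + d'} x)"
    proof (rule set_integrable_mult_right)
      have eq: "indicat_real S x *\<^sub>R indicat_real {a - d'..a + d'} x = indicat_real {a - d'..a + d'} x" for x
        using sub by (auto simp: indicator_def)
      show "set_integrable lborel S (indicat_real {a - d'..a + d'})"
        unfolding set_integrable_def eq using set_integrable_const_Icc[of "a - d'" "a + d'" 1] by (simp add: set_integrable_def)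
    qed
    have I2: "set_integrable lborel S (\<lambda>x. q ^ n * \<bar>k' x * T x\<bar>)" using Jint by simp
    have I3: "set_integrable lborel S (\<lambda>x. k' x * T x ^ Suc n)"
    proof (rule set_integrable_bound[OF k'T])
      show "set_borel_measurable lborel S (\<lambda>x. k' x * T x ^ Suc n)"
        using m k'_meas by (simp add: set_borel_measurable_def)
      have "\<bar>T x\<bar> ^ n \<le> 1" if "x \<in> S" for x using T[OF that] by (intro power_le_one) auto
      then show "AE x in lborel. x \<in> S \<longrightarrow> norm (k' x * T x ^ Suc n) \<le> norm (k' x * T x)"
        by (intro AE_I2) (auto simp: abs_mult power_abs mult_left_le[of "\<bar>T _\<bar> ^ n"] mult.assoc[symmetric])
    qed
    have "c * r ^ Suc n * indicat_real {a - d'..a + d'} x - q ^ n * \<bar>k' x * T x\<bar> \<le> k' x * T x ^ Suc n" if x: "x \<in> S" for x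
    proof -
      have q0: "0 \<le> q ^ n * \<bar>k' x * T x\<bar>" using *(3) by simp
      consider "\<bar>x - a\<bar> \<le> d'" | "d' < \<bar>x - a\<bar>" "\<bar>x - a\<bar> < d" | "d' < \<bar>x - a\<bar>" "\<bar>x - a\<bar> \<ge> d" by linarith
      then show ?thesis
      proof cases
        case 1
        then have "\<bar>x - a\<bar> < d" using *(2) by simp
        then have "c * r ^ Suc n \<le> k' x * T x ^ Suc n"
          using kc[of x] c *(3,4) *(6)[OF 1] by (intro mult_mono power_mono) auto
        moreover have "x \<in> {a - d'..a + d'}" using 1 by (auto simp: abs_le_iff)
        ultimately show ?thesis using q0 by simp
      next
        case 2
        then have "x \<notin> {a - d'..a + d'}" by auto
        moreover have "0 \<le> k' x * T x ^ Suc n" using kc[OF 2(2)] c T(1)[OF x] by simp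
        ultimately show ?thesis using q0 by simp
      next
        case 3
        then have "x \<notin> {a - d'..a + d'}" by auto
        moreover have "\<bar>k' x * T x ^ Suc n\<bar> \<le> q ^ n * \<bar>k' x * T x\<bar>"
        proof -
          have "T x ^ n \<le> q ^ n" using T(1)[OF x] *(5)[OF x 3(2)] by (rule_tac power_mono) auto
          then have "T x ^ n * (\<bar>k' x\<bar> * T x) \<le> q ^ n * (\<bar>k' x\<bar> * T x)"
            using T(1)[OF x] by (intro mult_right_mono) auto
          then show ?thesis using T(1)[OF x] by (simp add: abs_mult power_abs mult_ac)
        qed
        ultimately show ?thesis by simp
      qed
    qed
    then have "(LINT x:S|lborel. c * r ^ Suc n * indicat_real {a - d'..a + d'} x - q ^ n * \<bar>k' x * T x\<bar>) \<le> (LINT x:S|lborel. k' x * T x ^ Suc n)"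
      by (intro set_integral_mono set_integral_diff(1) I1 I2 I3)
    also have "\<dots> = 0" by (rule zero')
    also have "(LINT x:S|lborel. c * r ^ Suc n * indicat_real {a - d'..a + d'} x - q ^ n * \<bar>k' x * T x\<bar>)
      = c * r ^ Suc n * (LINT x:S|lborel. indicat_real {a - d'..a + d'} x) - q ^ n * J"
      using set_integral_diff(2)[OF I1 I2] by (simp add: J_def)
    also have "(LINT x:S|lborel. indicat_real {a - d'..a + d'} x) = 2 * d'"
    proof -
      have "(LINT x:S|lborel. indicat_real {a - d'..a + d'} x) = (LINT x|lborel. indicat_real {a - d'..a + d'} x)"
        unfolding set_lebesgue_integral_def using sub
        by (intro Bochner_Integration.integral_cong) (auto simp: indicator_def)
      then show ?thesis using *(1) by simp
    qed
    finally show ?thesis by (simp add: mult_ac)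
  qed
  have r: "r > 0" using *(3,4) by simp
  have "2 * d' * c * r \<le> (q / r) ^ n * J" for n
    using ineq[of n] r by (simp add: field_simps power_divide)
  moreover have "(\<lambda>n. (q / r) ^ n * J) \<longlonglongrightarrow> 0 * J"
    using *(3,4) r by (intro tendsto_mult_right LIMSEQ_realpow_zero) auto
  ultimately have "2 * d' * c * r \<le> 0" by (intro LIMSEQ_le_const[of _ 0]) auto
  then show False using *(1) c r by (simp add: mult_le_0_iff)
qed

text \<open>
  The kernel is \<open>(1 + cos (x - a)) / 2\<close>, whose powers are trigonometric polynomials.
\<close>

lemma fourier_coeff_determines:
  fixes k :: "real \<Rightarrow> real"
  assumes cont: "continuous_on UNIV k" and per: "\<And>x. k (x + 2 * pi) = k x"
    and zero: "\<And>j. (LINT x:{-pi..pi}|lborel. complex_of_real (k x) * cis (- (x * of_int j))) = 0"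
  shows "k a = 0"
proof -
  let ?S = "{a - pi..a + pi}"
  define T where "T x = (1 + cos (x - a)) / 2" for x
  have cT: "continuous_on UNIV T" unfolding T_def[abs_def] by (auto intro!: continuous_intros)
  have int: "set_integrable lborel {p..q} f" if "continuous_on UNIV f" for f :: "real \<Rightarrow> 'b::{banach, second_countable_topology}" and p q
    by (rule borel_integrable_atLeastAtMost'[OF continuous_on_subset[OF that]]) simp
  have ccis: "continuous_on UNIV (\<lambda>x. complex_of_real (k x) * of_real (T x) ^ n * cis (x * of_int j))" for n :: nat and j
    by (intro continuous_intros cont cT)
  have main: "(LINT x:?S|lborel. complex_of_real (k x) * of_real (T x) ^ n * cis (x * of_int j)) = 0" for n :: nat and j
  proof (induction n arbitrary: j)
    case 0
    have "(LINT x:?S|lborel. complex_of_real (k x) * cis (x * of_int j)) = (LINT x:{-pi..pi}|lborel. complex_of_real (k x) * cis (x * of_int j))"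
    proof (rule periodic_integral_shift)
      fix x
      have "cis ((x + 2 * pi) * of_int j) = cis (x * of_int j) * cis (2 * pi * of_int j)"
        by (simp add: cis_mult algebra_simps)
      also have "cis (2 * pi * of_int j) = 1" by (rule cis_multiple_2pi) simp
      finally show "complex_of_real (k (x + 2 * pi)) * cis ((x + 2 * pi) * of_int j) = complex_of_real (k x) * cis (x * of_int j)"
        using per by simp
    qed (intro int continuous_intros cont)
    also have "\<dots> = 0" using zero[of "-j"] by simp
    finally show ?case by simp
  next
    case (Suc n)
    have T: "complex_of_real (T x) = 1 / 2 + (cis (- a) * cis x + cis a * cis (- x)) / 4" for x
      by (auto simp: T_def complex_eq_iff cis_mult cos_diff sin_diff cos_add sin_add algebra_simps)
    have eq: "complex_of_real (k x) * of_real (T x) ^ Suc n * cis (x * of_int j)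
      = (1 / 2) * (complex_of_real (k x) * of_real (T x) ^ n * cis (x * of_int j))
      + ((cis (- a) / 4) * (complex_of_real (k x) * of_real (T x) ^ n * cis (x * of_int (j + 1)))
      + (cis a / 4) * (complex_of_real (k x) * of_real (T x) ^ n * cis (x * of_int (j - 1))))" for x
    proof -
      have c: "cis (x * of_int (j + 1)) = cis (x * of_int j) * cis x" "cis (x * of_int (j - 1)) = cis (x * of_int j) * cis (- x)"
        by (simp_all add: cis_mult algebra_simps)
      have "complex_of_real (k x) * of_real (T x) ^ Suc n * cis (x * of_int j)
        = complex_of_real (T x) * (complex_of_real (k x) * of_real (T x) ^ n * cis (x * of_int j))"
        by (simp add: mult_ac)
      also have "\<dots> = (1 / 2 + (cis (- a) * cis x + cis a * cis (- x)) / 4) * (complex_of_real (k x) * of_real (T x) ^ n * cis (x * of_int j))"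
        by (subst T) (rule refl)
      finally show ?thesis unfolding c by (simp add: algebra_simps)
    qed
    show ?case
      unfolding eq
      using Suc[of j] Suc[of "j + 1"] Suc[of "j - 1"] by (subst set_integral_add(2); (subst set_integral_add(2))?)
        (auto intro!: int continuous_intros cont cT set_integral_add(1))
  qed
  show ?thesis
  proof (rule concentration[where k = k and a = a and S = ?S and T = T and d\<^sub>0 = "pi / 2"])
    show "set_integrable lborel ?S (\<lambda>x. k x * T x)" by (intro int continuous_intros cont cT)
    show "isCont k a" using cont by (simp add: continuous_on_eq_continuous_at)
    show "0 \<le> T x" for x unfolding T_def using cos_ge_minus_one[of "x - a"] by (intro divide_nonneg_pos) linarith+
    show "T x \<le> 1" for x unfolding T_def using cos_le_one[of "x - a"] by simp
    show "(LINT x:?S|lborel. k x * T x ^ Suc n) = 0" for n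
    proof -
      have "complex_of_real (LINT x:?S|lborel. k x * T x ^ Suc n) = (LINT x:?S|lborel. complex_of_real (k x * T x ^ Suc n))"
        by (rule set_integral_complex_of_real[symmetric])
      also have "\<dots> = 0" using main[of "Suc n" 0] by simp
      finally show ?thesis by simp
    qed
    fix d :: real assume d: "0 < d" "d \<le> pi / 2"
    have T_abs: "T x = (1 + cos \<bar>x - a\<bar>) / 2" for x by (simp add: T_def)
    show "\<exists>d'>0. \<exists>q r. d' < d \<and> 0 \<le> q \<and> q < r \<and>
        (\<forall>x\<in>?S. \<bar>x - a\<bar> \<ge> d \<longrightarrow> T x \<le> q) \<and> (\<forall>x. \<bar>x - a\<bar> \<le> d' \<longrightarrow> r \<le> T x)"
    proof (rule exI[of _ "d / 2"], rule conjI[rotated], rule exI[of _ "(1 + cos d) / 2"], rule exI[of _ "(1 + cos (d / 2)) / 2"], intro conjI ballI allI impI)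
      show "0 \<le> (1 + cos d) / 2" using cos_ge_minus_one[of d] by (intro divide_nonneg_pos) linarith+
      show "(1 + cos d) / 2 < (1 + cos (d / 2)) / 2"
        using cos_monotone_0_pi[of "d / 2" d] d by simp
      show "T x \<le> (1 + cos d) / 2" if "x \<in> ?S" "d \<le> \<bar>x - a\<bar>" for x
        using cos_monotone_0_pi_le[of d "\<bar>x - a\<bar>"] that d unfolding T_abs by (auto simp: abs_if)
      show "(1 + cos (d / 2)) / 2 \<le> T x" if "\<bar>x - a\<bar> \<le> d / 2" for x
        using cos_monotone_0_pi_le[of "\<bar>x - a\<bar>" "d / 2"] that d unfolding T_abs by auto
    qed (use d in auto)
  qed (use cont cT in \<open>auto intro!: borel_measurable_continuous_onI\<close>)
qed

lemma power_times_gaussian_bounded: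
  assumes "\<beta> > 0" shows "\<exists>C. \<forall>x::real. \<bar>x\<bar> ^ m * exp (- \<beta> * x\<^sup>2) \<le> C"
proof (intro exI allI)
  fix x :: real
  show "\<bar>x\<bar> ^ m * exp (- \<beta> * x\<^sup>2) \<le> 1 + real m ^ m / \<beta> ^ m"
  proof (cases "x = 0")
    case False
    define y where "y = \<beta> * x\<^sup>2"
    have y: "y > 0" using False assms by (simp add: y_def)
    have "exp (- y) * y ^ m \<le> real m ^ m"
      using exp_inverse_div_power_le[of "1 / y" m] y by (simp add: field_simps power_divide)
    then have 1: "x\<^sup>2 ^ m * exp (- y) \<le> real m ^ m / \<beta> ^ m"
      using assms by (simp add: y_def power_mult_distrib field_simps)
    have "\<bar>x\<bar> ^ m \<le> 1 + x\<^sup>2 ^ m"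
    proof (cases "\<bar>x\<bar> \<le> 1")
      case True
      then show ?thesis using power_le_one[of "\<bar>x\<bar>" m] by (simp add: add_increasing2)
    next
      case False
      then have "\<bar>x\<bar> ^ m \<le> \<bar>x\<bar> ^ (2 * m)" by (intro power_increasing) auto
      then show ?thesis by (simp add: power_mult)
    qed
    then have "\<bar>x\<bar> ^ m * exp (- y) \<le> (1 + x\<^sup>2 ^ m) * exp (- y)" by (intro mult_right_mono) auto
    also have "\<dots> = exp (- y) + x\<^sup>2 ^ m * exp (- y)" by (simp add: algebra_simps)
    also have "\<dots> \<le> 1 + real m ^ m / \<beta> ^ m" using 1 y by (intro add_mono) auto
    finally show ?thesis by (simp add: y_def)
  qed (use assms in \<open>cases m; simp\<close>)
qed

text \<open>
  The functions \<open>p \<xi> exp (- \<beta> \<xi>\<^sup>2 + \<i> a \<xi>)\<close> with a polynomial \<open>p\<close> are closed under differentiation and decay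
  faster than any power.
\<close>

lemma schwartz_gaussian:
  assumes "\<beta> > 0"
  shows "schwartz (\<lambda>\<xi>. complex_of_real (exp (- \<beta> * \<xi>\<^sup>2)) * cis (a * \<xi>))"
proof -
  define h where "h w = exp (- complex_of_real \<beta> * w\<^sup>2 + \<i> * complex_of_real a * w)" for w
  define q :: "nat \<Rightarrow> complex poly" where
    "q n = ((\<lambda>p. pderiv p + [:\<i> * complex_of_real a, - 2 * complex_of_real \<beta>:] * p) ^^ n) 1" for n
  define D where "D n \<xi> = poly (q n) (complex_of_real \<xi>) * h (complex_of_real \<xi>)" for n and \<xi> :: real
  have hreal: "h (complex_of_real \<xi>) = complex_of_real (exp (- \<beta> * \<xi>\<^sup>2)) * cis (a * \<xi>)" for \<xi>
    unfolding h_def exp_add by (simp add: exp_of_real[symmetric] cis_conv_exp mult_ac)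
  have "((\<lambda>w. poly (q n) w * h w) has_field_derivative poly (q (Suc n)) w * h w) (at w)" for n w
    unfolding h_def
    by (auto intro!: derivative_eq_intros poly_DERIV simp: q_def algebra_simps power2_eq_square)
  then have D': "(D n has_vector_derivative D (Suc n) \<xi>) (at \<xi>)" for n \<xi>
    unfolding D_def[abs_def] by (rule has_vector_derivative_real_field)
  have norm_h: "norm (h (complex_of_real \<xi>)) = exp (- \<beta> * \<xi>\<^sup>2)" for \<xi>
    unfolding hreal by (simp add: norm_mult)
  have bd: "\<exists>C. \<forall>\<xi>::real. \<bar>\<xi>\<bar> ^ m * norm (poly p (complex_of_real \<xi>)) * exp (- \<beta> * \<xi>\<^sup>2) \<le> C" for m and p :: "complex poly"
  proof (induction p arbitrary: m)
    case 0
    then show ?case by auto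
  next
    case (pCons c p)
    obtain C1 where C1: "\<And>\<xi>. \<bar>\<xi>\<bar> ^ m * exp (- \<beta> * \<xi>\<^sup>2) \<le> C1" using power_times_gaussian_bounded[OF assms] by blast
    obtain C2 where C2: "\<And>\<xi>. \<bar>\<xi>\<bar> ^ Suc m * norm (poly p (complex_of_real \<xi>)) * exp (- \<beta> * \<xi>\<^sup>2) \<le> C2"
      using pCons.IH[of "Suc m"] by blast
    have "\<bar>\<xi>\<bar> ^ m * norm (poly (pCons c p) (complex_of_real \<xi>)) * exp (- \<beta> * \<xi>\<^sup>2) \<le> norm c * C1 + C2" for \<xi>
    proof -
      have "norm (poly (pCons c p) (complex_of_real \<xi>)) \<le> norm c + \<bar>\<xi>\<bar> * norm (poly p (complex_of_real \<xi>))"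
        using norm_triangle_ineq[of c "complex_of_real \<xi> * poly p (complex_of_real \<xi>)"] by (simp add: norm_mult)
      then have "\<bar>\<xi>\<bar> ^ m * norm (poly (pCons c p) (complex_of_real \<xi>)) * exp (- \<beta> * \<xi>\<^sup>2)
          \<le> \<bar>\<xi>\<bar> ^ m * (norm c + \<bar>\<xi>\<bar> * norm (poly p (complex_of_real \<xi>))) * exp (- \<beta> * \<xi>\<^sup>2)"
        by (intro mult_right_mono mult_left_mono) auto
      also have "\<dots> = norm c * (\<bar>\<xi>\<bar> ^ m * exp (- \<beta> * \<xi>\<^sup>2)) + \<bar>\<xi>\<bar> ^ Suc m * norm (poly p (complex_of_real \<xi>)) * exp (- \<beta> * \<xi>\<^sup>2)"
        by (simp add: algebra_simps)
      also have "\<dots> \<le> norm c * C1 + C2" by (intro add_mono mult_left_mono C1 C2) auto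
      finally show ?thesis .
    qed
    then show ?case by blast
  qed
  have "bounded (range (\<lambda>\<xi>. (\<xi> ^ m) *\<^sub>R D n \<xi>))" for n m
  proof -
    obtain C where "\<And>\<xi>. \<bar>\<xi>\<bar> ^ m * norm (poly (q n) (complex_of_real \<xi>)) * exp (- \<beta> * \<xi>\<^sup>2) \<le> C" using bd by blast
    then show ?thesis
      unfolding bounded_iff by (intro exI[of _ C]) (auto simp: D_def norm_mult norm_h power_abs mult.assoc)
  qed
  moreover have "D 0 = (\<lambda>\<xi>. complex_of_real (exp (- \<beta> * \<xi>\<^sup>2)) * cis (a * \<xi>))"
    by (auto simp: D_def q_def hreal)
  ultimately show ?thesis using D' unfolding schwartz_def by blast
qed

text \<open>
  After the substitution \<open>\<xi> = sqrt (2 n) y\<close> this is the characteristic function of the normal distribution.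
\<close>

lemma fourier_integral_gaussian:
  assumes "n > 0"
  shows "fourier_integral (\<lambda>\<xi>. complex_of_real (exp (- (1 / (4 * n)) * \<xi>\<^sup>2)) * cis (a * \<xi>)) x
    = complex_of_real (sqrt (4 * pi * n) * exp (- n * (x - a)\<^sup>2))"
proof -
  define s where "s = sqrt (2 * n)"
  have s: "s > 0" "s\<^sup>2 = 2 * n" using assms by (auto simp: s_def)
  have char: "(CLINT y|lborel. complex_of_real (std_normal_density y) * iexp (t * y)) = complex_of_real (exp (- t\<^sup>2 / 2))" for t
    using fun_cong[OF char_std_normal_distribution, of t]
    by (simp add: char_def integral_density scaleR_conv_of_real)
  have "fourier_integral (\<lambda>\<xi>. complex_of_real (exp (- (1 / (4 * n)) * \<xi>\<^sup>2)) * cis (a * \<xi>)) x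
    = (CLINT \<xi>|lborel. complex_of_real (exp (- (1 / (4 * n)) * \<xi>\<^sup>2)) * cis (- (x - a) * \<xi>))"
    unfolding fourier_integral_def
    by (intro Bochner_Integration.integral_cong) (auto simp: cis_mult algebra_simps)
  also have "\<dots> = s *\<^sub>R (CLINT y|lborel. complex_of_real (exp (- (1 / (4 * n)) * (s * y)\<^sup>2)) * cis (- (x - a) * (s * y)))"
    using s(1) by (subst lborel_integral_real_affine[where c = s and t = 0]) auto
  also have "(CLINT y|lborel. complex_of_real (exp (- (1 / (4 * n)) * (s * y)\<^sup>2)) * cis (- (x - a) * (s * y)))
    = (CLINT y|lborel. complex_of_real (sqrt (2 * pi)) * (complex_of_real (std_normal_density y) * iexp ((- (x - a) * s) * y)))"
  proof (intro Bochner_Integration.integral_cong refl)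
    fix y
    have "exp (- (1 / (4 * n)) * (s * y)\<^sup>2) = sqrt (2 * pi) * std_normal_density y"
      using assms by (simp add: std_normal_density_def power_mult_distrib s(2))
    moreover have "cis (- (x - a) * (s * y)) = iexp ((- (x - a) * s) * y)"
      by (simp add: cis_conv_exp mult_ac)
    ultimately show "complex_of_real (exp (- (1 / (4 * n)) * (s * y)\<^sup>2)) * cis (- (x - a) * (s * y))
      = complex_of_real (sqrt (2 * pi)) * (complex_of_real (std_normal_density y) * iexp ((- (x - a) * s) * y))"
      by simp
  qed
  also have "\<dots> = complex_of_real (sqrt (2 * pi)) * complex_of_real (exp (- (- (x - a) * s)\<^sup>2 / 2))"
    by (simp only: integral_mult_right_zero char)
  also have "- (- (x - a) * s)\<^sup>2 / 2 = - n * (x - a)\<^sup>2"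
    by (simp add: power_mult_distrib s(2) power2_commute)
  also have "s *\<^sub>R (complex_of_real (sqrt (2 * pi)) * complex_of_real (exp (- n * (x - a)\<^sup>2)))
    = complex_of_real (sqrt (4 * pi * n) * exp (- n * (x - a)\<^sup>2))"
    by (simp add: scaleR_conv_of_real s_def real_sqrt_mult[symmetric] mult_ac flip: of_real_mult)
  finally show ?thesis .
qed

lemma L2_times_gaussian_integrable:
  assumes "k \<in> L2 Line" "n > 0"
  shows "integrable lborel (\<lambda>x. k x * exp (- n * (x - a)\<^sup>2))"
proof -
  have k2: "integrable lborel (\<lambda>x. (k x)\<^sup>2)"
    using L2_D(2)[OF assms(1)] by (simp add: cell_def set_integrable_def)
  define \<sigma> where "\<sigma> = 1 / (2 * sqrt n)"
  have \<sigma>: "\<sigma> > 0" "2 * \<sigma>\<^sup>2 = 1 / (2 * n)" using assms(2) by (auto simp: \<sigma>_def power_divide power_mult_distrib)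
  have "integrable lborel (\<lambda>x. sqrt (2 * pi * \<sigma>\<^sup>2) * normal_density a \<sigma> x)"
    using \<sigma>(1) by simp
  moreover have "sqrt (2 * pi * \<sigma>\<^sup>2) * normal_density a \<sigma> x = (exp (- n * (x - a)\<^sup>2))\<^sup>2" for x
    using \<sigma> assms(2) by (simp add: normal_density_def exp_double[symmetric])
  ultimately have g2: "integrable lborel (\<lambda>x. (exp (- n * (x - a)\<^sup>2))\<^sup>2)" by simp
  show ?thesis
  proof (rule Bochner_Integration.integrable_bound[OF Bochner_Integration.integrable_add[OF k2 g2]])
    show "(\<lambda>x. k x * exp (- n * (x - a)\<^sup>2)) \<in> borel_measurable lborel"
      using L2_D(1)[OF assms(1)] by simp
    show "AE x in lborel. norm (k x * exp (- n * (x - a)\<^sup>2)) \<le> norm ((k x)\<^sup>2 + (exp (- n * (x - a)\<^sup>2))\<^sup>2)"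
    proof (rule AE_I2)
      fix x
      have *: "\<bar>p * e\<bar> \<le> p\<^sup>2 + e\<^sup>2" for p e :: real
      proof -
        have "2 * (\<bar>p\<bar> * \<bar>e\<bar>) \<le> p\<^sup>2 + e\<^sup>2" using sum_squares_bound[of "\<bar>p\<bar>" "\<bar>e\<bar>"] by (simp add: mult.assoc)
        moreover have "0 \<le> \<bar>p\<bar> * \<bar>e\<bar>" by simp
        ultimately show ?thesis unfolding abs_mult by linarith
      qed
      show "norm (k x * exp (- n * (x - a)\<^sup>2)) \<le> norm ((k x)\<^sup>2 + (exp (- n * (x - a)\<^sup>2))\<^sup>2)"
        using *[of "k x" "exp (- n * (x - a)\<^sup>2)"] by simp
    qed
  qed
qed

lemma gaussian_averages_determine:
  assumes k: "k \<in> L2 Line" "continuous_on UNIV k"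
    and zero: "\<And>n. n > 0 \<Longrightarrow> (LINT x|lborel. k x * exp (- n * (x - a)\<^sup>2)) = 0"
  shows "k a = 0"
proof (rule concentration[where k = k and a = a and S = UNIV and T = "\<lambda>x. exp (- 1 * (x - a)\<^sup>2)" and d\<^sub>0 = 1])
  show "set_integrable lborel UNIV (\<lambda>x. k x * exp (- 1 * (x - a)\<^sup>2))"
    using L2_times_gaussian_integrable[OF k(1), of 1] by (simp add: set_integrable_def)
  show "isCont k a" using k(2) by (simp add: continuous_on_eq_continuous_at)
  show "(LINT x:UNIV|lborel. k x * exp (- 1 * (x - a)\<^sup>2) ^ Suc n) = 0" for n
    using zero[of "Suc n"] by (simp add: set_lebesgue_integral_def exp_of_nat_mult[symmetric] algebra_simps del: power_Suc of_nat_Suc)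
  fix d :: real assume d: "0 < d"
  show "\<exists>d'>0. \<exists>q r. d' < d \<and> 0 \<le> q \<and> q < r \<and>
      (\<forall>x\<in>UNIV. \<bar>x - a\<bar> \<ge> d \<longrightarrow> exp (- 1 * (x - a)\<^sup>2) \<le> q) \<and> (\<forall>x. \<bar>x - a\<bar> \<le> d' \<longrightarrow> r \<le> exp (- 1 * (x - a)\<^sup>2))"
  proof (rule exI[of _ "d / 2"], rule conjI[rotated], rule exI[of _ "exp (- d\<^sup>2)"], rule exI[of _ "exp (- (d / 2)\<^sup>2)"], intro conjI ballI allI impI)
    show "exp (- d\<^sup>2) < exp (- (d / 2)\<^sup>2)" using d by (simp add: power_divide)
    show "exp (- 1 * (x - a)\<^sup>2) \<le> exp (- d\<^sup>2)" if "d \<le> \<bar>x - a\<bar>" for x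
      using power_mono[OF that, of 2] d by simp
    show "exp (- (d / 2)\<^sup>2) \<le> exp (- 1 * (x - a)\<^sup>2)" if "\<bar>x - a\<bar> \<le> d / 2" for x
      using power_mono[OF that, of 2] d by simp
  qed (use d in auto)
qed (use L2_D(1)[OF k(1)] in auto)

text \<open>
  For \<open>\<alpha> = 0\<close> the symbol is \<open>1\<close>, so \<open>u\<close> itself satisfies the defining identity. That no other continuous function
  does follows by testing with Gaussians on the line and from the Fourier coefficients on the torus.
\<close>

lemma frac_laplacian_zero:
  assumes "u \<in> L2 \<Omega>" "continuous_on UNIV u"
  shows "frac_laplacian \<Omega> 0 u = u"
  unfolding frac_laplacian_def
proof (rule the_equality)
  show "u \<in> L2 \<Omega> \<and> continuous_on UNIV u \<and> is_frac_laplacian \<Omega> 0 u u"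
    using assms by (cases \<Omega>) (auto simp: is_frac_laplacian_def frac_symbol_def)
next
  fix g assume g: "g \<in> L2 \<Omega> \<and> continuous_on UNIV g \<and> is_frac_laplacian \<Omega> 0 u g"
  define k where "k x = g x - u x" for x
  have k: "k \<in> L2 \<Omega>" "continuous_on UNIV k"
    using g assms L2_diff[of g \<Omega> u] by (auto simp: k_def[abs_def] intro!: continuous_intros)
  have "k a = 0" for a
  proof (cases \<Omega>)
    case Line
    show ?thesis
    proof (rule gaussian_averages_determine[where k = k and a = a])
      fix n :: real assume n: "n > 0"
      let ?\<phi> = "\<lambda>\<xi>. complex_of_real (exp (- (1 / (4 * n)) * \<xi>\<^sup>2)) * cis (a * \<xi>)"
      let ?G = "\<lambda>x. exp (- n * (x - a)\<^sup>2)"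
      have "schwartz ?\<phi>" using n by (intro schwartz_gaussian) simp
      then have eq: "(LINT x|lborel. complex_of_real (g x) * fourier_integral ?\<phi> x) = (LINT x|lborel. complex_of_real (u x) * fourier_integral ?\<phi> x)"
        using g Line by (simp add: is_frac_laplacian_def frac_symbol_def)
      have conv: "(LINT x|lborel. complex_of_real (f x) * fourier_integral ?\<phi> x) = complex_of_real (sqrt (4 * pi * n) * (LINT x|lborel. f x * ?G x))" for f
      proof -
        have "complex_of_real (f x) * fourier_integral ?\<phi> x = complex_of_real (sqrt (4 * pi * n) * (f x * ?G x))" for x
          unfolding fourier_integral_gaussian[OF n] by simp
        then show ?thesis by (simp only: integral_complex_of_real integral_mult_right_zero)
      qed
      have "sqrt (4 * pi * n) * (LINT x|lborel. g x * ?G x) = sqrt (4 * pi * n) * (LINT x|lborel. u x * ?G x)"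
        using eq unfolding conv by (simp only: of_real_eq_iff)
      then have "(LINT x|lborel. g x * ?G x) = (LINT x|lborel. u x * ?G x)" using n by simp
      then show "(LINT x|lborel. k x * ?G x) = 0"
        using L2_times_gaussian_integrable[of g n a] L2_times_gaussian_integrable[of u n a] g assms Line n
        by (simp add: k_def left_diff_distrib)
    qed (use k Line in auto)
  next
    case Torus
    show ?thesis
    proof (rule fourier_coeff_determines[where k = k and a = a, OF k(2)])
      show "k (x + 2 * pi) = k x" for x using L2_D(3)[OF k(1)] Torus by (simp add: function_on_def)
      fix j
      have "fourier_coeff g j = fourier_coeff u j"
        using g Torus by (simp add: is_frac_laplacian_def frac_symbol_def)
      then have "(LINT x:{-pi..pi}|lborel. complex_of_real (g x) * cis (- (x * of_int j))) = (LINT x:{-pi..pi}|lborel. complex_of_real (u x) * cis (- (x * of_int j)))"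
        by (simp add: fourier_coeff_def)
      moreover have "set_integrable lborel {-pi..pi} (\<lambda>x. complex_of_real (f x) * cis (- (x * of_int j)))" if "continuous_on UNIV f" for f
        by (intro borel_integrable_atLeastAtMost' continuous_intros continuous_on_subset[OF that]) auto
      ultimately show "(LINT x:{-pi..pi}|lborel. complex_of_real (k x) * cis (- (x * of_int j))) = 0"
        using g assms by (simp add: k_def left_diff_distrib)
    qed
  qed
  then show "g = u" by (auto simp: k_def)
qed

lemma damping_term:
  assumes "min \<nu> \<alpha> = 0" "u \<in> L2 \<Omega>" "continuous_on UNIV u"
  shows "\<nu> * frac_laplacian \<Omega> \<alpha> u x = \<nu> * u x"
  using frac_laplacian_zero[OF assms(2,3)] assms(1) by (cases "\<nu> = 0") (auto simp: min_def split: if_splits)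

section \<open>The flux and the displacement of characteristics\<close>

definition denom :: "real \<Rightarrow> real \<Rightarrow> real" where
  "denom M u = u\<^sup>2 + M * (1 - u)\<^sup>2"

text \<open>
  The speed \<open>f' (u)\<close> divided by \<open>u\<close>. Its primitive gives the displacement of damped characteristics, because
  \<open>r = exp (- \<nu> t) v\<close> turns \<open>f' (r) dt\<close> into \<open>- f' (r) / (\<nu> r) dr\<close>.
\<close>

definition speed_ratio :: "real \<Rightarrow> real \<Rightarrow> real" where
  "speed_ratio M u = 2 * M * (1 - u) / denom M u ^ 2"

definition speed_ratio' :: "real \<Rightarrow> real \<Rightarrow> real" where
  "speed_ratio' M u = (- 2 * M * denom M u - 4 * M * (1 - u) * (2 * u - 2 * M * (1 - u))) / denom M u ^ 3"

definition speed_ratio'' :: "real \<Rightarrow> real \<Rightarrow> real" where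
  "speed_ratio'' M u = (8 * M * (2 * u - 2 * M * (1 - u)) * denom M u - 8 * M * (1 - u) * (1 + M) * denom M u
     + 12 * M * (1 - u) * (2 * u - 2 * M * (1 - u))\<^sup>2) / denom M u ^ 4"

definition speed :: "real \<Rightarrow> real \<Rightarrow> real" where
  "speed M u = u * speed_ratio M u"

definition speed' :: "real \<Rightarrow> real \<Rightarrow> real" where
  "speed' M u = speed_ratio M u + u * speed_ratio' M u"

definition speed'' :: "real \<Rightarrow> real \<Rightarrow> real" where
  "speed'' M u = 2 * speed_ratio' M u + u * speed_ratio'' M u"

lemma denom_pos: "M > 0 \<Longrightarrow> denom M u > 0"
  by (cases "u = 0") (auto simp: denom_def add_pos_nonneg)

lemma denom_derivative: "(denom M has_real_derivative 2 * u - 2 * M * (1 - u)) (at u)"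
  unfolding denom_def[abs_def] by (auto intro!: derivative_eq_intros simp: algebra_simps)

lemma flux_derivative:
  assumes "M > 0" shows "(flux M has_real_derivative speed M u) (at u)"
proof -
  have "flux M = (\<lambda>u. u\<^sup>2 / denom M u)" by (auto simp: flux_def denom_def)
  moreover have "((\<lambda>u. u\<^sup>2 / denom M u) has_real_derivative
      (2 * u * denom M u - u\<^sup>2 * (2 * u - 2 * M * (1 - u))) / (denom M u * denom M u)) (at u)"
    using denom_pos[OF assms, of u] by (auto intro!: derivative_eq_intros denom_derivative)
  moreover have "2 * u * denom M u - u\<^sup>2 * (2 * u - 2 * M * (1 - u)) = u * (2 * M * (1 - u))"
    by (simp add: denom_def power2_eq_square algebra_simps)
  ultimately show ?thesis by (simp add: speed_def speed_ratio_def power2_eq_square)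
qed

lemma speed_ratio_derivative:
  assumes "M > 0" shows "(speed_ratio M has_real_derivative speed_ratio' M u) (at u)"
proof -
  define x y where "x = denom M u" and "y = 2 * u - 2 * M * (1 - u)"
  have x: "x > 0" using denom_pos[OF assms] by (simp add: x_def)
  have N: "((\<lambda>u. 2 * M * (1 - u)) has_real_derivative - 2 * M) (at u)"
    by (auto intro!: derivative_eq_intros)
  have D: "((\<lambda>u. denom M u ^ 2) has_real_derivative 2 * x * y) (at u)"
    using DERIV_power[OF denom_derivative[of M u], of 2] by (simp add: x_def y_def mult_ac)
  have "(speed_ratio M has_real_derivative (- 2 * M * x ^ 2 - 2 * M * (1 - u) * (2 * x * y)) / (x ^ 2 * x ^ 2)) (at u)"
    using DERIV_divide[OF N D] x unfolding speed_ratio_def[abs_def] by (simp add: x_def)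
  also have "(- 2 * M * x ^ 2 - 2 * M * (1 - u) * (2 * x * y)) / (x ^ 2 * x ^ 2) = (- 2 * M * x - 4 * M * (1 - u) * y) / x ^ 3"
    using x by (simp add: divide_simps) (simp add: eval_nat_numeral algebra_simps)
  finally show ?thesis by (simp add: speed_ratio'_def x_def y_def)
qed

lemma speed_ratio'_derivative:
  assumes "M > 0" shows "(speed_ratio' M has_real_derivative speed_ratio'' M u) (at u)"
proof -
  define x y n where "x = denom M u" and "y = 2 * u - 2 * M * (1 - u)"
    and "n = - 2 * M * x - 4 * M * (1 - u) * y"
  have x: "x > 0" using denom_pos[OF assms] by (simp add: x_def)
  have N: "((\<lambda>u. - 2 * M * denom M u - 4 * M * (1 - u) * (2 * u - 2 * M * (1 - u))) has_real_derivative
      2 * M * y - 8 * M * (1 - u) * (1 + M)) (at u)"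
    by (auto intro!: derivative_eq_intros denom_derivative simp: y_def algebra_simps)
  have D: "((\<lambda>u. denom M u ^ 3) has_real_derivative 3 * x ^ 2 * y) (at u)"
    using DERIV_power[OF denom_derivative[of M u], of 3] by (simp add: x_def y_def mult_ac)
  have "(speed_ratio' M has_real_derivative ((2 * M * y - 8 * M * (1 - u) * (1 + M)) * x ^ 3 - n * (3 * x ^ 2 * y)) / (x ^ 3 * x ^ 3)) (at u)"
    using DERIV_divide[OF N D] x unfolding speed_ratio'_def[abs_def] by (simp add: x_def y_def n_def)
  also have "((2 * M * y - 8 * M * (1 - u) * (1 + M)) * x ^ 3 - n * (3 * x ^ 2 * y)) / (x ^ 3 * x ^ 3)
      = (8 * M * y * x - 8 * M * (1 - u) * (1 + M) * x + 12 * M * (1 - u) * y\<^sup>2) / x ^ 4"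
    using x by (simp add: divide_simps) (simp add: n_def eval_nat_numeral algebra_simps)
  finally show ?thesis by (simp add: speed_ratio''_def x_def y_def)
qed

lemma speed_derivative:
  assumes "M > 0"
  shows "(speed M has_real_derivative speed' M u) (at u)" "(speed' M has_real_derivative speed'' M u) (at u)"
  unfolding speed_def[abs_def] speed'_def[abs_def] speed''_def
  by (auto intro!: derivative_eq_intros speed_ratio_derivative speed_ratio'_derivative assms)

lemma continuous_speed:
  assumes "M > 0"
  shows "continuous_on UNIV (speed_ratio M)" "continuous_on UNIV (speed_ratio' M)"
    "continuous_on UNIV (speed M)" "continuous_on UNIV (speed' M)" "continuous_on UNIV (speed'' M)"
proof -
  have D: "continuous_on UNIV (denom M)" unfolding denom_def[abs_def] by (intro continuous_intros)
  have D0: "denom M u \<noteq> 0" for u using denom_pos[OF assms, of u] by simp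
  show 1: "continuous_on UNIV (speed_ratio M)"
    unfolding speed_ratio_def[abs_def] by (intro continuous_intros D) (use D0 in auto)
  show 2: "continuous_on UNIV (speed_ratio' M)"
    unfolding speed_ratio'_def[abs_def] by (intro continuous_intros D) (use D0 in auto)
  have 3: "continuous_on UNIV (speed_ratio'' M)"
    unfolding speed_ratio''_def[abs_def] by (intro continuous_intros D) (use D0 in auto)
  show "continuous_on UNIV (speed M)" "continuous_on UNIV (speed' M)" "continuous_on UNIV (speed'' M)"
    unfolding speed_def[abs_def] speed'_def[abs_def] speed''_def[abs_def]
    by (intro continuous_intros 1 2 3)+
qed

text \<open>
  Strict convexity of the flux near \<open>0\<close>.
\<close>

lemma speed'_pos_near_0:
  assumes "M > 0" shows "\<exists>a>0. \<forall>u. 0 \<le> u \<longrightarrow> u \<le> a \<longrightarrow> speed' M u > 0"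
proof -
  have "speed' M 0 > 0" using assms by (simp add: speed'_def speed_ratio_def denom_def)
  moreover have "isCont (speed' M) 0" using speed_derivative(2)[OF assms] by (rule DERIV_isCont)
  ultimately have "\<forall>\<^sub>F u in at 0. speed' M u > 0" unfolding isCont_def by (intro order_tendstoD(1))
  then obtain d where d: "d > 0" "\<And>u. u \<noteq> 0 \<Longrightarrow> \<bar>u\<bar> < d \<Longrightarrow> speed' M u > 0"
    by (auto simp: eventually_at dist_real_def)
  show ?thesis
    by (intro exI[of _ "d / 2"]) (use d \<open>speed' M 0 > 0\<close> in \<open>force simp: less_eq_real_def\<close>)+
qed

text \<open>
  \<open>\<Gamma> t v\<close> is the integral of \<open>f' (exp (- \<nu> s) v)\<close> over \<open>s\<close> from \<open>t\<close> to \<open>1\<close>, the distance that a characteristic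
  with initial value \<open>v\<close> covers between the times \<open>t\<close> and \<open>1\<close>. Its properties are stated without the
  integral, since it is explicit both for \<open>\<nu> = 0\<close> and, up to a primitive, for \<open>\<nu> > 0\<close>.
\<close>

locale displacement =
  fixes M \<nu> :: real and \<Gamma> \<Gamma>\<^sub>v \<Gamma>\<^sub>v\<^sub>v :: "real \<Rightarrow> real \<Rightarrow> real"
  assumes M_pos: "M > 0" and nu_nonneg: "\<nu> \<ge> 0"
    and \<Gamma>_time: "\<And>t v. ((\<lambda>t. \<Gamma> t v) has_real_derivative - speed M (exp (- \<nu> * t) * v)) (at t)"
    and \<Gamma>_deriv: "\<And>t v. (\<Gamma> t has_real_derivative \<Gamma>\<^sub>v t v) (at v)"
    and \<Gamma>v_deriv: "\<And>t v. (\<Gamma>\<^sub>v t has_real_derivative \<Gamma>\<^sub>v\<^sub>v t v) (at v)"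
    and \<Gamma>_cont: "continuous_on UNIV (\<lambda>p. \<Gamma> (fst p) (snd p))"
    and \<Gamma>v_cont: "continuous_on UNIV (\<lambda>p. \<Gamma>\<^sub>v (fst p) (snd p))"
    and \<Gamma>vv_cont: "continuous_on UNIV (\<lambda>p. \<Gamma>\<^sub>v\<^sub>v (fst p) (snd p))"
    and \<Gamma>_final: "\<And>v. \<Gamma> 1 v = 0"
    and \<Gamma>v_pos: "\<exists>a>0. \<forall>t v. 0 \<le> t \<longrightarrow> t < 1 \<longrightarrow> 0 \<le> v \<longrightarrow> v \<le> a \<longrightarrow> \<Gamma>\<^sub>v t v > 0"

lemma displacement_undamped:
  assumes "M > 0"
  shows "displacement M 0 (\<lambda>t v. (1 - t) * speed M v) (\<lambda>t v. (1 - t) * speed' M v) (\<lambda>t v. (1 - t) * speed'' M v)"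
proof
  obtain a where a: "a > 0" "\<And>u. 0 \<le> u \<Longrightarrow> u \<le> a \<Longrightarrow> speed' M u > 0" using speed'_pos_near_0[OF assms] by blast
  show "\<exists>a>0. \<forall>t v. 0 \<le> t \<longrightarrow> t < 1 \<longrightarrow> 0 \<le> v \<longrightarrow> v \<le> a \<longrightarrow> (1 - t) * speed' M v > 0"
    using a by (intro exI[of _ a]) auto
qed (use assms in \<open>auto intro!: derivative_eq_intros speed_derivative continuous_intros
      continuous_on_compose2[OF continuous_speed(3)] continuous_on_compose2[OF continuous_speed(4)] continuous_on_compose2[OF continuous_speed(5)]\<close>)

lemma displacement_damped:
  assumes "M > 0" "\<nu> > 0" and K: "\<And>x. (K has_real_derivative speed_ratio M x) (at x)"
  shows "displacement M \<nu> (\<lambda>t v. (K (exp (- \<nu> * t) * v) - K (exp (- \<nu>) * v)) / \<nu>)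
    (\<lambda>t v. (exp (- \<nu> * t) * speed_ratio M (exp (- \<nu> * t) * v) - exp (- \<nu>) * speed_ratio M (exp (- \<nu>) * v)) / \<nu>)
    (\<lambda>t v. (exp (- \<nu> * t) * (exp (- \<nu> * t) * speed_ratio' M (exp (- \<nu> * t) * v)) - exp (- \<nu>) * (exp (- \<nu>) * speed_ratio' M (exp (- \<nu>) * v))) / \<nu>)"
    (is "displacement M \<nu> ?\<Gamma> ?\<Gamma>v ?\<Gamma>vv")
proof
  show "M > 0" "\<nu> \<ge> 0" "?\<Gamma> 1 v = 0" for v using assms by auto
  have cK: "continuous_on UNIV K" using K by (meson DERIV_continuous_on has_field_derivative_at_within)
  show "continuous_on UNIV (\<lambda>p. ?\<Gamma> (fst p) (snd p))"
    using assms(2) by (intro continuous_intros continuous_on_compose2[OF cK]) auto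
  show "continuous_on UNIV (\<lambda>p. ?\<Gamma>v (fst p) (snd p))"
    using assms(2) by (intro continuous_intros continuous_on_compose2[OF continuous_speed(1)[OF assms(1)]]) auto
  show "continuous_on UNIV (\<lambda>p. ?\<Gamma>vv (fst p) (snd p))"
    using assms(2) by (intro continuous_intros continuous_on_compose2[OF continuous_speed(2)[OF assms(1)]]) auto
  have e: "((\<lambda>t. exp (- \<nu> * t) * v) has_real_derivative - \<nu> * (exp (- \<nu> * t) * v)) (at t)" for t v
    by (auto intro!: derivative_eq_intros)
  show "((\<lambda>t. ?\<Gamma> t v) has_real_derivative - speed M (exp (- \<nu> * t) * v)) (at t)" for t v
    by (rule DERIV_cong, rule DERIV_cdivide[OF DERIV_diff[OF DERIV_chain2[OF K e] DERIV_const]])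
      (use assms(2) in \<open>simp add: speed_def mult_ac\<close>)
  note k = speed_ratio_derivative[OF assms(1)]
  have s: "((\<lambda>v. c * v) has_real_derivative c) (at v)" for c v :: real
    by (auto intro!: derivative_eq_intros)
  show "(?\<Gamma> t has_real_derivative ?\<Gamma>v t v) (at v)" for t v
    by (rule DERIV_cong, rule DERIV_cdivide[OF DERIV_diff[OF DERIV_chain2[OF K s] DERIV_chain2[OF K s]]])
      (simp add: mult_ac)
  show "(?\<Gamma>v t has_real_derivative ?\<Gamma>vv t v) (at v)" for t v
    by (rule DERIV_cong, rule DERIV_cdivide[OF DERIV_diff[OF DERIV_cmult[OF DERIV_chain2[OF k s]] DERIV_cmult[OF DERIV_chain2[OF k s]]]])
      (simp add: mult_ac)
  obtain a where a: "a > 0" "\<And>u. 0 \<le> u \<Longrightarrow> u \<le> a \<Longrightarrow> speed' M u > 0" using speed'_pos_near_0[OF assms(1)] by blast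
  have "?\<Gamma>v t v > 0" if "0 \<le> t" "t < 1" "0 \<le> v" "v \<le> a" for t v
  proof -
    have d: "((\<lambda>t. ?\<Gamma>v t v) has_real_derivative - (exp (- \<nu> * s) * speed' M (exp (- \<nu> * s) * v))) (at s)" for s
    proof -
      have 1: "((\<lambda>t. exp (- \<nu> * t)) has_real_derivative - \<nu> * exp (- \<nu> * s)) (at s)"
        by (auto intro!: derivative_eq_intros)
      have "((\<lambda>t. ?\<Gamma>v t v) has_real_derivative (- \<nu> * exp (- \<nu> * s) * speed_ratio M (exp (- \<nu> * s) * v)
          + speed_ratio' M (exp (- \<nu> * s) * v) * (- \<nu> * (exp (- \<nu> * s) * v)) * exp (- \<nu> * s) - 0) / \<nu>) (at s)"
        by (rule DERIV_cdivide[OF DERIV_diff[OF DERIV_mult[OF 1 DERIV_chain2[OF k e]] DERIV_const]])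
      also have "(- \<nu> * exp (- \<nu> * s) * speed_ratio M (exp (- \<nu> * s) * v)
          + speed_ratio' M (exp (- \<nu> * s) * v) * (- \<nu> * (exp (- \<nu> * s) * v)) * exp (- \<nu> * s) - 0) / \<nu>
        = - (exp (- \<nu> * s) * speed' M (exp (- \<nu> * s) * v))"
        using assms(2) unfolding speed'_def by (simp add: field_simps)
      finally show ?thesis .
    qed
    have "?\<Gamma>v 1 v < ?\<Gamma>v t v"
    proof (rule DERIV_neg_imp_decreasing[OF that(2)])
      fix s assume s: "t \<le> s" "s \<le> 1"
      have "exp (- \<nu> * s) * v \<le> 1 * v" using s that assms(2) by (intro mult_right_mono) auto
      then have "speed' M (exp (- \<nu> * s) * v) > 0" using that by (intro a(2)) auto
      then show "\<exists>y. ((\<lambda>t. ?\<Gamma>v t v) has_real_derivative y) (at s) \<and> y < 0"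
        using d[of s] by (intro exI[of _ "- (exp (- \<nu> * s) * speed' M (exp (- \<nu> * s) * v))"] conjI) auto
    qed
    then show ?thesis by simp
  qed
  then show "\<exists>a>0. \<forall>t v. 0 \<le> t \<longrightarrow> t < 1 \<longrightarrow> 0 \<le> v \<longrightarrow> v \<le> a \<longrightarrow> ?\<Gamma>v t v > 0"
    using a(1) by blast
qed

lemma displacement_exists:
  assumes "M > 0" "\<nu> \<ge> 0" shows "\<exists>\<Gamma> \<Gamma>v \<Gamma>vv. displacement M \<nu> \<Gamma> \<Gamma>v \<Gamma>vv"
proof (cases "\<nu> = 0")
  case True
  then show ?thesis using displacement_undamped[OF assms(1)] by blast
next
  case False
  obtain K where "\<And>x. (K has_real_derivative speed_ratio M x) (at x)"
    using continuous_antiderivative[OF continuous_speed(1)[OF assms(1)], of 0 0] by blast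
  moreover have "\<nu> > 0" using False assms(2) by simp
  ultimately show ?thesis using displacement_damped[OF assms(1)] by blast
qed

section \<open>A profile whose characteristics collapse on an interval\<close>

text \<open>
  The same \<open>2 pi\<close>-periodic functions serve both domains. On the line they are cut off at \<open>- pi\<close> and \<open>pi\<close>, where
  they and the needed derivatives vanish.
\<close>

definition cut :: "spatial_domain \<Rightarrow> (real \<Rightarrow> real) \<Rightarrow> real \<Rightarrow> real" where
  "cut \<Omega> F x = (if \<Omega> = Line \<and> \<bar>x\<bar> > pi then 0 else F x)"

lemma cut_eq_clamp:
  assumes "F pi = 0" "F (- pi) = 0"
  shows "cut Line F x = F (max (- pi) (min pi x))"
  using assms pi_gt_zero by (auto simp: cut_def max_def min_def abs_if split: if_splits)

lemma cut_admissible: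
  assumes "continuous_on UNIV F" "F pi = 0" "F (- pi) = 0" "\<And>x. F (x + 2 * pi) = F x"
  shows "admissible \<Omega> (cut \<Omega> F)"
proof (cases \<Omega>)
  case Line
  have "continuous_on UNIV (\<lambda>x. F (max (- pi) (min pi x)))"
    by (intro continuous_on_compose2[OF assms(1)] continuous_intros) auto
  then have "continuous_on UNIV (cut Line F)"
    unfolding cut_eq_clamp[of F, OF assms(2,3), abs_def] by simp
  then show ?thesis using Line by (auto simp: admissible_def function_on_def cut_def)
next
  case Torus
  then have "cut \<Omega> F = F" by (auto simp: cut_def)
  then show ?thesis using Torus assms by (simp add: admissible_def function_on_def)
qed

lemma cut_derivative:
  assumes "\<And>x. (F has_real_derivative F' x) (at x)" "F pi = 0" "F (- pi) = 0" "F' pi = 0" "F' (- pi) = 0"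
  shows "(cut \<Omega> F has_real_derivative cut \<Omega> F' x) (at x)"
proof -
  consider "\<Omega> = Torus" | "\<Omega> = Line" "\<bar>x\<bar> < pi" | "\<Omega> = Line" "\<bar>x\<bar> > pi" | "\<Omega> = Line" "\<bar>x\<bar> = pi"
    using linorder_cases[of "\<bar>x\<bar>" pi] spatial_domain.exhaust[of \<Omega>] by metis
  then show ?thesis
  proof cases
    case 1
    then have "cut \<Omega> F = F" "cut \<Omega> F' = F'" by (auto simp: cut_def)
    then show ?thesis using assms(1) by simp
  next
    case 2
    have "open {x::real. \<bar>x\<bar> < pi}" by (intro open_Collect_less continuous_intros)
    then show ?thesis
      using 2 assms(1)[of x] by (rule_tac has_field_derivative_transform_within_open[where S="{x. \<bar>x\<bar> < pi}" and f=F])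
        (auto simp: cut_def)
  next
    case 3
    have "open {x::real. \<bar>x\<bar> > pi}" by (intro open_Collect_less continuous_intros)
    then show ?thesis
      using 3 by (rule_tac has_field_derivative_transform_within_open[where S="{x. \<bar>x\<bar> > pi}" and f="\<lambda>_. 0"])
        (auto simp: cut_def)
  next
    case 4
    then have x: "x = pi \<or> x = - pi" by (auto simp: abs_if split: if_splits)
    then have F0: "F x = 0" "F' x = 0" using assms by auto
    then have C0: "cut \<Omega> F x = 0" "cut \<Omega> F' x = 0" by (auto simp: cut_def)
    have "((\<lambda>y. F y / (y - x)) \<longlongrightarrow> 0) (at x)"
      using assms(1)[of x] F0 by (simp add: has_field_derivative_iff)
    then have "((\<lambda>y. norm (F y / (y - x))) \<longlongrightarrow> 0) (at x)" by (rule tendsto_norm_zero)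
    then have "((\<lambda>y. cut \<Omega> F y / (y - x)) \<longlongrightarrow> 0) (at x)"
      by (rule Lim_null_comparison[rotated]) (auto intro!: always_eventually simp: cut_def)
    then show ?thesis unfolding has_field_derivative_iff C0 by simp
  qed
qed

lemma positive_part_square_derivative: "((\<lambda>y::real. (max 0 y)\<^sup>2) has_real_derivative 2 * max 0 y) (at y)"
proof -
  consider "y < 0" | "y > 0" | "y = 0" by linarith
  then show ?thesis
  proof cases
    case 1
    then show ?thesis
      by (rule_tac has_field_derivative_transform_within_open[where S="{..<0}" and f="\<lambda>_. 0"]) auto
  next
    case 2
    have "((\<lambda>y. y\<^sup>2) has_real_derivative 2 * max 0 y) (at y)" using 2 by (auto intro!: derivative_eq_intros)
    then show ?thesis
      by (rule has_field_derivative_transform_within_open[where S="{0<..}"]) (use 2 in auto)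
  next
    case 3
    have "((\<lambda>h::real. (max 0 h)\<^sup>2 / h) \<longlongrightarrow> 0) (at 0)"
    proof (rule Lim_null_comparison)
      show "\<forall>\<^sub>F h in at 0. norm ((max 0 h)\<^sup>2 / h) \<le> \<bar>h\<bar>"
        by (intro always_eventually) (auto simp: max_def power2_eq_square)
      show "((\<lambda>h::real. \<bar>h\<bar>) \<longlongrightarrow> 0) (at 0)" by (auto intro!: tendsto_eq_intros)
    qed
    then show ?thesis using 3 by (simp add: DERIV_def)
  qed
qed

text \<open>
  The choice of \<open>P'\<close> makes \<open>P\<close> constant where \<open>B' \<le> - 1\<close>, gives \<open>P' = c (1 + B')\<^sup>2 \<ge> c\<close> where \<open>B\<close> increases,
  and keeps \<open>P'\<close> continuously differentiable, because the square of the positive part is.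
\<close>

locale collapsing_profile =
  fixes \<Omega> :: spatial_domain and B B' B'' P P' P'' :: "real \<Rightarrow> real" and c :: real
  assumes B_adm: "admissible \<Omega> B" "admissible \<Omega> B'" "admissible \<Omega> B''"
    and B_deriv: "\<And>x. (B has_real_derivative B' x) (at x)" "\<And>x. (B' has_real_derivative B'' x) (at x)"
    and B_range: "\<And>x. 0 \<le> B x" "\<And>x. B x \<le> 4"
    and P_deriv: "\<And>x. (P has_real_derivative P' x) (at x)" "\<And>x. (P' has_real_derivative P'' x) (at x)"
    and P''_cont: "continuous_on UNIV P''"
    and P'_eq: "\<And>x. P' x = c * (max 0 (1 + B' x))\<^sup>2" and c_pos: "c > 0"
    and P_near_id: "\<exists>C. \<forall>x. \<bar>P x - x\<bar> \<le> C"
    and P_per: "\<Omega> = Torus \<Longrightarrow> P (x + 2 * pi) = P x + 2 * pi"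
    and collapse: "\<exists>x y. P x = P y \<and> B x \<noteq> B y"

text \<open>
  Here \<open>B = (1 + cos x)\<^sup>2\<close>, whose slope at \<open>pi / 2\<close> is \<open>- 2\<close>. On the torus \<open>P\<close> has to gain exactly \<open>2 pi\<close> over a
  period, which fixes \<open>c\<close>; on the line \<open>c = 1\<close> keeps \<open>P x - x\<close> bounded, since \<open>B'\<close> vanishes far out.
\<close>

lemma collapsing_profile_exists: "\<exists>B B' B'' P P' P'' c. collapsing_profile \<Omega> B B' B'' P P' P'' c"
proof -
  define b b' b'' :: "real \<Rightarrow> real" where "b x = (1 + cos x)\<^sup>2" and "b' x = - 2 * sin x * (1 + cos x)"
    and "b'' x = 2 * (sin x)\<^sup>2 - 2 * cos x * (1 + cos x)" for x
  have db: "(b has_real_derivative b' x) (at x)" for x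
    unfolding b_def[abs_def] b'_def by (auto intro!: derivative_eq_intros)
  have db': "(b' has_real_derivative b'' x) (at x)" for x
    unfolding b'_def[abs_def] b''_def by (auto intro!: derivative_eq_intros simp: power2_eq_square algebra_simps)
  have z: "b pi = 0" "b (-pi) = 0" "b' pi = 0" "b' (-pi) = 0" "b'' pi = 0" "b'' (-pi) = 0"
    by (auto simp: b_def b'_def b''_def)
  have per: "b (x + 2 * pi) = b x" "b' (x + 2 * pi) = b' x" "b'' (x + 2 * pi) = b'' x" for x
    by (auto simp: b_def b'_def b''_def)
  have cb: "continuous_on UNIV b" "continuous_on UNIV b'" "continuous_on UNIV b''"
    unfolding b_def[abs_def] b'_def[abs_def] b''_def[abs_def] by (intro continuous_intros)+
  define B B' B'' where "B = cut \<Omega> b" and "B' = cut \<Omega> b'" and "B'' = cut \<Omega> b''"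
  have adm: "admissible \<Omega> B" "admissible \<Omega> B'" "admissible \<Omega> B''"
    unfolding B_def B'_def B''_def by (intro cut_admissible cb z per)+
  have dB: "(B has_real_derivative B' x) (at x)" "(B' has_real_derivative B'' x) (at x)" for x
    unfolding B_def B'_def B''_def by (rule cut_derivative[OF db z(1,2,3,4)], rule cut_derivative[OF db' z(3,4,5,6)])
  have cB': "continuous_on UNIV B'" "continuous_on UNIV B''" using adm by (auto simp: admissible_def)
  have cos: "0 \<le> 1 + cos x" "1 + cos x \<le> 2" for x :: real
    using cos_ge_minus_one[of x] cos_le_one[of x] by linarith+
  have "0 \<le> b x" "b x \<le> 2\<^sup>2" for x
    unfolding b_def by (rule zero_le_power2, rule power_mono[OF cos(2,1)])
  then have rB: "0 \<le> B x" "B x \<le> 4" for x by (auto simp: B_def cut_def)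
  define h where "h x = (max 0 (1 + B' x))\<^sup>2" for x
  have ch: "continuous_on UNIV h" unfolding h_def[abs_def] by (intro continuous_intros cB')
  have dh: "(h has_real_derivative 2 * max 0 (1 + B' x) * B'' x) (at x)" for x
  proof -
    have "((\<lambda>x. 1 + B' x) has_real_derivative B'' x) (at x)" using dB(2) by (auto intro!: derivative_eq_intros)
    from DERIV_chain2[OF positive_part_square_derivative this] show ?thesis unfolding h_def[abs_def] .
  qed
  obtain H where H: "\<And>x. (H has_real_derivative h x) (at x)" "H 0 = 0"
    using continuous_antiderivative[OF ch, of 0 0] by blast
  have Hmono: "H x \<le> H y" if "x \<le> y" for x y
    by (rule DERIV_nonneg_imp_nondecreasing[OF that]) (use H(1) in \<open>auto simp: h_def intro!: exI\<close>)
  have "\<exists>c>0. (\<Omega> = Line \<longrightarrow> c = 1) \<and> (\<Omega> = Torus \<longrightarrow> (\<forall>x. c * H (x + 2 * pi) = c * H x + 2 * pi))"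
  proof (cases \<Omega>)
    case Torus
    have I: "H (2 * pi) > 0"
    proof (rule ccontr)
      assume "\<not> H (2 * pi) > 0"
      then have *: "H x = 0" if "x \<in> {0<..<2 * pi}" for x
        using Hmono[of 0 x] Hmono[of x "2 * pi"] H(2) that by auto
      have "(H has_real_derivative 0) (at pi)"
        by (rule has_field_derivative_transform_within_open[of "\<lambda>_. 0" _ _ "{0<..<2 * pi}"]) (auto simp: *)
      then have "h pi = 0" using H(1) DERIV_unique by blast
      then show False using z by (simp add: h_def B'_def cut_def)
    qed
    have hper: "h (x + 2 * pi) = h x" for x using per Torus by (simp add: h_def B'_def cut_def)
    have incr: "H (x + 2 * pi) - H x = H (0 + 2 * pi) - H 0" for x
    proof -
      have d: "((\<lambda>x. H (x + 2 * pi) - H x) has_real_derivative 0) (at y)" for y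
      proof -
        have "((\<lambda>x. H (x + 2 * pi)) has_real_derivative h (y + 2 * pi) * 1) (at y)"
          by (rule DERIV_chain2[OF H(1)]) (auto intro!: derivative_eq_intros)
        from DERIV_diff[OF this H(1)] show ?thesis using hper by simp
      qed
      show ?thesis
      proof (cases "0 \<le> x")
        case True
        then show ?thesis by (rule zero_derivative_imp_eq[OF _ d, symmetric])
      next
        case False
        then have "x \<le> 0" by simp
        then show ?thesis by (rule zero_derivative_imp_eq[OF _ d])
      qed
    qed
    have "H (x + 2 * pi) = H x + H (2 * pi)" for x using incr[of x] H(2) by simp
    then show ?thesis
      using I Torus by (intro exI[of _ "2 * pi / H (2 * pi)"]) (auto simp: distrib_left)
  qed auto
  then obtain c where c: "c > 0" "\<Omega> = Line \<Longrightarrow> c = 1" "\<And>x. \<Omega> = Torus \<Longrightarrow> c * H (x + 2 * pi) = c * H x + 2 * pi"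
    by blast
  define P where "P x = c * H x" for x
  have dP: "(P has_real_derivative c * h x) (at x)" for x unfolding P_def[abs_def] by (rule DERIV_cmult[OF H(1)])
  have "\<exists>y\<in>{-pi..pi}. P x - x = P y - y" for x
  proof (cases \<Omega>)
    case Torus
    then show ?thesis using c(3) by (intro periodic_reduce) (auto simp: P_def)
  next
    case Line
    have d: "((\<lambda>x. P x - x) has_real_derivative 0) (at y)" if "\<bar>y\<bar> \<ge> pi" for y
    proof -
      have "\<bar>y\<bar> > pi \<or> y = pi \<or> y = - pi" using that by linarith
      then have "B' y = 0" using z Line by (auto simp: B'_def cut_def)
      then have "h y = 1" by (simp add: h_def)
      then show ?thesis using DERIV_diff[OF dP DERIV_ident, of y] c(2)[OF Line] by simp
    qed
    consider "\<bar>x\<bar> \<le> pi" | "x > pi" | "x < - pi" by linarith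
    then show ?thesis
    proof cases
      case 1
      then show ?thesis by (intro bexI[of _ x]) (auto simp: abs_le_iff)
    next
      case 2
      have "P pi - pi = P x - x"
        by (rule zero_derivative_imp_eq[of pi x "\<lambda>x. P x - x"]) (use 2 d in auto)
      then show ?thesis by (intro bexI[of _ pi]) auto
    next
      case 3
      have "P x - x = P (- pi) - (- pi)"
        by (rule zero_derivative_imp_eq[of x "-pi" "\<lambda>x. P x - x"]) (use 3 d in auto)
      then show ?thesis by (intro bexI[of _ "-pi"]) auto
    qed
  qed
  moreover have "compact ((\<lambda>x. P x - x) ` {-pi..pi})"
    using dP by (intro compact_continuous_image continuous_intros) (auto intro!: continuous_at_imp_continuous_on DERIV_isCont)
  then obtain C where "\<And>y. y \<in> {-pi..pi} \<Longrightarrow> \<bar>P y - y\<bar> \<le> C"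
    using compact_imp_bounded by (force simp: bounded_iff)
  ultimately have near: "\<exists>C. \<forall>x. \<bar>P x - x\<bar> \<le> C" by metis
  have coll: "\<exists>x y. P x = P y \<and> B x \<noteq> B y"
  proof -
    have "B' (pi / 2) = - 2" by (simp add: B'_def cut_def b'_def)
    moreover have "isCont B' (pi / 2)" using dB(2) by (rule DERIV_isCont)
    ultimately have "\<forall>\<^sub>F x in at (pi / 2). B' x < - 1" unfolding isCont_def by (intro order_tendstoD(2)) auto
    then obtain e where e: "e > 0" "\<And>x. x \<noteq> pi / 2 \<Longrightarrow> \<bar>x - pi / 2\<bar> < e \<Longrightarrow> B' x < - 1"
      by (auto simp: eventually_at dist_real_def)
    define y where "y = pi / 2 + e / 2"
    have neg: "B' x < - 1" if "pi / 2 \<le> x" "x \<le> y" for x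
    proof (cases "x = pi / 2")
      case True
      show ?thesis unfolding True \<open>B' (pi / 2) = - 2\<close> by simp
    next
      case False
      then show ?thesis using that e(1) by (intro e(2)) (auto simp: y_def)
    qed
    have "P (pi / 2) = P y"
    proof (rule zero_derivative_imp_eq[of "pi / 2" y P])
      show "pi / 2 \<le> y" using e(1) by (simp add: y_def)
      show "(P has_real_derivative 0) (at x)" if "pi / 2 \<le> x" "x \<le> y" for x
        using dP[of x] neg[OF that] by (simp add: h_def)
    qed
    moreover have "B y < B (pi / 2)"
    proof (rule DERIV_neg_imp_decreasing[of "pi / 2" y B])
      show "pi / 2 < y" using e(1) by (simp add: y_def)
      show "\<exists>d. (B has_real_derivative d) (at x) \<and> d < 0" if "pi / 2 \<le> x" "x \<le> y" for x
        using dB(1)[of x] neg[OF that] by (intro exI[of _ "B' x"]) auto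
    qed
    ultimately show ?thesis by (intro exI[of _ "pi / 2"] exI[of _ y]) auto
  qed
  have "collapsing_profile \<Omega> B B' B'' P (\<lambda>x. c * h x) (\<lambda>x. c * (2 * max 0 (1 + B' x) * B'' x)) c"
  proof
    show "continuous_on UNIV (\<lambda>x. c * (2 * max 0 (1 + B' x) * B'' x))" by (intro continuous_intros cB')
    show "((\<lambda>x. c * h x) has_real_derivative c * (2 * max 0 (1 + B' x) * B'' x)) (at x)" for x
      by (rule DERIV_cmult[OF dh])
    show "P (x + 2 * pi) = P x + 2 * pi" if "\<Omega> = Torus" for x using c(3)[OF that] by (simp add: P_def)
    show "c * h x = c * (max 0 (1 + B' x))\<^sup>2" for x by (simp add: h_def)
  qed (fact adm dB rB dP c(1) near coll)+
  then show ?thesis by blast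
qed

section \<open>The solution along characteristics\<close>

abbreviation strip :: "(real \<times> real) set" where "strip \<equiv> {0..<1} \<times> UNIV"

text \<open>
  \<open>U\<close> and \<open>P\<close> are the value and the final position of a label. The positivity assumption says that
  characteristics do not cross before time \<open>1\<close>, the last one that some of them with different
  values meet at that time.
\<close>

locale shock = displacement +
  fixes \<Omega> :: spatial_domain and U U' U'' P P' P'' :: "real \<Rightarrow> real"
  assumes U_adm: "admissible \<Omega> U" "admissible \<Omega> U'" "admissible \<Omega> U''"
    and U_deriv: "\<And>x. (U has_real_derivative U' x) (at x)" "\<And>x. (U' has_real_derivative U'' x) (at x)"
    and U_range: "\<And>x. 0 \<le> U x" "\<And>x. U x \<le> 1"
    and P_deriv: "\<And>x. (P has_real_derivative P' x) (at x)" "\<And>x. (P' has_real_derivative P'' x) (at x)"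
    and P''_cont: "continuous_on UNIV P''"
    and P_near_id: "\<exists>C. \<forall>x. \<bar>P x - x\<bar> \<le> C"
    and P_per: "\<Omega> = Torus \<Longrightarrow> P (x + 2 * pi) = P x + 2 * pi"
    and X'_pos: "\<And>t x. 0 \<le> t \<Longrightarrow> t < 1 \<Longrightarrow> P' x - \<Gamma>\<^sub>v t (U x) * U' x > 0"
    and collapse: "\<exists>x y. P x = P y \<and> U x \<noteq> U y"
begin

definition X where "X t \<theta> = P \<theta> - \<Gamma> t (U \<theta>)"
definition X' where "X' t \<theta> = P' \<theta> - \<Gamma>\<^sub>v t (U \<theta>) * U' \<theta>"
definition X'' where "X'' t \<theta> = P'' \<theta> - (\<Gamma>\<^sub>v\<^sub>v t (U \<theta>) * U' \<theta> * U' \<theta> + U'' \<theta> * \<Gamma>\<^sub>v t (U \<theta>))"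

lemma continuous_U: "continuous_on S U" "continuous_on S U'" "continuous_on S U''"
  using U_adm by (auto simp: admissible_def intro: continuous_on_subset)

lemma continuous_P: "continuous_on S P" "continuous_on S P'" "continuous_on S P''"
proof -
  show "continuous_on S P" "continuous_on S P'"
    by (auto intro!: continuous_at_imp_continuous_on DERIV_isCont P_deriv)
  show "continuous_on S P''" by (rule continuous_on_subset[OF P''_cont]) simp
qed

lemma continuous_\<Gamma>:
  fixes g h :: "'x::topological_space \<Rightarrow> real"
  assumes "continuous_on S g" "continuous_on S h"
  shows "continuous_on S (\<lambda>q. \<Gamma> (g q) (h q))" "continuous_on S (\<lambda>q. \<Gamma>\<^sub>v (g q) (h q))" "continuous_on S (\<lambda>q. \<Gamma>\<^sub>v\<^sub>v (g q) (h q))"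
proof -
  have c: "continuous_on S (\<lambda>q. (g q, h q))" by (intro continuous_intros assms)
  show "continuous_on S (\<lambda>q. \<Gamma> (g q) (h q))" using continuous_on_compose2[OF \<Gamma>_cont c] by simp
  show "continuous_on S (\<lambda>q. \<Gamma>\<^sub>v (g q) (h q))" using continuous_on_compose2[OF \<Gamma>v_cont c] by simp
  show "continuous_on S (\<lambda>q. \<Gamma>\<^sub>v\<^sub>v (g q) (h q))" using continuous_on_compose2[OF \<Gamma>vv_cont c] by simp
qed

lemma continuous_comp:
  fixes g h :: "'x::topological_space \<Rightarrow> real"
  assumes "continuous_on S g" "continuous_on S h"
  shows "continuous_on S (\<lambda>q. X (g q) (h q))" "continuous_on S (\<lambda>q. X' (g q) (h q))" "continuous_on S (\<lambda>q. X'' (g q) (h q))"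
    "continuous_on S (\<lambda>q. U (h q))" "continuous_on S (\<lambda>q. U' (h q))" "continuous_on S (\<lambda>q. U'' (h q))"
proof -
  note c = continuous_on_compose2[OF _ assms(2), of UNIV]
  show U: "continuous_on S (\<lambda>q. U (h q))" "continuous_on S (\<lambda>q. U' (h q))" "continuous_on S (\<lambda>q. U'' (h q))"
    by (auto intro!: c continuous_U)
  have P: "continuous_on S (\<lambda>q. P (h q))" "continuous_on S (\<lambda>q. P' (h q))" "continuous_on S (\<lambda>q. P'' (h q))"
    by (auto intro!: c continuous_P)
  show "continuous_on S (\<lambda>q. X (g q) (h q))" "continuous_on S (\<lambda>q. X' (g q) (h q))" "continuous_on S (\<lambda>q. X'' (g q) (h q))"
    unfolding X_def X'_def X''_def by (intro continuous_intros continuous_\<Gamma> U P assms(1))+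
qed

lemma X_deriv: "(X t has_real_derivative X' t \<theta>) (at \<theta>)" "(X' t has_real_derivative X'' t \<theta>) (at \<theta>)"
  unfolding X_def[abs_def] X'_def[abs_def] X''_def
  by (intro DERIV_diff DERIV_mult P_deriv U_deriv DERIV_chain2[OF \<Gamma>_deriv] DERIV_chain2[OF \<Gamma>v_deriv])+

lemma X_time_deriv: "((\<lambda>t. X t \<theta>) has_real_derivative speed M (exp (- \<nu> * t) * U \<theta>)) (at t)"
  unfolding X_def using DERIV_diff[OF DERIV_const \<Gamma>_time] by (rule DERIV_cong) simp

lemma X_strict_mono:
  assumes "0 \<le> t" "t < 1" "\<theta> < \<theta>'" shows "X t \<theta> < X t \<theta>'"
proof (rule DERIV_pos_imp_increasing[OF assms(3)])
  show "\<exists>d. (X t has_real_derivative d) (at x) \<and> 0 < d" for x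
    using X_deriv(1)[of t x] X'_pos[OF assms(1,2), of x] unfolding X'_def by blast
qed

lemma X_near_id: "\<exists>C. \<forall>t \<theta>. 0 \<le> t \<longrightarrow> t \<le> 1 \<longrightarrow> \<bar>X t \<theta> - \<theta>\<bar> \<le> C"
proof -
  obtain C where C: "\<And>x. \<bar>P x - x\<bar> \<le> C" using P_near_id by blast
  have "compact ((\<lambda>p. \<Gamma> (fst p) (snd p)) ` ({0..1} \<times> {0..1}))"
    by (intro compact_continuous_image compact_Times continuous_on_subset[OF \<Gamma>_cont]) auto
  then obtain E where E: "\<And>t v. 0 \<le> t \<Longrightarrow> t \<le> 1 \<Longrightarrow> 0 \<le> v \<Longrightarrow> v \<le> 1 \<Longrightarrow> \<bar>\<Gamma> t v\<bar> \<le> E"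
    using compact_imp_bounded by (fastforce simp: bounded_iff)
  have "\<bar>X t \<theta> - \<theta>\<bar> \<le> C + E" if "0 \<le> t" "t \<le> 1" for t \<theta>
    using C[of \<theta>] E[OF that U_range, of \<theta>] unfolding X_def by linarith
  then show ?thesis by blast
qed

definition Y where "Y t x = (SOME \<theta>. X t \<theta> = x)"

lemma X_Y:
  assumes "0 \<le> t" "t < 1" shows "X t (Y t x) = x"
proof -
  obtain C where C: "\<And>\<theta>. \<bar>X t \<theta> - \<theta>\<bar> \<le> C" using X_near_id assms by (meson less_imp_le)
  have "X t (x - C) \<le> x" "x \<le> X t (x + C)" using C[of "x - C"] C[of "x + C"] by linarith+
  moreover have "0 \<le> C" using C[of 0] by linarith
  ultimately have "\<exists>\<theta>\<ge>x - C. \<theta> \<le> x + C \<and> X t \<theta> = x"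
    by (intro IVT) (auto intro: DERIV_isCont[OF X_deriv(1)])
  then have "\<exists>\<theta>. X t \<theta> = x" by blast
  then show ?thesis unfolding Y_def by (rule someI_ex)
qed

lemma X_less_iff:
  assumes "0 \<le> t" "t < 1" shows "X t \<theta> < X t \<theta>' \<longleftrightarrow> \<theta> < \<theta>'"
  using X_strict_mono[OF assms] by (metis less_asym' linorder_neqE_linordered_idom less_irrefl)

lemma X_eq_iff:
  assumes "0 \<le> t" "t < 1" shows "X t \<theta> = X t \<theta>' \<longleftrightarrow> \<theta> = \<theta>'"
  using X_strict_mono[OF assms] by (metis linorder_neqE_linordered_idom less_irrefl)

lemma Y_X: "0 \<le> t \<Longrightarrow> t < 1 \<Longrightarrow> Y t (X t \<theta>) = \<theta>"
  using X_Y[of t "X t \<theta>"] X_eq_iff by blast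

text \<open>
  The order relation between \<open>Y t x\<close> and a label \<open>a\<close> is the one between \<open>x\<close> and \<open>X t a\<close>, and the latter depends
  continuously on \<open>(t, x)\<close>.
\<close>

lemma continuous_Y: "continuous_on strip (\<lambda>p. Y (fst p) (snd p))"
  unfolding continuous_on_def
proof
  fix p\<^sub>0 :: "real \<times> real" assume p0: "p\<^sub>0 \<in> strip"
  have inS: "\<forall>\<^sub>F p in at p\<^sub>0 within strip. p \<in> strip" by (simp add: eventually_at_filter)
  have lim: "((\<lambda>p. snd p - X (fst p) a) \<longlongrightarrow> snd p\<^sub>0 - X (fst p\<^sub>0) a) (at p\<^sub>0 within strip)" for a
  proof -
    have "continuous_on strip (\<lambda>p. snd p - X (fst p) a)" by (intro continuous_intros continuous_comp)
    then show ?thesis using p0 by (auto simp: continuous_on_def)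
  qed
  have YX: "a < Y t x \<longleftrightarrow> 0 < x - X t a" "Y t x < a \<longleftrightarrow> x - X t a < 0" if "(t, x) \<in> strip" for t x a
    using that X_less_iff[of t a "Y t x"] X_less_iff[of t "Y t x" a] X_Y[of t x] by auto
  show "((\<lambda>p. Y (fst p) (snd p)) \<longlongrightarrow> Y (fst p\<^sub>0) (snd p\<^sub>0)) (at p\<^sub>0 within strip)"
  proof (rule order_tendstoI)
    fix a assume "a < Y (fst p\<^sub>0) (snd p\<^sub>0)"
    then have "0 < snd p\<^sub>0 - X (fst p\<^sub>0) a" using YX(1)[of "fst p\<^sub>0" "snd p\<^sub>0" a] p0 by simp
    from order_tendstoD(1)[OF lim this] inS
    show "\<forall>\<^sub>F p in at p\<^sub>0 within strip. a < Y (fst p) (snd p)"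
      by eventually_elim (use YX(1) in auto)
  next
    fix a assume "Y (fst p\<^sub>0) (snd p\<^sub>0) < a"
    then have "snd p\<^sub>0 - X (fst p\<^sub>0) a < 0" using YX(2)[of "fst p\<^sub>0" "snd p\<^sub>0" a] p0 by simp
    from order_tendstoD(2)[OF lim this] inS
    show "\<forall>\<^sub>F p in at p\<^sub>0 within strip. Y (fst p) (snd p) < a"
      by eventually_elim (use YX(2) in auto)
  qed
qed

lemma continuous_Y_slice:
  assumes "0 \<le> t" "t < 1" shows "continuous_on UNIV (Y t)"
proof -
  have "continuous_on UNIV (\<lambda>x::real. (t, x))" by (intro continuous_intros)
  moreover have "(\<lambda>x::real. (t, x)) ` UNIV \<subseteq> strip" using assms by auto
  ultimately have "continuous_on UNIV (\<lambda>x. Y (fst (t, x)) (snd (t, x)))"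
    by (rule continuous_on_compose2[OF continuous_Y])
  then show ?thesis by simp
qed

lemma Y_isCont_time:
  assumes "0 < t" "t < 1" shows "isCont (\<lambda>s. Y s x) t"
proof -
  have "continuous_on {0<..<1} (\<lambda>s. Y s x)"
  proof -
    have "continuous_on {0<..<1} (\<lambda>s. (s, x))" by (intro continuous_intros)
    moreover have "(\<lambda>s. (s, x)) ` {0<..<1} \<subseteq> strip" by auto
    ultimately have "continuous_on {0<..<1} (\<lambda>s. Y (fst (s, x)) (snd (s, x)))"
      by (rule continuous_on_compose2[OF continuous_Y])
    then show ?thesis by simp
  qed
  then show ?thesis using assms by (auto simp: continuous_on_eq_continuous_at)
qed

lemma X'_positive: "0 \<le> t \<Longrightarrow> t < 1 \<Longrightarrow> X' t \<theta> > 0"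
  unfolding X'_def by (rule X'_pos)

lemma Y_deriv:
  assumes "0 \<le> t" "t < 1" shows "(Y t has_real_derivative 1 / X' t (Y t x)) (at x)"
proof -
  have "(Y t has_real_derivative inverse (X' t (Y t x))) (at x)"
  proof (rule DERIV_inverse_function[where f = "X t" and a = "x - 1" and b = "x + 1"])
    show "(X t has_real_derivative X' t (Y t x)) (at (Y t x))" by (rule X_deriv)
    show "X' t (Y t x) \<noteq> 0" using X'_positive[OF assms] by (metis less_irrefl)
    show "isCont (Y t) x" using continuous_Y_slice[OF assms] by (simp add: continuous_on_eq_continuous_at)
  qed (use X_Y[OF assms] in auto)
  then show ?thesis by (simp add: inverse_eq_divide)
qed

text \<open>
  Differentiation of \<open>X s (Y s x) = x\<close>. The increment is split into one in the label, expressed by the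
  Caratheodory quotient \<open>q\<close> of \<open>X t\<close>, and one in time, expressed by the mean value theorem.
\<close>

lemma Y_time_deriv:
  assumes t: "0 < t" "t < 1"
  shows "((\<lambda>s. Y s x) has_real_derivative - speed M (exp (- \<nu> * t) * U (Y t x)) / X' t (Y t x)) (at t)"
proof -
  define y where "y = Y t x"
  obtain q where q: "\<And>\<theta>. X t \<theta> - X t y = q \<theta> * (\<theta> - y)" "isCont q y" "q y = X' t y"
    using X_deriv(1)[of t y] unfolding CARAT_DERIV by blast
  have Xp: "X' t y > 0" using X'_positive t by simp
  have Ylim: "((\<lambda>s. Y s x) \<longlongrightarrow> y) (at t)"
    using Y_isCont_time[OF t] unfolding isCont_def y_def .
  have "\<exists>\<xi>. \<bar>\<xi> - t\<bar> \<le> \<bar>s - t\<bar> \<and> X s \<theta> - X t \<theta> = (s - t) * speed M (exp (- \<nu> * \<xi>) * U \<theta>)" for s \<theta>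
  proof -
    consider "s = t" | "s < t" | "t < s" by linarith
    then show ?thesis
    proof cases
      case 2
      from MVT2[OF this X_time_deriv[of \<theta>]] obtain \<xi> where \<xi>: "s < \<xi>" "\<xi> < t"
        "X t \<theta> - X s \<theta> = (t - s) * speed M (exp (- \<nu> * \<xi>) * U \<theta>)" by blast
      then have "X s \<theta> - X t \<theta> = (s - t) * speed M (exp (- \<nu> * \<xi>) * U \<theta>)" by (simp add: algebra_simps)
      with \<xi> show ?thesis by (intro exI[of _ \<xi>]) auto
    next
      case 3
      from MVT2[OF this X_time_deriv[of \<theta>]] obtain \<xi> where "t < \<xi>" "\<xi> < s"
        "X s \<theta> - X t \<theta> = (s - t) * speed M (exp (- \<nu> * \<xi>) * U \<theta>)" by blast
      then show ?thesis by (intro exI[of _ \<xi>]) auto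
    qed auto
  qed
  then obtain \<xi> where \<xi>: "\<And>s \<theta>. \<bar>\<xi> s \<theta> - t\<bar> \<le> \<bar>s - t\<bar>"
    "\<And>s \<theta>. X s \<theta> - X t \<theta> = (s - t) * speed M (exp (- \<nu> * \<xi> s \<theta>) * U \<theta>)" by metis
  have \<xi>lim: "((\<lambda>s. \<xi> s (Y s x)) \<longlongrightarrow> t) (at t)"
  proof -
    have "((\<lambda>s. \<xi> s (Y s x) - t) \<longlongrightarrow> 0) (at t)"
    proof (rule Lim_null_comparison)
      show "\<forall>\<^sub>F s in at t. norm (\<xi> s (Y s x) - t) \<le> \<bar>s - t\<bar>" using \<xi>(1) by simp
      show "((\<lambda>s. \<bar>s - t\<bar>) \<longlongrightarrow> 0) (at t)" by (auto intro!: tendsto_eq_intros)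
    qed
    then show ?thesis by (simp add: LIM_zero_iff)
  qed
  have qlim: "((\<lambda>s. q (Y s x)) \<longlongrightarrow> X' t y) (at t)"
    using isCont_tendsto_compose[OF q(2) Ylim] q(3) by simp
  have "isCont (speed M) z" for z using speed_derivative(1)[OF M_pos] by (rule DERIV_isCont)
  moreover have "isCont U y" using U_deriv(1) by (rule DERIV_isCont)
  ultimately have slim: "((\<lambda>s. speed M (exp (- \<nu> * \<xi> s (Y s x)) * U (Y s x))) \<longlongrightarrow> speed M (exp (- \<nu> * t) * U y)) (at t)"
    by (intro isCont_tendsto_compose[of _ "speed M"] isCont_tendsto_compose[of _ U] tendsto_intros \<xi>lim Ylim)
  have lim: "((\<lambda>s. - speed M (exp (- \<nu> * \<xi> s (Y s x)) * U (Y s x)) / q (Y s x)) \<longlongrightarrow> - speed M (exp (- \<nu> * t) * U y) / X' t y) (at t)"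
    using Xp by (intro tendsto_divide tendsto_minus slim qlim) auto
  have "\<forall>\<^sub>F s in at t. s \<in> {0<..<1}" using t by (intro eventually_at_in_open') auto
  moreover have "\<forall>\<^sub>F s in at t. s \<noteq> t" by (simp add: eventually_at_filter)
  moreover have "\<forall>\<^sub>F s in at t. q (Y s x) > 0" using order_tendstoD(1)[OF qlim Xp] .
  ultimately have "\<forall>\<^sub>F s in at t. - speed M (exp (- \<nu> * \<xi> s (Y s x)) * U (Y s x)) / q (Y s x) = (Y s x - Y t x) / (s - t)"
  proof eventually_elim
    case (elim s)
    have "X s (Y s x) = x" "X t y = x" using elim t X_Y by (auto simp: y_def)
    then have "q (Y s x) * (Y s x - y) = - ((s - t) * speed M (exp (- \<nu> * \<xi> s (Y s x)) * U (Y s x)))"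
      using q(1)[of "Y s x"] \<xi>(2)[of s "Y s x"] by linarith
    then have "Y s x - y = - ((s - t) * speed M (exp (- \<nu> * \<xi> s (Y s x)) * U (Y s x))) / q (Y s x)"
      using elim by (simp add: field_simps)
    then show ?case using elim unfolding y_def[symmetric] by simp
  qed
  from Lim_transform_eventually[OF lim this]
  show ?thesis unfolding has_field_derivative_iff y_def .
qed

definition u where "u t x = exp (- \<nu> * t) * U (Y t x)"
definition u\<^sub>x where "u\<^sub>x t x = exp (- \<nu> * t) * (U' (Y t x) / X' t (Y t x))"
definition u\<^sub>x\<^sub>x where "u\<^sub>x\<^sub>x t x = exp (- \<nu> * t) *
  ((U'' (Y t x) * X' t (Y t x) - U' (Y t x) * X'' t (Y t x)) / X' t (Y t x) ^ 3)"

lemma u_deriv: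
  assumes "0 \<le> t" "t < 1"
  shows "(u t has_real_derivative u\<^sub>x t x) (at x)" "(u\<^sub>x t has_real_derivative u\<^sub>x\<^sub>x t x) (at x)"
proof -
  note Yd = Y_deriv[OF assms, of x]
  have Xp: "X' t (Y t x) > 0" by (rule X'_positive[OF assms])
  show "(u t has_real_derivative u\<^sub>x t x) (at x)"
    unfolding u_def[abs_def] u\<^sub>x_def
    using DERIV_cmult[OF DERIV_chain2[OF U_deriv(1) Yd], of "exp (- \<nu> * t)"] by simp
  have "((\<lambda>x. U' (Y t x) / X' t (Y t x)) has_real_derivative
     ((U'' (Y t x) * (1 / X' t (Y t x))) * X' t (Y t x) - U' (Y t x) * (X'' t (Y t x) * (1 / X' t (Y t x)))) / (X' t (Y t x) * X' t (Y t x))) (at x)"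
    using Xp by (intro DERIV_divide DERIV_chain2[OF U_deriv(2) Yd] DERIV_chain2[OF X_deriv(2) Yd]) simp
  also have "((U'' (Y t x) * (1 / X' t (Y t x))) * X' t (Y t x) - U' (Y t x) * (X'' t (Y t x) * (1 / X' t (Y t x)))) / (X' t (Y t x) * X' t (Y t x))
     = (U'' (Y t x) * X' t (Y t x) - U' (Y t x) * X'' t (Y t x)) / X' t (Y t x) ^ 3"
    using Xp by (simp add: field_simps eval_nat_numeral)
  finally show "(u\<^sub>x t has_real_derivative u\<^sub>x\<^sub>x t x) (at x)"
    unfolding u\<^sub>x_def[abs_def] u\<^sub>x\<^sub>x_def by (rule DERIV_cmult)
qed

lemma u_time_deriv:
  assumes "0 < t" "t < 1"
  shows "((\<lambda>s. u s x) has_real_derivative - \<nu> * u t x - speed M (u t x) * u\<^sub>x t x) (at t)"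
proof -
  have e: "((\<lambda>s. exp (- \<nu> * s)) has_real_derivative - \<nu> * exp (- \<nu> * t)) (at t)"
    by (auto intro!: derivative_eq_intros)
  from DERIV_mult[OF e DERIV_chain2[OF U_deriv(1) Y_time_deriv[OF assms]], of x]
  show ?thesis unfolding u_def u\<^sub>x_def by (rule DERIV_cong) (simp add: field_simps)
qed

lemma continuous_u:
  "continuous_on strip (\<lambda>p. u (fst p) (snd p))" "continuous_on strip (\<lambda>p. u\<^sub>x (fst p) (snd p))"
  "continuous_on strip (\<lambda>p. u\<^sub>x\<^sub>x (fst p) (snd p))"
proof -
  have Xp: "X' (fst p) (Y (fst p) (snd p)) \<noteq> 0" if "p \<in> strip" for p
    using X'_positive[of "fst p" "Y (fst p) (snd p)"] that by auto
  note c = continuous_comp[OF continuous_on_fst[OF continuous_on_id] continuous_Y]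
  show "continuous_on strip (\<lambda>p. u (fst p) (snd p))" "continuous_on strip (\<lambda>p. u\<^sub>x (fst p) (snd p))"
    "continuous_on strip (\<lambda>p. u\<^sub>x\<^sub>x (fst p) (snd p))"
    unfolding u_def u\<^sub>x_def u\<^sub>x\<^sub>x_def using Xp by (intro continuous_intros c; auto)+
qed

lemma continuous_slice:
  assumes "continuous_on strip (\<lambda>p. f (fst p) (snd p))" "0 \<le> t" "t < 1"
  shows "continuous_on UNIV (f t :: real \<Rightarrow> real)"
proof -
  have "continuous_on UNIV (\<lambda>x::real. (t, x))" by (intro continuous_intros)
  moreover have "(\<lambda>x::real. (t, x)) ` UNIV \<subseteq> strip" using assms by auto
  ultimately have "continuous_on UNIV (\<lambda>x. f (fst (t, x)) (snd (t, x)))"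
    by (rule continuous_on_compose2[OF assms(1)])
  then show ?thesis by simp
qed

lemma Y_periodic:
  assumes "\<Omega> = Torus" "0 \<le> t" "t < 1" shows "Y t (x + 2 * pi) = Y t x + 2 * pi"
proof -
  have "X t (Y t x + 2 * pi) = X t (Y t x) + 2 * pi"
    using P_per[OF assms(1)] U_adm(1) assms(1) by (simp add: X_def admissible_def function_on_def)
  then have "X t (Y t x + 2 * pi) = X t (Y t (x + 2 * pi))" using X_Y[OF assms(2,3)] by simp
  then show ?thesis using X_eq_iff[OF assms(2,3)] by simp
qed

lemma u_periodic:
  assumes "\<Omega> = Torus" "0 \<le> t" "t < 1"
  shows "u t (x + 2 * pi) = u t x" "u\<^sub>x t (x + 2 * pi) = u\<^sub>x t x" "u\<^sub>x\<^sub>x t (x + 2 * pi) = u\<^sub>x\<^sub>x t x"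
proof -
  show 0: "u t (x + 2 * pi) = u t x" for x
    using Y_periodic[OF assms] U_adm(1) assms(1) by (simp add: u_def admissible_def function_on_def)
  show 1: "u\<^sub>x t (x + 2 * pi) = u\<^sub>x t x" for x
    by (rule derivative_periodic[OF u_deriv(1)[OF assms(2,3)], of 0]) (simp add: 0)
  show "u\<^sub>x\<^sub>x t (x + 2 * pi) = u\<^sub>x\<^sub>x t x"
    by (rule derivative_periodic[OF u_deriv(2)[OF assms(2,3)], of 0]) (simp add: 1)
qed

lemma u_support:
  assumes "\<Omega> = Line"
  shows "\<exists>\<rho>. \<forall>t x. 0 \<le> t \<longrightarrow> t < 1 \<longrightarrow> \<bar>x\<bar> > \<rho> \<longrightarrow> u t x = 0 \<and> u\<^sub>x t x = 0 \<and> u\<^sub>x\<^sub>x t x = 0"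
proof -
  obtain a b c where abc: "\<And>x. \<bar>x\<bar> > a \<Longrightarrow> U x = 0" "\<And>x. \<bar>x\<bar> > b \<Longrightarrow> U' x = 0" "\<And>x. \<bar>x\<bar> > c \<Longrightarrow> U'' x = 0"
    using U_adm assms by (auto simp: admissible_def)
  obtain C where C: "\<And>t \<theta>. 0 \<le> t \<Longrightarrow> t \<le> 1 \<Longrightarrow> \<bar>X t \<theta> - \<theta>\<bar> \<le> C" using X_near_id by blast
  have "u t x = 0 \<and> u\<^sub>x t x = 0 \<and> u\<^sub>x\<^sub>x t x = 0" if "0 \<le> t" "t < 1" "\<bar>x\<bar> > \<bar>a\<bar> + \<bar>b\<bar> + \<bar>c\<bar> + C" for t x
  proof -
    have "\<bar>x - Y t x\<bar> \<le> C" using C[of t "Y t x"] X_Y[OF that(1,2)] that by simp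
    then have "\<bar>Y t x\<bar> > \<bar>a\<bar> + \<bar>b\<bar> + \<bar>c\<bar>" using that(3) by linarith
    then show ?thesis using abc[of "Y t x"] by (simp add: u_def u\<^sub>x_def u\<^sub>x\<^sub>x_def)
  qed
  then show ?thesis by blast
qed

lemma u_admissible:
  assumes "0 \<le> t" "t < 1"
  shows "admissible \<Omega> (u t)" "admissible \<Omega> (u\<^sub>x t)" "admissible \<Omega> (u\<^sub>x\<^sub>x t)"
proof -
  have c: "continuous_on UNIV (u t)" "continuous_on UNIV (u\<^sub>x t)" "continuous_on UNIV (u\<^sub>x\<^sub>x t)"
    by (rule continuous_slice[OF continuous_u(1) assms] continuous_slice[OF continuous_u(2) assms] continuous_slice[OF continuous_u(3) assms])+
  have s: "\<exists>\<rho>. \<forall>x. \<bar>x\<bar> > \<rho> \<longrightarrow> u t x = 0 \<and> u\<^sub>x t x = 0 \<and> u\<^sub>x\<^sub>x t x = 0" if "\<Omega> = Line"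
    using u_support[OF that] assms by blast
  show "admissible \<Omega> (u t)" "admissible \<Omega> (u\<^sub>x t)" "admissible \<Omega> (u\<^sub>x\<^sub>x t)"
    using c s u_periodic[OF _ assms] unfolding admissible_def function_on_def
    by (cases \<Omega>; force)+
qed

text \<open>
  Integrals over a fixed compact interval depend continuously on a parameter on which the integrand
  depends jointly continuously.
\<close>

lemma square_distance_tendsto_0:
  assumes "continuous_on strip (\<lambda>p. f (fst p) (snd p) :: real)" "0 \<le> t" "t < 1"
  shows "((\<lambda>s. LINT x:{a..b}|lborel. (f s x - f t x)\<^sup>2) \<longlongrightarrow> 0) (at t within {0..<1})"
proof -
  have c: "continuous_on ({0..<1} \<times> {a..b}) (\<lambda>(s, x). (f s x - f t x)\<^sup>2)"
  proof -
    have "continuous_on ({0..<1} \<times> {a..b}) (\<lambda>p. f (fst p) (snd p))"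
      by (rule continuous_on_subset[OF assms(1)]) auto
    moreover have "continuous_on ({0..<1} \<times> {a..b}) (\<lambda>p. f t (snd p))"
      by (rule continuous_on_compose2[OF continuous_slice[OF assms]]) (auto intro!: continuous_intros)
    ultimately show ?thesis unfolding case_prod_unfold by (intro continuous_intros)
  qed
  have ci: "continuous_on {0..<1} (\<lambda>s. integral (cbox a b) (\<lambda>x. (f s x - f t x)\<^sup>2))"
    by (rule integral_continuous_on_param) (use c in simp)
  have "((\<lambda>s. integral {a..b} (\<lambda>x. (f s x - f t x)\<^sup>2)) \<longlongrightarrow> integral {a..b} (\<lambda>x. (f t x - f t x)\<^sup>2)) (at t within {0..<1})"
    using ci[unfolded continuous_on_def, rule_format, of t] assms(2,3) by simp
  moreover have "\<forall>\<^sub>F s in at t within {0..<1}. integral {a..b} (\<lambda>x. (f s x - f t x)\<^sup>2) = (LINT x:{a..b}|lborel. (f s x - f t x)\<^sup>2)"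
  proof -
    have "\<forall>\<^sub>F s in at t within {0..<1}. s \<in> {0..<1}" by (simp add: eventually_at_filter)
    then show ?thesis
    proof eventually_elim
      case (elim s)
      have "set_integrable lborel {a..b} (\<lambda>x. (f s x - f t x)\<^sup>2)"
        using elim assms
        by (intro borel_integrable_atLeastAtMost' continuous_intros continuous_on_subset[OF continuous_slice[OF assms(1)]]) auto
      then show ?case by (simp add: set_borel_integral_eq_integral(2))
    qed
  qed
  ultimately show ?thesis by (rule_tac Lim_transform_eventually) simp_all
qed

text \<open>
  On the line all \<open>u t\<close> vanish outside one bounded interval, because the characteristics travel a bounded
  distance.
\<close>

lemma cell_reduction:
  "\<exists>a b. \<forall>f\<in>{u, u\<^sub>x, u\<^sub>x\<^sub>x}. \<forall>s\<in>{0..<1}. \<forall>t\<in>{0..<1}.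
    (LINT x:cell \<Omega>|lborel. (f s x - f t x)\<^sup>2) = (LINT x:{a..b}|lborel. (f s x - f t x)\<^sup>2)"
proof (cases \<Omega>)
  case Torus
  then show ?thesis by (intro exI[of _ "-pi"] exI[of _ pi]) (simp add: cell_def)
next
  case Line
  obtain \<rho> where \<rho>: "\<And>t x. 0 \<le> t \<Longrightarrow> t < 1 \<Longrightarrow> \<bar>x\<bar> > \<rho> \<Longrightarrow> u t x = 0 \<and> u\<^sub>x t x = 0 \<and> u\<^sub>x\<^sub>x t x = 0"
    using u_support[OF Line] by blast
  have out: "\<bar>x\<bar> > \<rho>" if "x \<notin> {-\<rho>..\<rho>}" for x using that by (auto simp: abs_le_iff not_le[symmetric])
  show ?thesis
    unfolding Line cell_def spatial_domain.case
    by (rule exI[of _ "-\<rho>"], rule exI[of _ \<rho>], intro ballI set_integral_support) (use \<rho>[OF _ _ out] in auto)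
qed

lemma u_continuous_in_H2:
  assumes "0 \<le> t" "t < 1"
  shows "((\<lambda>s. H2_norm \<Omega> (\<lambda>x. u s x - u t x)) \<longlongrightarrow> 0) (at t within {0..<1})"
proof -
  obtain a b where ab: "\<forall>f\<in>{u, u\<^sub>x, u\<^sub>x\<^sub>x}. \<forall>s\<in>{0..<1}. \<forall>t\<in>{0..<1}.
    (LINT x:cell \<Omega>|lborel. (f s x - f t x)\<^sup>2) = (LINT x:{a..b}|lborel. (f s x - f t x)\<^sup>2)"
    using cell_reduction by blast
  let ?I = "\<lambda>f s. LINT x:{a..b}|lborel. (f s x - f t x)\<^sup>2"
  have "((\<lambda>s. sqrt (?I u s + ?I u\<^sub>x s + ?I u\<^sub>x\<^sub>x s)) \<longlongrightarrow> sqrt (0 + 0 + 0)) (at t within {0..<1})"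
    by (intro tendsto_intros square_distance_tendsto_0 continuous_u assms)
  moreover have "\<forall>\<^sub>F s in at t within {0..<1}. sqrt (?I u s + ?I u\<^sub>x s + ?I u\<^sub>x\<^sub>x s) = H2_norm \<Omega> (\<lambda>x. u s x - u t x)"
  proof -
    have "\<forall>\<^sub>F s in at t within {0..<1}. s \<in> {0..<1}" by (simp add: eventually_at_filter)
    then show ?thesis
    proof eventually_elim
      case (elim s)
      then have s: "0 \<le> s" "s < 1" by auto
      have "H2_norm \<Omega> (\<lambda>x. u s x - u t x) = sqrt ((LINT x:cell \<Omega>|lborel. (u s x - u t x)\<^sup>2)
         + (LINT x:cell \<Omega>|lborel. (u\<^sub>x s x - u\<^sub>x t x)\<^sup>2) + (LINT x:cell \<Omega>|lborel. (u\<^sub>x\<^sub>x s x - u\<^sub>x\<^sub>x t x)\<^sup>2))"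
        by (rule C2_in_H2(2)) (intro admissible_diff u_admissible DERIV_diff u_deriv s assms)+
      then show ?case using ab s assms by simp
    qed
  qed
  ultimately show ?thesis by (rule_tac Lim_transform_eventually) simp_all
qed

lemma u_solution:
  assumes "min \<nu> \<alpha> = 0" shows "H2_solution \<Omega> M \<nu> \<alpha> (u 0) 1 u"
  unfolding H2_solution_def
proof (intro conjI ballI allI)
  show "u t \<in> H2 \<Omega>" if "t \<in> {0..<1}" for t
    using that by (intro C2_in_H2(1)[of _ _ "u\<^sub>x t" "u\<^sub>x\<^sub>x t"] u_admissible u_deriv) auto
  show "((\<lambda>s. H2_norm \<Omega> (\<lambda>x. u s x - u t x)) \<longlongrightarrow> 0) (at t within {0..<1})" if "t \<in> {0..<1}" for t
    using that by (intro u_continuous_in_H2) auto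
  fix t x :: real assume t: "t \<in> {0<..<1}"
  have adm: "admissible \<Omega> (u t)" using t by (intro u_admissible) auto
  have "\<nu> * frac_laplacian \<Omega> \<alpha> (u t) x = \<nu> * u t x"
    by (rule damping_term[OF assms admissible_L2[OF adm]]) (use adm in \<open>simp add: admissible_def\<close>)
  moreover have "((\<lambda>y. flux M (u t y)) has_real_derivative speed M (u t x) * u\<^sub>x t x) (at x)"
    using t by (intro DERIV_chain2[OF flux_derivative[OF M_pos]] u_deriv) auto
  moreover have "((\<lambda>s. u s x) has_real_derivative - \<nu> * u t x - speed M (u t x) * u\<^sub>x t x) (at t)"
    using t by (intro u_time_deriv) auto
  ultimately show "\<exists>u\<^sub>t F\<^sub>x. ((\<lambda>s. u s x) has_real_derivative u\<^sub>t) (at t) \<and>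
      ((\<lambda>y. flux M (u t y)) has_real_derivative F\<^sub>x) (at x) \<and> u\<^sub>t + F\<^sub>x = - \<nu> * frac_laplacian \<Omega> \<alpha> (u t) x"
    by (rule_tac exI[of _ "- \<nu> * u t x - speed M (u t x) * u\<^sub>x t x"], rule_tac exI[of _ "speed M (u t x) * u\<^sub>x t x"]) auto
qed simp

end

section \<open>Uniqueness\<close>

lemma continuous_on_strip:
  fixes f :: "real \<Rightarrow> real \<Rightarrow> real"
  assumes slice: "\<And>t. t \<in> S \<Longrightarrow> continuous_on UNIV (f t)"
    and unif: "\<And>s t x. s \<in> S \<Longrightarrow> t \<in> S \<Longrightarrow> \<bar>f s x - f t x\<bar> \<le> N s t"
    and N: "\<And>t. t \<in> S \<Longrightarrow> ((\<lambda>s. N s t) \<longlongrightarrow> 0) (at t within S)"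
  shows "continuous_on (S \<times> UNIV) (\<lambda>p. f (fst p) (snd p))"
  unfolding continuous_on_iff
proof (intro ballI allI impI)
  fix p :: "real \<times> real" and e :: real assume p: "p \<in> S \<times> UNIV" and e: "e > 0"
  obtain t x where tx: "p = (t, x)" "t \<in> S" using p by (cases p) auto
  have "\<forall>\<^sub>F s in at t within S. N s t < e / 2" using N[OF tx(2)] e by (intro order_tendstoD(2)) auto
  then obtain d1 where d1: "d1 > 0" "\<And>s. s \<in> S \<Longrightarrow> s \<noteq> t \<Longrightarrow> dist s t < d1 \<Longrightarrow> N s t < e / 2"
    by (auto simp: eventually_at)
  obtain d2 where d2: "d2 > 0" "\<And>y. dist y x < d2 \<Longrightarrow> dist (f t y) (f t x) < e / 2"
    using slice[OF tx(2)] e unfolding continuous_on_iff by (meson UNIV_I half_gt_zero)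
  show "\<exists>d>0. \<forall>p'\<in>S \<times> UNIV. dist p' p < d \<longrightarrow> dist (f (fst p') (snd p')) (f (fst p) (snd p)) < e"
  proof (intro exI[of _ "min d1 d2"] conjI ballI impI)
    fix p' :: "real \<times> real" assume p': "p' \<in> S \<times> UNIV" "dist p' p < min d1 d2"
    obtain s y where sy: "p' = (s, y)" "s \<in> S" using p' by (cases p') auto
    have dst: "dist s t < d1" "dist y x < d2"
      using p'(2) dist_fst_le[of p' p] dist_snd_le[of p' p] by (auto simp: sy tx)
    have "\<bar>f s y - f t y\<bar> < e / 2"
      using unif[OF sy(2) tx(2), of y] d1(2)[OF sy(2) _ dst(1)] e by (cases "s = t") auto
    moreover have "\<bar>f t y - f t x\<bar> < e / 2" using d2(2)[OF dst(2)] by (simp add: dist_real_def)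
    ultimately show "dist (f (fst p') (snd p')) (f (fst p) (snd p)) < e"
      using abs_triangle_ineq[of "f s y - f t y" "f t y - f t x"] by (simp add: sy tx dist_real_def)
  qed (use d1 d2 in auto)
qed

lemma Gronwall_zero:
  fixes m :: "real \<Rightarrow> real"
  assumes "0 < b" and "continuous_on {0..b} m" and "m 0 = 0"
    and der: "\<And>t. 0 < t \<Longrightarrow> t < b \<Longrightarrow> (m has_real_derivative m' t) (at t)"
    and bound: "\<And>t. 0 < t \<Longrightarrow> t < b \<Longrightarrow> m t * m' t \<le> C * (m t)\<^sup>2"
  shows "m b = 0"
proof -
  define g where "g t = exp (- 2 * C * t) * (m t)\<^sup>2" for t
  have "g b \<le> g 0"
  proof (rule DERIV_nonpos_imp_decreasing_open[of 0 b g])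
    show "0 \<le> b" using assms(1) by simp
    show "continuous_on {0..b} g" unfolding g_def[abs_def] by (intro continuous_intros assms(2))
    fix t assume t: "0 < t" "t < b"
    have e: "((\<lambda>t. exp (- 2 * C * t)) has_real_derivative - 2 * C * exp (- 2 * C * t)) (at t)"
      by (auto intro!: derivative_eq_intros)
    have s: "((\<lambda>t. (m t)\<^sup>2) has_real_derivative 2 * m t * m' t) (at t)"
      using DERIV_power[OF der[OF t], of 2] by (simp add: mult_ac)
    have "(g has_real_derivative - 2 * C * exp (- 2 * C * t) * (m t)\<^sup>2 + 2 * m t * m' t * exp (- 2 * C * t)) (at t)"
      unfolding g_def[abs_def] by (rule DERIV_mult[OF e s])
    moreover have "- 2 * C * exp (- 2 * C * t) * (m t)\<^sup>2 + 2 * m t * m' t * exp (- 2 * C * t)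
        = 2 * exp (- 2 * C * t) * (m t * m' t - C * (m t)\<^sup>2)" by (simp add: algebra_simps)
    moreover have "\<dots> \<le> 0" using bound[OF t] by (intro mult_nonneg_nonpos) auto
    ultimately show "\<exists>y. (g has_real_derivative y) (at t) \<and> y \<le> 0" by auto
  qed
  then have "(m b)\<^sup>2 \<le> 0" using assms(3) by (simp add: g_def mult_le_0_iff)
  then show ?thesis by simp
qed

text \<open>
  The increment is split into one in \<open>x\<close> at the time \<open>s\<close>, to which the mean value theorem applies and whose
  derivative converges by joint continuity, and one in time at the fixed position \<open>\<gamma> t\<close>.
\<close>

lemma derivative_along_curve:
  fixes v v\<^sub>x :: "real \<Rightarrow> real \<Rightarrow> real"
  assumes "0 < t" "t < 1"
    and vx: "\<And>s x. 0 < s \<Longrightarrow> s < 1 \<Longrightarrow> (v s has_real_derivative v\<^sub>x s x) (at x)"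
    and cont: "continuous_on ({0..<1} \<times> UNIV) (\<lambda>p. v\<^sub>x (fst p) (snd p))"
    and vt: "((\<lambda>s. v s (\<gamma> t)) has_real_derivative d) (at t)"
    and \<gamma>: "(\<gamma> has_real_derivative \<gamma>') (at t)"
  shows "((\<lambda>s. v s (\<gamma> s)) has_real_derivative v\<^sub>x t (\<gamma> t) * \<gamma>' + d) (at t)"
proof -
  have "\<exists>\<xi>. 0 < s \<longrightarrow> s < 1 \<longrightarrow> \<bar>\<xi> - \<gamma> t\<bar> \<le> \<bar>\<gamma> s - \<gamma> t\<bar> \<and> v s (\<gamma> s) - v s (\<gamma> t) = (\<gamma> s - \<gamma> t) * v\<^sub>x s \<xi>" for s
  proof (cases "0 < s \<and> s < 1")
    case True
    consider "\<gamma> s = \<gamma> t" | "\<gamma> s < \<gamma> t" | "\<gamma> t < \<gamma> s" by linarith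
    then show ?thesis
    proof cases
      case 2
      from MVT2[OF this vx] True obtain \<xi> where \<xi>: "\<gamma> s < \<xi>" "\<xi> < \<gamma> t"
        "v s (\<gamma> t) - v s (\<gamma> s) = (\<gamma> t - \<gamma> s) * v\<^sub>x s \<xi>" by blast
      then have "v s (\<gamma> s) - v s (\<gamma> t) = (\<gamma> s - \<gamma> t) * v\<^sub>x s \<xi>" by (simp add: algebra_simps)
      with \<xi> show ?thesis by (intro exI[of _ \<xi>]) auto
    next
      case 3
      from MVT2[OF this vx] True obtain \<xi> where "\<gamma> t < \<xi>" "\<xi> < \<gamma> s"
        "v s (\<gamma> s) - v s (\<gamma> t) = (\<gamma> s - \<gamma> t) * v\<^sub>x s \<xi>" by blast
      then show ?thesis by (intro exI[of _ \<xi>]) auto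
    qed auto
  qed auto
  then obtain \<xi> where \<xi>: "\<And>s. 0 < s \<Longrightarrow> s < 1 \<Longrightarrow> \<bar>\<xi> s - \<gamma> t\<bar> \<le> \<bar>\<gamma> s - \<gamma> t\<bar>"
    "\<And>s. 0 < s \<Longrightarrow> s < 1 \<Longrightarrow> v s (\<gamma> s) - v s (\<gamma> t) = (\<gamma> s - \<gamma> t) * v\<^sub>x s (\<xi> s)" by metis
  have in01: "\<forall>\<^sub>F s in at t. s \<in> {0<..<1}" using assms(1,2) by (intro eventually_at_in_open') auto
  have \<gamma>lim: "(\<gamma> \<longlongrightarrow> \<gamma> t) (at t)" using DERIV_isCont[OF \<gamma>] by (simp add: isCont_def)
  have "((\<lambda>s. \<xi> s - \<gamma> t) \<longlongrightarrow> 0) (at t)"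
  proof (rule Lim_null_comparison)
    show "\<forall>\<^sub>F s in at t. norm (\<xi> s - \<gamma> t) \<le> \<bar>\<gamma> s - \<gamma> t\<bar>" using in01 by eventually_elim (use \<xi>(1) in auto)
    show "((\<lambda>s. \<bar>\<gamma> s - \<gamma> t\<bar>) \<longlongrightarrow> 0) (at t)" using \<gamma>lim by (intro tendsto_rabs_zero) (simp add: LIM_zero_iff)
  qed
  then have \<xi>lim: "(\<xi> \<longlongrightarrow> \<gamma> t) (at t)" by (simp add: LIM_zero_iff)
  have vlim: "((\<lambda>s. v\<^sub>x s (\<xi> s)) \<longlongrightarrow> v\<^sub>x t (\<gamma> t)) (at t)"
  proof -
    have "((\<lambda>s. (s, \<xi> s)) \<longlongrightarrow> (t, \<gamma> t)) (at t)" by (intro tendsto_intros \<xi>lim)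
    moreover have "\<forall>\<^sub>F s in at t. (s, \<xi> s) \<in> {0..<1} \<times> UNIV" using in01 by eventually_elim auto
    ultimately show ?thesis using continuous_on_tendsto_compose[OF cont, of "\<lambda>s. (s, \<xi> s)" "(t, \<gamma> t)" "at t"] assms(1,2) by simp
  qed
  have "((\<lambda>s. v\<^sub>x s (\<xi> s) * ((\<gamma> s - \<gamma> t) / (s - t)) + (v s (\<gamma> t) - v t (\<gamma> t)) / (s - t)) \<longlongrightarrow> v\<^sub>x t (\<gamma> t) * \<gamma>' + d) (at t)"
    using vt \<gamma> by (intro tendsto_intros vlim) (simp_all add: has_field_derivative_iff)
  moreover have "\<forall>\<^sub>F s in at t. v\<^sub>x s (\<xi> s) * ((\<gamma> s - \<gamma> t) / (s - t)) + (v s (\<gamma> t) - v t (\<gamma> t)) / (s - t)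
      = (v s (\<gamma> s) - v t (\<gamma> t)) / (s - t)"
    using in01
  proof eventually_elim
    case (elim s)
    then have "v s (\<gamma> s) - v t (\<gamma> t) = v\<^sub>x s (\<xi> s) * (\<gamma> s - \<gamma> t) + (v s (\<gamma> t) - v t (\<gamma> t))" using \<xi>(2)[of s] by (simp add: mult.commute)
    then show ?case by (simp only: add_divide_distrib times_divide_eq_right)
  qed
  ultimately show ?thesis unfolding has_field_derivative_iff by (rule Lim_transform_eventually)
qed

context shock
begin

text \<open>
  The competitor \<open>v\<close> is followed along a characteristic of \<open>u\<close>, not of \<open>v\<close>; so no differential equation has to
  be solved. Continuity in \<open>H\<^sup>2\<close> and the Sobolev embedding make \<open>v\<close> and \<open>v\<^sub>x\<close> jointly continuous, hence bounded
  along the curve up to the time considered.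
\<close>

lemma solution_unique:
  assumes "min \<nu> \<alpha> = 0" and sol: "H2_solution \<Omega> M \<nu> \<alpha> (u 0) 1 v" and t1: "0 \<le> t\<^sub>1" "t\<^sub>1 < 1"
  shows "v t\<^sub>1 = u t\<^sub>1"
proof (cases "t\<^sub>1 = 0")
  case True
  then show ?thesis using sol by (simp add: H2_solution_def)
next
  case False
  then have t1_pos: "0 < t\<^sub>1" using t1 by simp
  have vH: "v t \<in> H2 \<Omega>" if "t \<in> {0..<1}" for t using sol that by (simp add: H2_solution_def)
  have v0: "v 0 = u 0" using sol by (simp add: H2_solution_def)
  define N where "N s t = H2_norm \<Omega> (\<lambda>x. v s x - v t x)" for s t
  have Nlim: "((\<lambda>s. N s t) \<longlongrightarrow> 0) (at t within {0..<1})" if "t \<in> {0..<1}" for t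
    using sol that by (simp add: H2_solution_def N_def)
  define v\<^sub>x where "v\<^sub>x t = deriv (v t)" for t
  obtain C where C: "C > 0" "\<And>z. z \<in> H2 \<Omega> \<Longrightarrow> (\<forall>x. \<bar>z x\<bar> \<le> C * H2_norm \<Omega> z) \<and>
     (\<forall>x. (z has_real_derivative deriv z x) (at x) \<and> \<bar>deriv z x\<bar> \<le> C * H2_norm \<Omega> z) \<and> continuous_on UNIV (deriv z)"
    using Sobolev_embedding by metis
  have vx: "(v t has_real_derivative v\<^sub>x t x) (at x)" if "t \<in> {0..<1}" for t x
    using C(2)[OF vH[OF that]] by (simp add: v\<^sub>x_def)
  have close: "\<bar>v s x - v t x\<bar> \<le> C * N s t" "\<bar>v\<^sub>x s x - v\<^sub>x t x\<bar> \<le> C * N s t" if st: "s \<in> {0..<1}" "t \<in> {0..<1}" for s t x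
  proof -
    note S = C(2)[OF H2_diff[OF vH[OF st(1)] vH[OF st(2)]]]
    show "\<bar>v s x - v t x\<bar> \<le> C * N s t" using S by (simp add: N_def)
    have "deriv (\<lambda>x. v s x - v t x) x = v\<^sub>x s x - v\<^sub>x t x"
      by (rule DERIV_imp_deriv, rule DERIV_diff[OF vx[OF st(1)] vx[OF st(2)]])
    then show "\<bar>v\<^sub>x s x - v\<^sub>x t x\<bar> \<le> C * N s t" using S by (metis N_def)
  qed
  have CN: "((\<lambda>s. C * N s t) \<longlongrightarrow> 0) (at t within {0..<1})" if "t \<in> {0..<1}" for t
    using tendsto_mult_left[OF Nlim[OF that], of C] by simp
  have v_cont: "continuous_on strip (\<lambda>p. v (fst p) (snd p))"
    by (rule continuous_on_strip[OF _ close(1) CN]) (use vH in \<open>auto simp: H2_def\<close>)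
  have vx_cont: "continuous_on strip (\<lambda>p. v\<^sub>x (fst p) (snd p))"
    by (rule continuous_on_strip[OF _ close(2) CN]) (use C(2)[OF vH] in \<open>auto simp: v\<^sub>x_def\<close>)
  have along: "v t\<^sub>1 (X t\<^sub>1 \<theta>) = exp (- \<nu> * t\<^sub>1) * U \<theta>" for \<theta>
  proof -
    define e where "e t = exp (- \<nu> * t) * U \<theta>" for t
    define m where "m t = v t (X t \<theta>) - e t" for t
    have path: "continuous_on {0..t\<^sub>1} (\<lambda>t. (t, X t \<theta>))" "(\<lambda>t. (t, X t \<theta>)) ` {0..t\<^sub>1} \<subseteq> strip"
      using t1 by (auto intro!: continuous_intros continuous_comp)
    have cv: "continuous_on {0..t\<^sub>1} (\<lambda>t. v t (X t \<theta>))" and cvx: "continuous_on {0..t\<^sub>1} (\<lambda>t. v\<^sub>x t (X t \<theta>))"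
      using continuous_on_compose2[OF v_cont path] continuous_on_compose2[OF vx_cont path] by simp_all
    have ce: "continuous_on {0..t\<^sub>1} e" unfolding e_def[abs_def] by (intro continuous_intros)
    obtain b where b: "\<And>t. t \<in> {0..t\<^sub>1} \<Longrightarrow> \<bar>v t (X t \<theta>)\<bar> \<le> b"
      using compact_imp_bounded[OF compact_continuous_image[OF cv]] by (force simp: bounded_iff)
    obtain b' where b': "\<And>t. t \<in> {0..t\<^sub>1} \<Longrightarrow> \<bar>e t\<bar> \<le> b'"
      using compact_imp_bounded[OF compact_continuous_image[OF ce]] by (force simp: bounded_iff)
    obtain A where A: "\<And>t. t \<in> {0..t\<^sub>1} \<Longrightarrow> \<bar>v\<^sub>x t (X t \<theta>)\<bar> \<le> A"
      using compact_imp_bounded[OF compact_continuous_image[OF cvx]] by (force simp: bounded_iff)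
    define R where "R = max b b'"
    have "continuous_on {-R..R} (speed' M)" by (rule continuous_on_subset[OF continuous_speed(4)[OF M_pos]]) simp
    then obtain L where L: "\<And>z. z \<in> {-R..R} \<Longrightarrow> \<bar>speed' M z\<bar> \<le> L"
      using compact_imp_bounded[OF compact_continuous_image[of "{-R..R}" "speed' M"]] by (force simp: bounded_iff)
    have Lip: "\<bar>speed M p - speed M q\<bar> \<le> L * \<bar>p - q\<bar>" if "p \<in> {-R..R}" "q \<in> {-R..R}" for p q
      using field_differentiable_bound[of "{-R..R}" "speed M" "speed' M" L p q] that L
        speed_derivative(1)[OF M_pos, THEN has_field_derivative_at_within] by simp
    have "m t\<^sub>1 = 0"
    proof (rule Gronwall_zero[OF t1_pos, where C = "A * L"])
      show "continuous_on {0..t\<^sub>1} m" unfolding m_def[abs_def] by (intro continuous_intros cv ce)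
      show "m 0 = 0" using Y_X[of 0 \<theta>] by (simp add: m_def e_def v0 u_def)
      fix t assume t: "0 < t" "t < t\<^sub>1"
      then have t': "t \<in> {0..<1}" "t \<in> {0<..<1}" "t \<in> {0..t\<^sub>1}" using t1 by auto
      let ?x = "X t \<theta>"
      obtain d F where dF: "((\<lambda>s. v s ?x) has_real_derivative d) (at t)"
        "((\<lambda>y. flux M (v t y)) has_real_derivative F) (at ?x)" "d + F = - \<nu> * frac_laplacian \<Omega> \<alpha> (v t) ?x"
        using sol t'(2) unfolding H2_solution_def by blast
      have "F = speed M (v t ?x) * v\<^sub>x t ?x"
        by (rule DERIV_unique[OF dF(2) DERIV_chain2[OF flux_derivative[OF M_pos] vx[OF t'(1)]]])
      moreover have "\<nu> * frac_laplacian \<Omega> \<alpha> (v t) ?x = \<nu> * v t ?x"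
        by (rule damping_term[OF assms(1)]) (use vH[OF t'(1)] in \<open>auto simp: H2_def\<close>)
      ultimately have d: "d = - \<nu> * v t ?x - speed M (v t ?x) * v\<^sub>x t ?x" using dF(3) by auto
      have 1: "((\<lambda>s. v s (X s \<theta>)) has_real_derivative v\<^sub>x t ?x * speed M (e t) + d) (at t)"
      proof (rule derivative_along_curve[where v = v and \<gamma> = "\<lambda>s. X s \<theta>", OF _ _ _ vx_cont dF(1)])
        show "(v s has_real_derivative v\<^sub>x s x) (at x)" if "0 < s" "s < 1" for s x using that by (intro vx) simp
        show "((\<lambda>s. X s \<theta>) has_real_derivative speed M (e t)) (at t)" using X_time_deriv by (simp add: e_def)
      qed (use t' in auto)
      have 2: "(e has_real_derivative - \<nu> * e t) (at t)"
        unfolding e_def[abs_def] by (auto intro!: derivative_eq_intros)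
      show "(m has_real_derivative v\<^sub>x t ?x * (speed M (e t) - speed M (v t ?x)) - \<nu> * m t) (at t)"
        unfolding m_def[abs_def] using DERIV_diff[OF 1 2] by (rule DERIV_cong) (simp add: d m_def algebra_simps)
      have "\<bar>speed M (e t) - speed M (v t ?x)\<bar> \<le> L * \<bar>e t - v t ?x\<bar>"
        using b[OF t'(3)] b'[OF t'(3)] by (intro Lip) (auto simp: R_def abs_le_iff)
      then have sp: "\<bar>speed M (e t) - speed M (v t ?x)\<bar> \<le> L * \<bar>m t\<bar>" by (simp add: m_def abs_minus_commute)
      have "m t * (v\<^sub>x t ?x * (speed M (e t) - speed M (v t ?x))) \<le> \<bar>m t\<bar> * (\<bar>v\<^sub>x t ?x\<bar> * \<bar>speed M (e t) - speed M (v t ?x)\<bar>)"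
        using abs_ge_self[of "m t * (v\<^sub>x t ?x * (speed M (e t) - speed M (v t ?x)))"] by (simp add: abs_mult)
      also have "\<dots> \<le> \<bar>m t\<bar> * (A * (L * \<bar>m t\<bar>))"
        using A[OF t'(3)] sp by (intro mult_left_mono mult_mono) (auto intro: order_trans[OF abs_ge_zero])
      also have "\<dots> = A * L * (m t)\<^sup>2" by (simp add: power2_eq_square mult_ac)
      finally have "m t * (v\<^sub>x t ?x * (speed M (e t) - speed M (v t ?x))) \<le> A * L * (m t)\<^sup>2" .
      moreover have "0 \<le> \<nu> * (m t * m t)" using nu_nonneg by simp
      ultimately show "m t * (v\<^sub>x t ?x * (speed M (e t) - speed M (v t ?x)) - \<nu> * m t) \<le> A * L * (m t)\<^sup>2"
        by (simp add: right_diff_distrib mult_ac)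
    qed
    then show ?thesis by (simp add: m_def e_def)
  qed
  show ?thesis
  proof
    fix x
    show "v t\<^sub>1 x = u t\<^sub>1 x" using along[of "Y t\<^sub>1 x"] X_Y[OF t1] by (simp add: u_def)
  qed
qed

section \<open>Blow-up\<close>

lemma holder_norm_ge:
  assumes "x \<noteq> y" shows "ereal (\<bar>f x - f y\<bar> / \<bar>x - y\<bar> powr \<delta>) \<le> holder_norm \<delta> f"
proof -
  have r: "ereal (\<bar>f x - f y\<bar> / \<bar>x - y\<bar> powr \<delta>) \<le> (SUP (x, y)\<in>{(x, y). x \<noteq> y}. ereal (\<bar>f x - f y\<bar> / \<bar>x - y\<bar> powr \<delta>))"
    by (rule SUP_upper2[of "(x, y)"]) (use assms in auto)
  have s: "0 \<le> (SUP x. ereal \<bar>f x\<bar>)" by (rule SUP_upper2[of 0]) auto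
  show ?thesis unfolding holder_norm_def by (rule add_increasing[OF s r])
qed

text \<open>
  Two characteristics with different values meet at time \<open>1\<close>. Their values stay apart while the
  distance of their positions tends to \<open>0\<close>, so the Hoelder quotient at these positions tends to infinity.
\<close>

lemma u_blowup:
  assumes "\<delta> > 0"
  shows "Limsup (at_left 1) (\<lambda>t. holder_norm \<delta> (u t)) = \<infinity>"
proof -
  obtain a b where ab: "P a = P b" "U a \<noteq> U b" using collapse by blast
  define \<kappa> where "\<kappa> = exp (- \<nu>) * \<bar>U a - U b\<bar>"
  have \<kappa>: "\<kappa> > 0" using ab by (simp add: \<kappa>_def)
  define D where "D t = \<bar>X t a - X t b\<bar>" for t
  have in01: "\<forall>\<^sub>F t in at_left (1::real). t \<in> {0<..<1}" by (intro eventually_at_left_real) simp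
  have Dpos: "D t > 0" if "t \<in> {0<..<1}" for t
  proof -
    have "a \<noteq> b" using ab by auto
    then show ?thesis using X_eq_iff[of t a b] that by (simp add: D_def)
  qed
  have "continuous_on UNIV D" unfolding D_def[abs_def] by (intro continuous_intros continuous_comp)
  then have "(D \<longlongrightarrow> D 1) (at_left 1)"
    by (auto simp: continuous_on_eq_continuous_at isCont_def intro: tendsto_within_subset)
  moreover have "D 1 = 0" using ab by (simp add: D_def X_def \<Gamma>_final)
  ultimately have D0: "(D \<longlongrightarrow> 0) (at_left 1)" by simp
  have "filterlim (\<lambda>t. \<kappa> / D t powr \<delta>) at_top (at_left 1)"
  proof (rule LIM_at_top_divide[OF tendsto_const \<kappa>])
    have "((\<lambda>t. D t powr \<delta>) \<longlongrightarrow> 0 powr \<delta>) (at_left 1)"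
      using in01 assms Dpos by (intro tendsto_powr2 D0 tendsto_const) (auto elim!: eventually_mono intro: less_imp_le)
    then show "((\<lambda>t. D t powr \<delta>) \<longlongrightarrow> 0) (at_left 1)" by simp
    show "\<forall>\<^sub>F t in at_left 1. 0 < D t powr \<delta>" using in01 by eventually_elim (use Dpos in force)
  qed
  then have ev: "\<forall>\<^sub>F t in at_left 1. K \<le> \<kappa> / D t powr \<delta>" for K by (simp add: filterlim_at_top)
  have "ereal K \<le> Limsup (at_left 1) (\<lambda>t. holder_norm \<delta> (u t))" for K
  proof -
    have "\<forall>\<^sub>F t in at_left 1. ereal K \<le> holder_norm \<delta> (u t)"
      using ev[of K] in01
    proof eventually_elim
      case (elim t)
      then have t: "0 \<le> t" "t < 1" by auto
      have ne: "X t a \<noteq> X t b" using Dpos[OF elim(2)] by (auto simp: D_def)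
      have "u t (X t a) - u t (X t b) = exp (- \<nu> * t) * (U a - U b)"
        using Y_X[OF t] by (simp add: u_def algebra_simps)
      then have "\<bar>u t (X t a) - u t (X t b)\<bar> = exp (- \<nu> * t) * \<bar>U a - U b\<bar>" by (simp add: abs_mult)
      also have "\<dots> \<ge> \<kappa>"
        unfolding \<kappa>_def using t nu_nonneg mult_left_mono[of t 1 \<nu>] by (intro mult_right_mono) auto
      finally have "\<kappa> / D t powr \<delta> \<le> \<bar>u t (X t a) - u t (X t b)\<bar> / \<bar>X t a - X t b\<bar> powr \<delta>"
        unfolding D_def by (intro divide_right_mono) auto
      with elim(1) have "ereal K \<le> ereal (\<bar>u t (X t a) - u t (X t b)\<bar> / \<bar>X t a - X t b\<bar> powr \<delta>)" by simp
      also have "\<dots> \<le> holder_norm \<delta> (u t)" by (rule holder_norm_ge[OF ne])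
      finally show ?case .
    qed
    then have "ereal K \<le> Liminf (at_left 1) (\<lambda>t. holder_norm \<delta> (u t))" by (rule Liminf_bounded)
    also have "\<dots> \<le> Limsup (at_left 1) (\<lambda>t. holder_norm \<delta> (u t))" by (rule Liminf_le_Limsup) simp
    finally show ?thesis .
  qed
  then show ?thesis by (rule ereal_top)
qed

lemma finite_time_singularity:
  assumes "min \<nu> \<alpha> = 0" and "\<delta> > 0"
  shows "\<exists>u\<^sub>0\<in>H2 \<Omega>. (\<forall>x. 0 \<le> u\<^sub>0 x \<and> u\<^sub>0 x \<le> 1) \<and>
      (\<exists>T>0. \<exists>u. the_H2_solution \<Omega> M \<nu> \<alpha> u\<^sub>0 T u \<and>
         Limsup (at_left T) (\<lambda>t. holder_norm \<delta> (u t)) = \<infinity>)"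
proof (rule bexI[of _ "u 0"], intro conjI)
  have sol: "the_H2_solution \<Omega> M \<nu> \<alpha> (u 0) 1 u"
    unfolding the_H2_solution_def
  proof (intro conjI allI impI ballI)
    show "H2_solution \<Omega> M \<nu> \<alpha> (u 0) 1 u" by (rule u_solution[OF assms(1)])
    show "v t = u t" if "H2_solution \<Omega> M \<nu> \<alpha> (u 0) 1 v" "t \<in> {0..<1}" for v t
      using that(2) by (intro solution_unique[OF assms(1) that(1)]) simp_all
  qed
  then show "\<exists>T>0. \<exists>u'. the_H2_solution \<Omega> M \<nu> \<alpha> (u 0) T u' \<and>
         Limsup (at_left T) (\<lambda>t. holder_norm \<delta> (u' t)) = \<infinity>"
    by (intro exI[of _ "1 :: real"] conjI exI[of _ u] u_blowup[OF assms(2)]) simp_all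
  show "u 0 \<in> H2 \<Omega>" using u_solution[OF assms(1)] by (simp add: H2_solution_def)
  show "\<forall>x. 0 \<le> u 0 x \<and> u 0 x \<le> 1" using U_range by (simp add: u_def)
qed

end

text \<open>
  The profile is multiplied by a small \<open>\<epsilon>\<close>: its values then lie in the range where the displacement is increasing,
  and \<open>\<epsilon> G \<le> c\<close>, where \<open>G\<close> bounds the derivative of the displacement, gives \<open>G \<epsilon> B' < c (1 + B')\<^sup>2 = P'\<close> where
  \<open>B\<close> does not decrease.
\<close>

lemma shock_exists:
  assumes "M > 0" "\<nu> \<ge> 0"
  shows "\<exists>\<Gamma> \<Gamma>\<^sub>v \<Gamma>\<^sub>v\<^sub>v U U' U'' P P' P''. shock M \<nu> \<Gamma> \<Gamma>\<^sub>v \<Gamma>\<^sub>v\<^sub>v \<Omega> U U' U'' P P' P''"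
proof -
  obtain \<Gamma> \<Gamma>v \<Gamma>vv where disp: "displacement M \<nu> \<Gamma> \<Gamma>v \<Gamma>vv" using displacement_exists[OF assms] by blast
  then interpret displacement M \<nu> \<Gamma> \<Gamma>v \<Gamma>vv .
  obtain B B' B'' P P' P'' c where "collapsing_profile \<Omega> B B' B'' P P' P'' c"
    using collapsing_profile_exists by blast
  then interpret collapsing_profile \<Omega> B B' B'' P P' P'' c .
  obtain a where a: "a > 0" "\<And>t v. 0 \<le> t \<Longrightarrow> t < 1 \<Longrightarrow> 0 \<le> v \<Longrightarrow> v \<le> a \<Longrightarrow> \<Gamma>v t v > 0"
    using \<Gamma>v_pos by blast
  have "compact ((\<lambda>p. \<Gamma>v (fst p) (snd p)) ` ({0..1} \<times> {0..a}))"
    by (intro compact_continuous_image compact_Times continuous_on_subset[OF \<Gamma>v_cont]) auto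
  then obtain G0 where G0: "\<And>t v. 0 \<le> t \<Longrightarrow> t \<le> 1 \<Longrightarrow> 0 \<le> v \<Longrightarrow> v \<le> a \<Longrightarrow> \<bar>\<Gamma>v t v\<bar> \<le> G0"
    using compact_imp_bounded by (fastforce simp: bounded_iff)
  define G where "G = max 1 G0"
  define \<epsilon> where "\<epsilon> = min (a / 4) (min (1 / 4) (c / G))"
  have \<epsilon>: "\<epsilon> > 0" "4 * \<epsilon> \<le> a" "4 * \<epsilon> \<le> 1" "\<epsilon> \<le> c / G"
    using a(1) c_pos by (auto simp: \<epsilon>_def G_def)
  have G: "G \<ge> 1" by (simp add: G_def)
  have \<epsilon>G: "\<epsilon> * G \<le> c" using \<epsilon>(4) G by (simp add: field_simps)
  have UB: "0 \<le> \<epsilon> * B x" "\<epsilon> * B x \<le> a" "\<epsilon> * B x \<le> 1" for x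
  proof -
    have le: "\<epsilon> * B x \<le> \<epsilon> * 4" using B_range(2) \<epsilon>(1) by (intro mult_left_mono) auto
    then show "\<epsilon> * B x \<le> a" "\<epsilon> * B x \<le> 1" using \<epsilon>(2,3) by linarith+
    show "0 \<le> \<epsilon> * B x" using \<epsilon>(1) B_range(1)[of x] by simp
  qed
  have adm: "admissible \<Omega> (\<lambda>x. \<epsilon> * f x)" if "admissible \<Omega> f" for f
    using that by (cases \<Omega>) (auto simp: admissible_def function_on_def intro!: continuous_intros)
  have pos: "P' x - \<Gamma>v t (\<epsilon> * B x) * (\<epsilon> * B' x) > 0" if t: "0 \<le> t" "t < 1" for t x
  proof -
    define g where "g = \<Gamma>v t (\<epsilon> * B x)"
    have g: "0 < g" "g \<le> G"
      using a(2)[OF t UB(1,2)] G0[of t "\<epsilon> * B x"] t UB(1,2)[of x] by (auto simp: g_def G_def)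
    show ?thesis
    proof (cases "B' x < 0")
      case True
      have "0 \<le> P' x" using c_pos by (simp add: P'_eq)
      moreover have "g * (\<epsilon> * B' x) < 0" using True g(1) \<epsilon>(1) by (simp add: mult_pos_neg)
      ultimately show ?thesis by (simp add: g_def)
    next
      case False
      then have "g * (\<epsilon> * B' x) \<le> G * (\<epsilon> * B' x)" using g \<epsilon>(1) by (intro mult_right_mono) auto
      also have "\<dots> = (\<epsilon> * G) * B' x" by simp
      also have "\<dots> \<le> c * B' x" using \<epsilon>G False by (intro mult_right_mono) auto
      also have "\<dots> < c * (1 + B' x)\<^sup>2"
      proof -
        have "B' x < (1 + B' x)\<^sup>2" using False by (simp add: power2_eq_square algebra_simps add_pos_nonneg)
        then show ?thesis using c_pos by simp
      qed
      also have "\<dots> = P' x" using False by (simp add: P'_eq)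
      finally show ?thesis by (simp add: g_def)
    qed
  qed
  have "shock M \<nu> \<Gamma> \<Gamma>v \<Gamma>vv \<Omega> (\<lambda>x. \<epsilon> * B x) (\<lambda>x. \<epsilon> * B' x) (\<lambda>x. \<epsilon> * B'' x) P P' P''"
  proof
    show "((\<lambda>x. \<epsilon> * B x) has_real_derivative \<epsilon> * B' x) (at x)" for x by (rule DERIV_cmult[OF B_deriv(1)])
    show "((\<lambda>x. \<epsilon> * B' x) has_real_derivative \<epsilon> * B'' x) (at x)" for x by (rule DERIV_cmult[OF B_deriv(2)])
    show "\<exists>x y. P x = P y \<and> \<epsilon> * B x \<noteq> \<epsilon> * B y" using collapse \<epsilon>(1) by simp
  qed (fact UB(1,3) pos P_deriv P''_cont P_near_id P_per | intro adm B_adm)+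
  then show ?thesis by (intro exI)
qed

theorem proposition3:
  fixes \<Omega> :: spatial_domain and M \<nu> \<alpha> :: real
  assumes "M > 0" and "\<nu> \<ge> 0" and "\<alpha> \<ge> 0" and "min \<nu> \<alpha> = 0"
  shows "\<forall>\<^sub>F \<delta> in at_right (0::real).
    \<exists>u\<^sub>0\<in>H2 \<Omega>. (\<forall>x. 0 \<le> u\<^sub>0 x \<and> u\<^sub>0 x \<le> 1) \<and>
      (\<exists>T>0. \<exists>u. the_H2_solution \<Omega> M \<nu> \<alpha> u\<^sub>0 T u \<and>
         Limsup (at_left T) (\<lambda>t. holder_norm \<delta> (u t)) = \<infinity>)"
proof -
  obtain \<Gamma> \<Gamma>\<^sub>v \<Gamma>\<^sub>v\<^sub>v U U' U'' P P' P'' where "shock M \<nu> \<Gamma> \<Gamma>\<^sub>v \<Gamma>\<^sub>v\<^sub>v \<Omega> U U' U'' P P' P''"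
    using shock_exists[OF assms(1,2), of \<Omega>] by - (elim exE, rule that)
  note singularity = shock.finite_time_singularity[OF this assms(4)]
  have "\<forall>\<^sub>F \<delta> in at_right 0. (0::real) < \<delta>" by (rule eventually_at_right_less)
  then show ?thesis by eventually_elim (rule singularity)
qed

end
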